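(* Let $\mathcal D\subset\mathbb C^n_*$ be a domain, let $Q_1,\dots,Q_n:\mathcal D\to\mathfrak M_k$ be holomorphic with $\sum_{p=1}^n Q_p(\boldsymbol t)\equiv 0$, and consider the deformation of a Fuchsian equation $$\frac{dY}{dx}=\Big(\sum_{1\le p\le n}\frac{Q_p(\boldsymbol t)}{x-t_p}\Big)Y .$$ Let $x_0\in\overline{\mathbb C}$ and $\boldsymbol t^0\in\mathcal D$ with $t_j^0\ne x_0$ for all $j$. Assume that all the matrices $Q_1(\boldsymbol t^0),\dots,Q_n(\boldsymbol t^0)$ are non-resonant. If the deformation is isomonodromic with respect to $x_0$ at $\boldsymbol t^0$, then it is isoprincipal in the narrow sense with respect to $x_0$ at $\boldsymbol t^0$.
   Context: $\mathfrak M_k$ is the set of complex $k\times k$ matrices, $\overline{\mathbb C}=\mathbb C\cup\{\infty\}$, and $\mathbb C^n_*$ is the set of $\boldsymbol t=(t_1,\dots,t_n)\in\mathbb C^n$ with pairwise distinct coordinates. $D_{a,r}=\{z\in\mathbb C:|z-a|<r\}$ and $\mathsf D(\boldsymbol t^0,\delta)=\prod_{p=1}^nD_{t_p^0,\delta}$; $\delta$ is always so small that $\mathsf D(\boldsymbol t^0,\delta)\subset\mathcal D$. $\mathrm{cov}(X;x)$ is the universal covering of $X$ with distinguished point $x$; its points are pairs (point, homotopy class of a path from $x$ to it). A square matrix is non-resonant if no two of its eigenvalues differ by a nonzero integer. Normalized solution and monodromy. $Y(x,\boldsymbol t)$ is the (multivalued in $x$) solution with $Y(x_0,\boldsymbol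 t)=I$. For a loop $\gamma$ in $\overline{\mathbb C}\setminus\{t_1,\dots,t_n\}$ based at $x_0$, $M_\gamma(\boldsymbol t)$ is the value at the end of $\gamma$ of the analytic continuation of $Y(\cdot,\boldsymbol t)$ along $\gamma$. Isomonodromic at $\boldsymbol t^0$ with respect to $x_0$: for every loop $\gamma\subset\overline{\mathbb C}\setminus\{t_1^0,\dots,t_n^0\}$ based at $x_0$ there is $\delta>0$ (depending on $\boldsymbol t^0,\gamma$, small enough that the $t_j$ stay off $\gamma$) with $M_\gamma(\boldsymbol t)=M_\gamma(\boldsymbol t^0)$ for all $\boldsymbol t\in\mathsf D(\boldsymbol t^0,\delta)$. Coherent continuation. Put $\rho_j(\boldsymbol t^0)=\frac12\min_{p\ne j}|t_j^0-t_p^0|$. Let $0<\rho\le\rho_j(\boldsymbol t^0)$, $0<2\delta<\rho$, let $x_j$ satisfy $\delta<|x_j-t_j^0|<\rho-\delta$, and let $\alpha_j$ be a path from $x_0$ to $x_j$ with $|z-t_p^0|>\delta$ for all $z\in\alpha_j$ and all $p$. Neither $x_j$ nor $\alpha_j$ depends on $\boldsymbol t$. For $\boldsymbol t\in\mathsf D(\boldsymbol t^0,\delta)$, $Y_{\alpha_j}(\cdot,\boldsymbol t)$ is the function on $\mathrm{cov}(D_{t_j,\rho}\setminus\{t_j\};x_j)$ whose value at $(x,\mu)$ is obtained by continuing $Y(\cdot,\boldsymbol t)$ from $x_0$ first along $\alpha_j$ and then along $\mu$. A value $\vartheta_j^0=\arg(x_j-t_j^0)$ is fixed, and for $t_j\in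 D_{t_j^0,\delta}$ one takes $\arg(x_j-t_j)\in(\vartheta_j^0-\pi/2,\vartheta_j^0+\pi/2)$; continuing along $\mu$ determines $\log(x-t_j)$ and hence $(x-t_j)^{A}=e^{A\log(x-t_j)}$ on the covering. Isoprincipal in the narrow sense at $\boldsymbol t^0$ with respect to $x_0$: for every $j=1,\dots,n$, for some $\rho,\delta>0$, some point $x_j$ and some path $\alpha_j$ from $x_0$ to $x_j$ satisfying $0<\rho\le\rho_j(\boldsymbol t^0)$, $0<2\delta<\rho$, $\delta<|x_j-t_j^0|<\rho-\delta$, and $|z-t_p^0|>\delta$ for all $z\in\alpha_j$ and all $p$, $Y_{\alpha_j}(x,\boldsymbol t)=H_{\alpha_j}(x,\boldsymbol t)(x-t_j)^{A_{\alpha_j}}$ for $x\in D_{t_j,\rho}\setminus\{t_j\}$ (as points of the covering), $\boldsymbol t\in\mathsf D(\boldsymbol t^0,\delta)$, where $H_{\alpha_j}(x,\boldsymbol t)$ is (single-valued) holomorphic in $(x,\boldsymbol t)$ with invertible values for $x\in D_{t_j,\rho}$, $\boldsymbol t\in\mathsf D(\boldsymbol t^0,\delta)$, and $A_{\alpha_j}$ is a matrix not depending on $\boldsymbol t$ (nor on $x$). *)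

theory Defs
  imports "HOL-Analysis.Analysis"
begin

section \<open>Matrices\<close>

text \<open>
  The instances of \<^typ>\<open>complex ^ 'k ^ 'k\<close> for the ring classes use the componentwise product, so
  neither \<^term>\<open>(^)\<close> nor \<^term>\<open>exp\<close> of the library is the matrix power or the matrix exponential.
\<close>

definition mat_scale :: "complex \<Rightarrow> complex ^ 'k ^ 'k \<Rightarrow> complex ^ 'k ^ 'k" where
  "mat_scale c A = (\<chi> i j. c * A $ i $ j)"

definition mat_power :: "complex ^ 'k ^ 'k \<Rightarrow> nat \<Rightarrow> complex ^ 'k ^ 'k" where
  "mat_power A m = (((**) A) ^^ m) (mat 1)"

definition mat_exp :: "complex ^ 'k ^ 'k \<Rightarrow> complex ^ 'k ^ 'k" where
  "mat_exp A = (\<Sum>m. mat_power A m /\<^sub>R fact m)"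

definition is_eigenvalue :: "complex ^ 'k ^ 'k \<Rightarrow> complex \<Rightarrow> bool" where
  "is_eigenvalue A z \<longleftrightarrow> (\<exists>v. v \<noteq> 0 \<and> A *v v = z *s v)"

definition non_resonant :: "complex ^ 'k ^ 'k \<Rightarrow> bool" where
  "non_resonant A \<longleftrightarrow>
     (\<forall>z w. is_eigenvalue A z \<and> is_eigenvalue A w \<longrightarrow> (\<forall>m::int. m \<noteq> 0 \<longrightarrow> z - w \<noteq> of_int m))"


section \<open>Holomorphic functions of several variables\<close>

text \<open>
  Complex (Frechet) differentiability at every point of \<open>S\<close>, meant for open \<open>S\<close>. There is no type class
  of complex vector spaces, so the scalar multiplication of the source is a parameter. Matrix-valued
  functions are treated entrywise.
\<close>

definition mv_holomorphic_on ::
    "(complex \<Rightarrow> 'a \<Rightarrow> 'a) \<Rightarrow> ('a::real_normed_vector \<Rightarrow> complex ^ 'k ^ 'k) \<Rightarrow> 'a set \<Rightarrow> bool" where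
  "mv_holomorphic_on scl f S \<longleftrightarrow>
     (\<forall>z\<in>S. \<forall>i j. \<exists>f'. ((\<lambda>w. f w $ i $ j) has_derivative f') (at z) \<and>
                   (\<forall>c v. f' (scl c v) = c * f' v))"

definition vec_holomorphic_on ::
    "(complex ^ 'n \<Rightarrow> complex ^ 'k ^ 'k) \<Rightarrow> (complex ^ 'n) set \<Rightarrow> bool" where
  "vec_holomorphic_on = mv_holomorphic_on (*s)"

definition joint_holomorphic_on ::
    "(complex \<times> (complex ^ 'n) \<Rightarrow> complex ^ 'k ^ 'k) \<Rightarrow> (complex \<times> (complex ^ 'n)) set \<Rightarrow> bool" where
  "joint_holomorphic_on = mv_holomorphic_on (\<lambda>c (x, t). (c * x, c *s t))"


section \<open>The Riemann sphere\<close>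

text \<open>The point at infinity is \<^term>\<open>None\<close>.\<close>

definition riemann_sphere :: "complex option topology" where
  "riemann_sphere = Alexandroff_compactification euclidean"

text \<open>The inverse of the chart \<open>x \<mapsto> 1 / x\<close> around infinity.\<close>

definition at_infinity_chart :: "complex \<Rightarrow> complex option" where
  "at_infinity_chart w = (if w = 0 then None else Some (1 / w))"

definition sphere_holomorphic_on ::
    "(complex option \<Rightarrow> complex ^ 'k ^ 'k) \<Rightarrow> complex option set \<Rightarrow> bool" where
  "sphere_holomorphic_on f U \<longleftrightarrow> openin riemann_sphere U \<and>
     (\<forall>i j. (\<lambda>z. f (Some z) $ i $ j) holomorphic_on {z. Some z \<in> U} \<and>
            (\<lambda>w. f (at_infinity_chart w) $ i $ j) holomorphic_on {w. at_infinity_chart w \<in> U})"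

text \<open>
  The library's \<^term>\<open>(+++)\<close> needs the target type to be in class \<open>topological_space\<close>, which
  \<^typ>\<open>complex option\<close> is not.
\<close>

definition path_join :: "(real \<Rightarrow> 'a) \<Rightarrow> (real \<Rightarrow> 'a) \<Rightarrow> real \<Rightarrow> 'a" where
  "path_join \<alpha> \<beta> s = (if s \<le> 1 / 2 then \<alpha> (2 * s) else \<beta> (2 * s - 1))"

text \<open>
  Analytic continuation along \<open>\<gamma>\<close>: function elements \<open>u s\<close>, each holomorphic on a neighbourhood \<open>U s\<close>
  of \<open>\<gamma> s\<close>, such that for \<open>s'\<close> close to \<open>s\<close> the elements \<open>u s\<close> and \<open>u s'\<close> have the same germ at \<open>\<gamma> s'\<close>.
\<close>

definition analytic_continuation_along ::
    "(real \<Rightarrow> complex option) \<Rightarrow> (real \<Rightarrow> complex option \<Rightarrow> complex ^ 'k ^ 'k) \<Rightarrow>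
     (real \<Rightarrow> complex option set) \<Rightarrow> bool" where
  "analytic_continuation_along \<gamma> u U \<longleftrightarrow>
     (\<forall>s\<in>{0..1}. \<gamma> s \<in> U s \<and> sphere_holomorphic_on (u s) (U s)) \<and>
     (\<forall>s\<in>{0..1}. \<exists>\<epsilon>>0. \<forall>s'\<in>{0..1}. \<bar>s' - s\<bar> < \<epsilon> \<longrightarrow>
        (\<exists>V. openin riemann_sphere V \<and> \<gamma> s' \<in> V \<and> V \<subseteq> U s \<inter> U s' \<and> (\<forall>z\<in>V. u s z = u s' z)))"


section \<open>Deformations of Fuchsian equations\<close>

definition distinct_coords :: "(complex ^ 'n) set" where
  "distinct_coords = {t. \<forall>p q. p \<noteq> q \<longrightarrow> t $ p \<noteq> t $ q}"

definition polydisc :: "complex ^ 'n \<Rightarrow> real \<Rightarrow> (complex ^ 'n) set" where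
  "polydisc t0 \<delta> = {t. \<forall>p. t $ p \<in> ball (t0 $ p) \<delta>}"

text \<open>Half the distance from \<open>t\<^sub>j\<close> to the other \<open>t\<^sub>p\<close>; it is infinite if there are none.\<close>

definition half_gap :: "complex ^ 'n \<Rightarrow> 'n \<Rightarrow> ereal" where
  "half_gap t j = (INF p\<in>{p. p \<noteq> j}. ereal (dist (t $ j) (t $ p) / 2))"

definition fuchsian_coeff ::
    "('n::finite \<Rightarrow> complex ^ 'n \<Rightarrow> complex ^ 'k ^ 'k) \<Rightarrow> complex ^ 'n \<Rightarrow> complex \<Rightarrow> complex ^ 'k ^ 'k" where
  "fuchsian_coeff Q t x = (\<Sum>p\<in>UNIV. mat_scale (1 / (x - t $ p)) (Q p t))"

text \<open>
  If \<open>U\<close> contains infinity, holomorphy of \<open>Y\<close> there together with the equation at the nearby finite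
  points expresses that \<open>Y\<close> solves the equation also at infinity, which is a regular point when the
  residue matrices sum to zero.
\<close>

definition solves_fuchsian_on ::
    "('n::finite \<Rightarrow> complex ^ 'n \<Rightarrow> complex ^ 'k ^ 'k) \<Rightarrow> complex ^ 'n \<Rightarrow>
     (complex option \<Rightarrow> complex ^ 'k ^ 'k) \<Rightarrow> complex option set \<Rightarrow> bool" where
  "solves_fuchsian_on Q t Y U \<longleftrightarrow>
     sphere_holomorphic_on Y U \<and> (\<forall>p. Some (t $ p) \<notin> U) \<and>
     (\<forall>x i j. Some x \<in> U \<longrightarrow>
        ((\<lambda>z. Y (Some z) $ i $ j) has_field_derivative
           (fuchsian_coeff Q t x ** Y (Some x)) $ i $ j) (at x))"

text \<open>
  For a path \<open>\<gamma>\<close> in the sphere that starts at \<open>x0\<close> and avoids all \<open>t\<^sub>p\<close>: the value at the end of \<open>\<gamma>\<close> of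
  the continuation along \<open>\<gamma>\<close> of the local solution \<open>Y\<close> with \<open>Y x0 = I\<close>. For a loop it is the
  monodromy matrix \<open>M\<^sub>\<gamma>(t)\<close>.
\<close>

definition continued_solution ::
    "('n::finite \<Rightarrow> complex ^ 'n \<Rightarrow> complex ^ 'k ^ 'k) \<Rightarrow> complex option \<Rightarrow> complex ^ 'n \<Rightarrow>
     (real \<Rightarrow> complex option) \<Rightarrow> complex ^ 'k ^ 'k" where
  "continued_solution Q x0 t \<gamma> =
     (THE M. \<exists>u U. analytic_continuation_along \<gamma> u U \<and>
                   solves_fuchsian_on Q t (u 0) (U 0) \<and> u 0 x0 = mat 1 \<and> M = u 1 (\<gamma> 1))"

definition isomonodromic_at ::
    "(complex ^ 'n) set \<Rightarrow> ('n::finite \<Rightarrow> complex ^ 'n \<Rightarrow> complex ^ 'k ^ 'k) \<Rightarrow>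
     complex option \<Rightarrow> complex ^ 'n \<Rightarrow> bool" where
  "isomonodromic_at D Q x0 t0 \<longleftrightarrow>
     (\<forall>\<gamma>. pathin riemann_sphere \<gamma> \<and> \<gamma> 0 = x0 \<and> \<gamma> 1 = x0 \<and> (\<forall>s\<in>{0..1}. \<forall>p. \<gamma> s \<noteq> Some (t0 $ p)) \<longrightarrow>
        (\<exists>\<delta>>0. polydisc t0 \<delta> \<subseteq> D \<and>
               (\<forall>t\<in>polydisc t0 \<delta>. \<forall>s\<in>{0..1}. \<forall>p. \<gamma> s \<noteq> Some (t $ p)) \<and>
               (\<forall>t\<in>polydisc t0 \<delta>. continued_solution Q x0 t \<gamma> = continued_solution Q x0 t0 \<gamma>)))"

text \<open>
  \<open>l\<close> is the continuation of \<open>log (x - a)\<close> along the path \<open>\<mu>\<close> whose initial argument lies within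
  \<open>\<pi> / 2\<close> of \<open>\<theta>\<close>.
\<close>

definition log_along :: "complex \<Rightarrow> real \<Rightarrow> (real \<Rightarrow> complex) \<Rightarrow> (real \<Rightarrow> complex) \<Rightarrow> bool" where
  "log_along a \<theta> \<mu> l \<longleftrightarrow>
     continuous_on {0..1} l \<and> (\<forall>s\<in>{0..1}. exp (l s) = \<mu> s - a) \<and>
     Im (l 0) \<in> {\<theta> - pi / 2 <..< \<theta> + pi / 2}"

text \<open>
  A point of the universal covering of the punctured disc is the endpoint \<open>\<mu> 1\<close> of a path \<open>\<mu>\<close> that
  starts at \<open>xj\<close>, together with the homotopy class of \<open>\<mu>\<close>. The factorization on the covering is
  stated for all representatives \<open>\<mu>\<close>. The choice of \<open>\<theta> = arg (xj - t0\<^sub>j)\<close> is immaterial, since another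
  choice multiplies \<open>H\<close> by an integer power of \<open>exp (2 * \<pi> * \<i> * A)\<close>, so any choice is allowed.
\<close>

definition isoprincipal_narrow_at ::
    "(complex ^ 'n) set \<Rightarrow> ('n::finite \<Rightarrow> complex ^ 'n \<Rightarrow> complex ^ 'k ^ 'k) \<Rightarrow>
     complex option \<Rightarrow> complex ^ 'n \<Rightarrow> bool" where
  "isoprincipal_narrow_at D Q x0 t0 \<longleftrightarrow>
     (\<forall>j. \<exists>\<rho> \<delta> xj \<alpha>.
        0 < \<rho> \<and> ereal \<rho> \<le> half_gap t0 j \<and> 0 < 2 * \<delta> \<and> 2 * \<delta> < \<rho> \<and> polydisc t0 \<delta> \<subseteq> D \<and>
        \<delta> < cmod (xj - t0 $ j) \<and> cmod (xj - t0 $ j) < \<rho> - \<delta> \<and>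
        pathin riemann_sphere \<alpha> \<and> \<alpha> 0 = x0 \<and> \<alpha> 1 = Some xj \<and>
        (\<forall>s\<in>{0..1}. \<forall>z p. \<alpha> s = Some z \<longrightarrow> cmod (z - t0 $ p) > \<delta>) \<and>
        (\<forall>\<theta>. is_Arg (xj - t0 $ j) \<theta> \<longrightarrow>
          (\<exists>H A.
             joint_holomorphic_on H {(x, t). t \<in> polydisc t0 \<delta> \<and> x \<in> ball (t $ j) \<rho>} \<and>
             (\<forall>t\<in>polydisc t0 \<delta>. \<forall>x\<in>ball (t $ j) \<rho>. invertible (H (x, t))) \<and>
             (\<forall>t\<in>polydisc t0 \<delta>. \<forall>\<mu> l.
                path \<mu> \<and> \<mu> 0 = xj \<and> path_image \<mu> \<subseteq> ball (t $ j) \<rho> - {t $ j} \<and>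
                log_along (t $ j) \<theta> \<mu> l \<longrightarrow>
                continued_solution Q x0 t (path_join \<alpha> (Some \<circ> \<mu>)) =
                  H (\<mu> 1, t) ** mat_exp (mat_scale (l 1) A)))))"

end

theory Submission
  imports Defs "HOL-Complex_Analysis.Conformal_Mappings"
    "HOL-Computational_Algebra.Fundamental_Theorem_Algebra"
begin

text \<open>
  Near \<open>x = t\<^sub>j\<close> the non-resonance of \<open>Q\<^sub>j(t)\<close>, which persists for \<open>t\<close> close to \<open>t\<^sup>0\<close>, gives a convergent Frobenius
  series \<open>G(x, t)\<close> with \<open>G(t\<^sub>j, t) = I\<close> such that \<open>Y = G (x - t\<^sub>j)\<^bsup>Q\<^sub>j\<^esup> C\<close>; everything depends holomorphically on \<open>t\<close>.
  Hence \<open>Y = (G C) (x - t\<^sub>j)\<^bsup>A\<^esup>\<close> with \<open>A(t) = C\<^bsup>-1\<^esup> Q\<^sub>j(t) C\<close>, and only the constancy of \<open>A(t)\<close> is at stake.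
  The loop that runs to \<open>x\<^sub>j\<close>, once around \<open>t\<^sub>j\<close> and back has monodromy \<open>exp (2 \<pi> \<i> A(t))\<close>, which does not depend on \<open>t\<close>.
  So \<open>A(t)\<close> commutes with \<open>exp (2 \<pi> \<i> A(t\<^sup>0))\<close>, therefore with the non-resonant matrix \<open>A(t\<^sup>0)\<close> itself, and
  \<open>exp (2 \<pi> \<i> (A(t) - A(t\<^sup>0))) = I\<close> with a small exponent forces \<open>A(t) = A(t\<^sup>0)\<close>.
\<close>

section \<open>Matrices and the matrix exponential\<close>

text \<open>The point \<open>xj\<close> and the path \<open>\<alpha>\<close> may be chosen, and this
  keeps the continuation from \<open>x0\<close> simple. Taking \<open>xj\<close> off finitely many
  real lines makes a straight segment from \<open>x0\<close>, or a segment in a coordinate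
  \<open>c / (x - b)\<close> when \<open>x0\<close> is infinity, avoid all poles. A single solution,
  defined near the whole segment and holomorphic in the parameters, then accounts for all of
  \<open>\<alpha>\<close>; genuine continuation happens only around the pole, where the logarithm is
  explicit. The obstacle is uniformity in \<open>t\<close>: a radius that shrinks with
  \<open>t\<close> would be useless. So non-resonance is turned into one lower bound for the
  operators that the recursion has to invert, a bound that survives small perturbations, and the
  radius of convergence is computed from such bounds alone. The same estimate with residue 0 gives
  discs of a common radius at ordinary points, which are chained along the segment. That the
  isomonodromy radius depends on the loop does no harm, since one loop for each \<open>j\<close>
  suffices.\<close>

lemma mat_scale_nth [simp]: "mat_scale c A $ i $ j = c * A $ i $ j"
  by (simp add: mat_scale_def)

lemma matrix_mult_nth: "(A ** B) $ i $ j = (\<Sum>k\<in>UNIV. A $ i $ k * B $ k $ j)"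
  by (simp add: matrix_matrix_mult_def)

lemma mat_scale_mult_left: "mat_scale c A ** B = mat_scale c (A ** B)"
  by (simp add: vec_eq_iff matrix_mult_nth sum_distrib_left mult_ac)

lemma mat_scale_mult_right: "A ** mat_scale c B = mat_scale c (A ** B)"
  by (simp add: vec_eq_iff matrix_mult_nth sum_distrib_left mult_ac)

lemma mat_scale_mat_scale [simp]: "mat_scale c (mat_scale d A) = mat_scale (c * d) A"
  by (simp add: vec_eq_iff mult_ac)

lemma mat_scale_one [simp]: "mat_scale 1 A = A"
  by (simp add: vec_eq_iff)

lemma mat_scale_zero [simp]: "mat_scale 0 A = 0"
  by (simp add: vec_eq_iff)

lemma mat_scale_zero_right [simp]: "mat_scale c 0 = 0"
  by (simp add: vec_eq_iff)

lemma mat_scale_add_right: "mat_scale c (A + B) = mat_scale c A + mat_scale c B"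
  by (simp add: vec_eq_iff algebra_simps)

lemma mat_scale_diff_right: "mat_scale c (A - B) = mat_scale c A - mat_scale c B"
  by (simp add: vec_eq_iff algebra_simps)

lemma mat_scale_add_left: "mat_scale (c + d) A = mat_scale c A + mat_scale d A"
  by (simp add: vec_eq_iff algebra_simps)

lemma mat_scale_diff_left: "mat_scale (c - d) A = mat_scale c A - mat_scale d A"
  by (simp add: vec_eq_iff algebra_simps)

lemma mat_scale_minus_left: "mat_scale (- c) A = - mat_scale c A"
  by (simp add: vec_eq_iff)

lemma mat_scale_eq_0_iff [simp]: "mat_scale c A = 0 \<longleftrightarrow> c = 0 \<or> A = 0"
  by (auto simp: vec_eq_iff)

lemma mat_scale_sum: "mat_scale c (\<Sum>i\<in>I. F i) = (\<Sum>i\<in>I. mat_scale c (F i))"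
  by (simp add: vec_eq_iff sum_distrib_left)

lemma scaleR_eq_mat_scale: "r *\<^sub>R A = mat_scale (of_real r) A"
  by (simp add: vec_eq_iff) (simp add: scaleR_conv_of_real)

lemma mat_power_0 [simp]: "mat_power A 0 = mat 1"
  and mat_power_Suc: "mat_power A (Suc m) = A ** mat_power A m"
  by (simp_all add: mat_power_def)

lemma matrix_mult_minus_left: "(- A) ** B = - (A ** (B :: complex ^ 'k ^ 'k))"
  by (simp add: vec_eq_iff matrix_mult_nth sum_negf)

lemma matrix_mult_minus_right: "A ** (- B) = - (A ** (B :: complex ^ 'k ^ 'k))"
  by (simp add: vec_eq_iff matrix_mult_nth sum_negf)

lemma matrix_mult_diff_left: "(A - B) ** C = A ** C - B ** (C :: complex ^ 'k ^ 'k)"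
  by (simp add: vec_eq_iff matrix_mult_nth sum_subtractf algebra_simps)

lemma matrix_mult_diff_right: "A ** (B - C) = A ** B - A ** (C :: complex ^ 'k ^ 'k)"
  by (simp add: vec_eq_iff matrix_mult_nth sum_subtractf algebra_simps)

lemma matrix_mult_add_left: "(A + B) ** C = A ** C + B ** (C :: complex ^ 'k ^ 'k)"
  by (simp add: vec_eq_iff matrix_mult_nth sum.distrib algebra_simps)

lemma matrix_mult_0 [simp]: "0 ** A = (0 :: complex ^ 'k ^ 'k)" "A ** 0 = (0 :: complex ^ 'k ^ 'k)"
  by (simp_all add: vec_eq_iff matrix_mult_nth)

text \<open>A noncommutative normal form: products are multiplied out and nested to the right, with
  scalars and signs in front. Where two such forms must be compared in the other nesting,
  \<open>matrix_mul_assoc\<close> is applied afterwards.\<close>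

lemmas mat_algebra = matrix_mul_assoc [symmetric] matrix_add_ldistrib matrix_mult_add_left
  matrix_mult_diff_left matrix_mult_diff_right mat_scale_mult_left mat_scale_mult_right
  matrix_mult_minus_left matrix_mult_minus_right
  mat_scale_add_right mat_scale_diff_right

lemma norm_mat_entry: "norm (A $ i $ j) \<le> norm (A :: complex ^ 'k ^ 'k)"
  by (meson Finite_Cartesian_Product.norm_nth_le order_trans)

lemma norm_mat_power2: "(norm (A :: complex ^ 'k ^ 'k))\<^sup>2 = (\<Sum>i\<in>UNIV. \<Sum>j\<in>UNIV. (cmod (A $ i $ j))\<^sup>2)"
  by (simp add: norm_vec_def L2_set_def sum_nonneg)

lemma norm_mat_scale: "norm (mat_scale c A) = cmod c * norm A"
proof -
  have "(norm (mat_scale c A))\<^sup>2 = (cmod c * norm A)\<^sup>2"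
    by (simp add: norm_mat_power2 norm_mult power_mult_distrib sum_distrib_left)
  then show ?thesis
    by (simp add: power2_eq_iff_nonneg)
qed

text \<open>The norm is the Euclidean norm of all entries, so submultiplicativity is the
  Cauchy-Schwarz inequality for each entry of the product. In this norm \<open>mat 1\<close> has the
  square root of the dimension as norm, which is why the factor \<open>norm (mat 1)\<close>
  accompanies the estimates.\<close>

lemma norm_matrix_mult_le:
  fixes A B :: "complex ^ 'k ^ 'k"
  shows "norm (A ** B) \<le> norm A * norm B"
proof -
  have CS: "(cmod (\<Sum>k\<in>UNIV. A $ i $ k * B $ k $ j))\<^sup>2 \<le>
      (\<Sum>k\<in>UNIV. (cmod (A $ i $ k))\<^sup>2) * (\<Sum>k\<in>UNIV. (cmod (B $ k $ j))\<^sup>2)" for i j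
  proof -
    have "cmod (\<Sum>k\<in>UNIV. A $ i $ k * B $ k $ j) \<le> (\<Sum>k\<in>UNIV. \<bar>cmod (A $ i $ k)\<bar> * \<bar>cmod (B $ k $ j)\<bar>)"
      by (rule order_trans [OF norm_sum]) (simp add: norm_mult)
    also have "\<dots> \<le> L2_set (\<lambda>k. cmod (A $ i $ k)) UNIV * L2_set (\<lambda>k. cmod (B $ k $ j)) UNIV"
      by (rule L2_set_mult_ineq)
    finally have "(cmod (\<Sum>k\<in>UNIV. A $ i $ k * B $ k $ j))\<^sup>2 \<le>
        (L2_set (\<lambda>k. cmod (A $ i $ k)) UNIV * L2_set (\<lambda>k. cmod (B $ k $ j)) UNIV)\<^sup>2"
      by (rule power_mono) simp
    then show ?thesis
      by (simp add: power_mult_distrib L2_set_def sum_nonneg)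
  qed
  have "(norm (A ** B))\<^sup>2 \<le>
      (\<Sum>i\<in>UNIV. \<Sum>j\<in>UNIV. (\<Sum>k\<in>UNIV. (cmod (A $ i $ k))\<^sup>2) * (\<Sum>k\<in>UNIV. (cmod (B $ k $ j))\<^sup>2))"
    unfolding norm_mat_power2 matrix_mult_nth by (intro sum_mono CS)
  also have "\<dots> = (norm A)\<^sup>2 * (\<Sum>j\<in>UNIV. \<Sum>k\<in>UNIV. (cmod (B $ k $ j))\<^sup>2)"
    unfolding norm_mat_power2 by (rule sum_product [symmetric])
  also have "(\<Sum>j\<in>UNIV. \<Sum>k\<in>UNIV. (cmod (B $ k $ j))\<^sup>2) = (norm B)\<^sup>2"
    unfolding norm_mat_power2 by (rule sum.swap)
  finally have "(norm (A ** B))\<^sup>2 \<le> (norm A * norm B)\<^sup>2"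
    by (simp only: power_mult_distrib)
  then show ?thesis
    by (rule power2_le_imp_le) simp
qed

lemma bounded_bilinear_matrix_mult: "bounded_bilinear ((**) :: complex ^ 'k ^ 'k \<Rightarrow> complex ^ 'k ^ 'k \<Rightarrow> complex ^ 'k ^ 'k)"
proof
  show "\<exists>K. \<forall>a b. norm ((a :: complex ^ 'k ^ 'k) ** (b :: complex ^ 'k ^ 'k)) \<le> norm a * norm b * K"
    by (rule exI [of _ 1]) (simp add: norm_matrix_mult_le)
qed (simp_all add: mat_algebra scaleR_eq_mat_scale)

lemma bounded_linear_mat_entry: "bounded_linear (\<lambda>A :: complex ^ 'k ^ 'k. A $ i $ j)"
  using bounded_linear_compose [OF bounded_linear_vec_nth bounded_linear_vec_nth] .

lemma norm_mat_power_le: "norm (mat_power (A :: complex ^ 'k ^ 'k) m) \<le> norm (mat 1 :: complex ^ 'k ^ 'k) * norm A ^ m"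
proof (induction m)
  case (Suc m)
  have "norm (mat_power A (Suc m)) \<le> norm A * norm (mat_power A m)"
    by (simp add: mat_power_Suc norm_matrix_mult_le)
  also have "\<dots> \<le> norm A * (norm (mat 1 :: complex ^ 'k ^ 'k) * norm A ^ m)"
    by (intro mult_left_mono Suc) auto
  finally show ?case by (simp add: mult_ac)
qed simp

text \<open>Starting the induction at the first power avoids the factor \<open>norm (mat 1)\<close>;
  \<open>mat_exp_eq_one_small\<close> relies on this for a bound that is independent of the
  dimension.\<close>

lemma norm_mat_power_Suc_le: "norm (mat_power (A :: complex ^ 'k ^ 'k) (Suc m)) \<le> norm A ^ Suc m"
proof (induction m)
  case (Suc m)
  have "norm (mat_power A (Suc (Suc m))) \<le> norm A * norm (mat_power A (Suc m))"
    by (simp add: mat_power_Suc norm_matrix_mult_le)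
  also have "\<dots> \<le> norm A * norm A ^ Suc m"
    by (intro mult_left_mono Suc) auto
  finally show ?case by simp
qed (simp add: mat_power_Suc)

lemma mat_exp_sums: "(\<lambda>m. mat_power A m /\<^sub>R fact m) sums mat_exp (A :: complex ^ 'k ^ 'k)"
  unfolding mat_exp_def
proof (rule summable_sums, rule summable_norm_cancel, rule summable_comparison_test)
  show "summable (\<lambda>m. norm (mat 1 :: complex ^ 'k ^ 'k) * (norm A ^ m /\<^sub>R fact m))"
    by (intro summable_mult summable_exp_generic)
  show "\<exists>N. \<forall>m\<ge>N. norm (norm (mat_power A m /\<^sub>R fact m)) \<le> norm (mat 1 :: complex ^ 'k ^ 'k) * (norm A ^ m /\<^sub>R fact m)"
    by (rule exI [of _ 0])
      (auto simp: divide_inverse_commute mult_ac intro!: mult_right_mono mult_left_mono norm_mat_power_le)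
qed

lemma mat_power_mat_scale: "mat_power (mat_scale w A) m = mat_scale (w ^ m) (mat_power A m)"
  by (induction m) (simp_all add: mat_power_Suc mat_algebra mult_ac)

text \<open>An intertwiner of \<open>A\<close> and \<open>B\<close> intertwines all powers, hence
  the series. \<open>X\<close> may be singular: besides commutation and similarity this covers the
  eigenvectors of a commutator in \<open>commute_of_commute_exp\<close>.\<close>

lemma matrix_mult_mat_exp:
  assumes "X ** A = B ** (X :: complex ^ 'k ^ 'k)"
  shows "X ** mat_exp A = mat_exp B ** X"
proof -
  have P: "X ** mat_power A m = mat_power B m ** X" for m
  proof (induction m)
    case (Suc m)
    show ?case
      by (metis Suc assms mat_power_Suc matrix_mul_assoc)
  qed simp
  have "(\<lambda>m. X ** (mat_power A m /\<^sub>R fact m)) sums (X ** mat_exp A)"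
    by (rule bounded_linear.sums [OF bounded_bilinear.bounded_linear_right [OF bounded_bilinear_matrix_mult] mat_exp_sums])
  moreover have "(\<lambda>m. (mat_power B m /\<^sub>R fact m) ** X) sums (mat_exp B ** X)"
    by (rule bounded_linear.sums [OF bounded_bilinear.bounded_linear_left [OF bounded_bilinear_matrix_mult] mat_exp_sums])
  moreover have "X ** (mat_power A m /\<^sub>R fact m) = (mat_power B m /\<^sub>R fact m) ** X" for m
    by (simp add: scaleR_eq_mat_scale mat_algebra P)
  ultimately show ?thesis
    by (metis (no_types, lifting) sums_cong sums_unique2)
qed

lemma mat_exp_zero [simp]: "mat_exp 0 = (mat 1 :: complex ^ 'k ^ 'k)"
proof -
  have "mat_power 0 m /\<^sub>R fact m = (if m = 0 then mat 1 else 0 :: complex ^ 'k ^ 'k)" for m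
    by (cases m) (simp_all add: mat_power_Suc)
  then have "(\<lambda>m. mat_power 0 m /\<^sub>R fact m) sums (mat 1 :: complex ^ 'k ^ 'k)"
    using sums_single [of 0 "\<lambda>_. mat 1 :: complex ^ 'k ^ 'k"] by simp
  then show ?thesis
    using mat_exp_sums sums_unique2 by blast
qed

section \<open>Derivatives of matrix functions and linear equations with constant
  coefficients\<close>

definition mat_deriv :: "(complex \<Rightarrow> complex ^ 'k ^ 'k) \<Rightarrow> complex ^ 'k ^ 'k \<Rightarrow> complex \<Rightarrow> bool" where
  "mat_deriv F F' z \<longleftrightarrow> (\<forall>i j. ((\<lambda>z. F z $ i $ j) has_field_derivative F' $ i $ j) (at z))"

lemma mat_deriv_const: "mat_deriv (\<lambda>_. C) 0 z"
  by (simp add: mat_deriv_def)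

lemma mat_deriv_mult:
  assumes "mat_deriv F F' z" "mat_deriv G G' z"
  shows "mat_deriv (\<lambda>z. F z ** G z) (F' ** G z + F z ** G') z"
  using assms unfolding mat_deriv_def matrix_mult_nth
  by (auto intro!: derivative_eq_intros simp: sum.distrib matrix_mult_nth mult.commute add.commute)

lemma mat_deriv_mult_const:
  assumes "mat_deriv F F' z"
  shows "mat_deriv (\<lambda>z. F z ** C) (F' ** C) z"
  using mat_deriv_mult [OF assms mat_deriv_const [of C]] by simp

lemma mat_deriv_compose:
  assumes "mat_deriv F F' (g z)" "(g has_field_derivative g') (at z)"
  shows "mat_deriv (\<lambda>z. F (g z)) (mat_scale g' F') z"
  using assms DERIV_chain2 [of "\<lambda>z. F z $ _ $ _" _ g z g'] unfolding mat_deriv_def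
  by (fastforce simp: mult.commute)

lemma mat_deriv_unique: "mat_deriv F A z \<Longrightarrow> mat_deriv F B z \<Longrightarrow> A = B"
  unfolding mat_deriv_def vec_eq_iff using DERIV_unique by blast

lemma mat_deriv_transform:
  assumes "mat_deriv F F' z" "open S" "z \<in> S" "\<And>x. x \<in> S \<Longrightarrow> F x = G x"
  shows "mat_deriv G F' z"
  unfolding mat_deriv_def
proof (intro allI)
  fix i j
  show "((\<lambda>z. G z $ i $ j) has_field_derivative F' $ i $ j) (at z)"
    by (rule has_field_derivative_transform_within_open [of "\<lambda>z. F z $ i $ j", OF _ assms(2,3)])
      (use assms in \<open>auto simp: mat_deriv_def\<close>)
qed

lemma mat_deriv_zero_const:
  assumes "convex S" "open S" "\<And>z. z \<in> S \<Longrightarrow> mat_deriv F 0 z" "x \<in> S" "y \<in> S"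
  shows "F x = F y"
proof -
  have "F x $ i $ j = F y $ i $ j" for i j
  proof -
    have "\<exists>c. \<forall>z\<in>S. F z $ i $ j = c"
      using assms(3)
      by (intro has_field_derivative_zero_constant [OF assms(1)])
        (auto simp: mat_deriv_def intro: has_field_derivative_at_within)
    then show ?thesis using assms(4,5) by auto
  qed
  then show ?thesis by (simp add: vec_eq_iff)
qed

lemma mat_exp_entry_sums:
  "(\<lambda>m. (mat_power A m $ i $ j / fact m) * w ^ m) sums (mat_exp (mat_scale w A) $ i $ j)"
  using bounded_linear.sums [OF bounded_linear_mat_entry mat_exp_sums, of "mat_scale w A" i j]
  by (simp add: mat_power_mat_scale scaleR_eq_mat_scale divide_inverse mult_ac)

lemma mat_deriv_exp:
  fixes A :: "complex ^ 'k ^ 'k"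
  shows "mat_deriv (\<lambda>w. mat_exp (mat_scale w A)) (A ** mat_exp (mat_scale w A)) w"
  unfolding mat_deriv_def
proof (intro allI)
  fix i j
  define c where "c i m = mat_power A m $ i $ j / fact m" for i m
  have S: "(\<lambda>m. c i m * w ^ m) sums (mat_exp (mat_scale w A) $ i $ j)" for i w
    unfolding c_def by (rule mat_exp_entry_sums)
  have "((\<lambda>w. \<Sum>m. c i m * w ^ m) has_field_derivative (\<Sum>m. diffs (c i) m * w ^ m)) (at w)"
    by (rule termdiffs_strong_converges_everywhere) (use S in \<open>auto simp: sums_iff\<close>)
  moreover have "(\<lambda>m. diffs (c i) m * w ^ m) sums ((A ** mat_exp (mat_scale w A)) $ i $ j)"
  proof -
    \<comment> \<open>The factor \<open>m + 1\<close> from differentiation cancels against the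
      factorial, so the derived series is \<open>A\<close> times the original one.\<close>
    have "diffs (c i) m = mat_power A (Suc m) $ i $ j / fact m" for m
      unfolding diffs_def c_def by (simp add: divide_simps del: of_nat_Suc)
    then have "diffs (c i) m * w ^ m = (\<Sum>k\<in>UNIV. A $ i $ k * (c k m * w ^ m))" for m
      by (simp add: c_def mat_power_Suc matrix_mult_nth sum_divide_distrib sum_distrib_left sum_distrib_right mult_ac)
    then show ?thesis
      using sums_sum [of UNIV "\<lambda>k m. A $ i $ k * (c k m * w ^ m)", OF sums_mult [OF S]]
      by (simp add: matrix_mult_nth)
  qed
  ultimately show "((\<lambda>w. mat_exp (mat_scale w A) $ i $ j) has_field_derivative (A ** mat_exp (mat_scale w A)) $ i $ j) (at w)"
    using S by (simp add: sums_iff)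
qed

lemma mat_exp_commute: "A ** mat_exp (mat_scale w A) = mat_exp (mat_scale w A) ** A"
  by (rule matrix_mult_mat_exp) (simp add: mat_algebra)

lemma mat_exp_minus_scale: "mat_exp (mat_scale w (- A)) ** mat_exp (mat_scale w A) = mat 1"
proof -
  have "mat_deriv (\<lambda>w. mat_exp (mat_scale w (- A)) ** mat_exp (mat_scale w A)) 0 w" for w
    using mat_deriv_mult [OF mat_deriv_exp [of "- A" w] mat_deriv_exp [of A w]]
    unfolding mat_exp_commute [of "- A"] by (simp add: mat_algebra)
  from mat_deriv_zero_const [of UNIV, OF _ _ this, of w 0] show ?thesis by simp
qed

lemma mat_exp_minus: "mat_exp (- A) ** mat_exp A = mat 1" "mat_exp A ** mat_exp (- A) = mat 1"
  using mat_exp_minus_scale [of 1 A] mat_exp_minus_scale [of 1 "- A"] by simp_all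

lemma invertible_mat_exp: "invertible (mat_exp (A :: complex ^ 'k ^ 'k))"
  unfolding invertible_def using mat_exp_minus by blast

text \<open>Multiplying \<open>F\<close> by the inverse exponential gives a function with derivative
  0. Exponential identities are derived from this by checking a differential equation instead of
  multiplying series.\<close>

lemma linear_ode_unique:
  assumes "\<And>w. mat_deriv F (A ** F w) w"
  shows "F w = mat_exp (mat_scale w A) ** F 0"
proof -
  have "mat_deriv (\<lambda>w. mat_exp (mat_scale w (- A)) ** F w) 0 w" for w
    using mat_deriv_mult [OF mat_deriv_exp [of "- A" w] assms [of w]]
    unfolding mat_exp_commute [of "- A"] by (simp add: mat_algebra)
  from mat_deriv_zero_const [of UNIV, OF _ _ this, of w 0]
  have "mat_exp (mat_scale w (- A)) ** F w = F 0" by simp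
  then have "mat_exp (mat_scale w A) ** F 0 = (mat_exp (mat_scale w A) ** mat_exp (mat_scale w (- A))) ** F w"
    by (simp add: mat_algebra)
  then show ?thesis
    using mat_exp_minus_scale [of w "- A"] by simp
qed

text \<open>Along \<open>w\<close> the product solves the equation of \<open>A + B\<close>;
  commutation is needed to move \<open>B\<close> past the exponential of \<open>A\<close>.\<close>

lemma mat_exp_add:
  assumes "A ** B = B ** (A :: complex ^ 'k ^ 'k)"
  shows "mat_exp (A + B) = mat_exp A ** mat_exp B"
proof -
  define F where "F w = mat_exp (mat_scale w A) ** mat_exp (mat_scale w B)" for w
  have "B ** mat_exp (mat_scale w A) = mat_exp (mat_scale w A) ** B" for w
    by (rule matrix_mult_mat_exp) (simp add: mat_algebra assms)
  then have "mat_deriv F ((A + B) ** F w) w" for w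
    using mat_deriv_mult [OF mat_deriv_exp [of A w] mat_deriv_exp [of B w]]
    unfolding F_def by (simp add: mat_algebra) (simp add: matrix_mul_assoc)
  from linear_ode_unique [OF this, of 1] show ?thesis
    by (simp add: F_def)
qed

lemma mat_exp_scale_add:
  "mat_exp (mat_scale (a + b) A) = mat_exp (mat_scale a A) ** mat_exp (mat_scale b A)"
  unfolding mat_scale_add_left by (rule mat_exp_add) (simp add: mat_algebra mult_ac)

text \<open>If the exponential is 1, then \<open>X\<close> equals minus the sum of the terms of
  order at least 2, so \<open>norm X\<close> is at most \<open>2 * (norm X)\<^sup>2\<close>, which
  is impossible for \<open>0 < norm X < 1 / 2\<close>.\<close>

lemma mat_exp_eq_one_small:
  fixes X :: "complex ^ 'k ^ 'k"
  assumes "mat_exp X = mat 1" "norm X < 1 / 4"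
  shows "X = 0"
proof -
  have S: "(\<lambda>m. mat_power X (Suc (Suc m)) /\<^sub>R fact (Suc (Suc m))) sums (- X)"
    using sums_split_initial_segment [OF mat_exp_sums [of X], of 2] assms(1)
    by (simp add: mat_power_Suc numeral_2_eq_2)
  have E: "(\<lambda>m. (norm X)\<^sup>2 * (norm X ^ m /\<^sub>R fact m)) sums ((norm X)\<^sup>2 * exp (norm X))"
    by (intro sums_mult exp_converges)
  have B: "norm (mat_power X (Suc (Suc m)) /\<^sub>R fact (Suc (Suc m))) \<le> (norm X)\<^sup>2 * (norm X ^ m /\<^sub>R fact m)" for m
  proof -
    have "norm (mat_power X (Suc (Suc m)) /\<^sub>R fact (Suc (Suc m))) \<le> norm X ^ Suc (Suc m) / fact (Suc (Suc m))"
      using norm_mat_power_Suc_le [of X "Suc m"] by (simp add: divide_inverse mult.commute mult_right_mono del: fact_Suc power_Suc)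
    also have "\<dots> \<le> norm X ^ Suc (Suc m) / fact m"
      by (intro divide_left_mono fact_mono) auto
    finally show ?thesis by (simp add: power2_eq_square field_simps)
  qed
  have "norm X \<le> (norm X)\<^sup>2 * exp (norm X)"
    using norm_suminf_le [OF B sums_summable [OF E]] S E by (simp add: sums_iff)
  also have "\<dots> \<le> (norm X)\<^sup>2 * 2"
    using exp_bound_half [of "norm X"] assms(2) by (intro mult_left_mono) auto
  finally have le: "norm X * 1 \<le> norm X * (norm X * 2)"
    by (simp add: power2_eq_square)
  show ?thesis
  proof (rule ccontr)
    assume "X \<noteq> 0"
    with le have "1 \<le> norm X * 2"
      by (metis mult_le_cancel_left_pos zero_less_norm_iff)
    with assms(2) show False by simp
  qed
qed

section \<open>Holomorphic functions of several variables\<close>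

definition jscale :: "complex \<Rightarrow> complex \<times> (complex ^ 'n) \<Rightarrow> complex \<times> (complex ^ 'n)" where
  "jscale c = (\<lambda>(x, t). (c * x, c *s t))"

text \<open>The scalar notion behind \<open>joint_holomorphic_on\<close>. Functions of
  \<open>t\<close> alone are regarded as functions of the pair through \<open>snd\<close>, on
  \<open>UNIV \<times> T\<close>, so that one calculus serves both kinds.\<close>

definition chol :: "(complex \<times> (complex ^ 'n) \<Rightarrow> complex) \<Rightarrow> (complex \<times> (complex ^ 'n)) set \<Rightarrow> bool" where
  "chol f S \<longleftrightarrow> (\<forall>z\<in>S. \<exists>f'. (f has_derivative f') (at z) \<and> (\<forall>c v. f' (jscale c v) = c * f' v))"

lemma joint_holomorphic_on_chol:
  "joint_holomorphic_on H S \<longleftrightarrow> (\<forall>i j. chol (\<lambda>w. H w $ i $ j) S)"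
  unfolding joint_holomorphic_on_def mv_holomorphic_on_def chol_def jscale_def by blast

lemma fst_jscale [simp]: "fst (jscale c v) = c * fst v"
  and snd_jscale [simp]: "snd (jscale c v) = c *s snd v"
  by (simp_all add: jscale_def case_prod_beta)

lemma jscale_Pair: "jscale c (x, t) = (c * x, c *s t)"
  by (simp add: jscale_def)

lemma norm_vector_smult: "norm (c *s (t :: complex ^ 'n)) = cmod c * norm t"
proof -
  have "(norm (c *s t))\<^sup>2 = (cmod c * norm t)\<^sup>2"
    by (simp add: norm_vec_def L2_set_def sum_nonneg norm_mult power_mult_distrib sum_distrib_left)
  then show ?thesis
    by (simp add: power2_eq_iff_nonneg)
qed

lemma norm_jscale: "norm (jscale c v) = cmod c * norm v"
proof -
  have "(norm (jscale c v))\<^sup>2 = (cmod c * norm v)\<^sup>2"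
    by (cases v) (simp add: jscale_Pair norm_Pair norm_mult norm_vector_smult power_mult_distrib algebra_simps)
  then show ?thesis
    by (simp add: power2_eq_iff_nonneg)
qed

lemma bounded_linear_jscale: "bounded_linear (\<lambda>\<zeta>. jscale \<zeta> h)"
proof (rule bounded_linear_intro [where K = "norm h"])
  show "jscale (x + y) h = jscale x h + jscale y h" for x y
    by (cases h) (simp add: jscale_Pair algebra_simps vector_add_ldistrib vec_eq_iff)
  show "jscale (r *\<^sub>R x) h = r *\<^sub>R jscale x h" for r x
    by (cases h) (simp add: jscale_Pair vec_eq_iff)
  show "norm (jscale x h) \<le> norm x * norm h" for x
    by (simp add: norm_jscale)
qed

lemma cholI:
  assumes "\<And>z. z \<in> S \<Longrightarrow> \<exists>f'. (f has_derivative f') (at z) \<and> (\<forall>c v. f' (jscale c v) = c * f' v)"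
  shows "chol f S"
  using assms by (simp add: chol_def)

lemma chol_subset: "chol f S \<Longrightarrow> T \<subseteq> S \<Longrightarrow> chol f T"
  by (auto simp: chol_def)

lemma chol_continuous_on: "chol f S \<Longrightarrow> continuous_on S f"
  unfolding chol_def
  by (meson continuous_at_imp_continuous_on has_derivative_continuous)

lemma chol_transform:
  assumes "chol f S" "open S" "\<And>z. z \<in> S \<Longrightarrow> f z = g z"
  shows "chol g S"
  unfolding chol_def
proof
  fix z assume z: "z \<in> S"
  then obtain f' where "(f has_derivative f') (at z)" "\<forall>c v. f' (jscale c v) = c * f' v"
    using assms(1) unfolding chol_def by blast
  then show "\<exists>f'. (g has_derivative f') (at z) \<and> (\<forall>c v. f' (jscale c v) = c * f' v)"
    using has_derivative_transform_within_open [of f f' z UNIV S g] assms(2,3) z by auto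
qed

lemma chol_const [simp]: "chol (\<lambda>_. c) S"
  by (rule cholI) (auto intro!: exI [of _ "\<lambda>_. 0"])

lemma chol_fst [simp]: "chol fst S"
  by (rule cholI) (auto intro!: exI [of _ fst] derivative_eq_intros)

lemma chol_coord [simp]: "chol (\<lambda>w. snd w $ p) S"
  by (rule cholI)
    (auto intro!: exI [of _ "\<lambda>w. snd w $ p"] bounded_linear.has_derivative [OF bounded_linear_vec_nth] derivative_eq_intros)

lemma chol_add: "chol f S \<Longrightarrow> chol g S \<Longrightarrow> chol (\<lambda>w. f w + g w) S"
proof (rule cholI)
  fix z assume "chol f S" "chol g S" "z \<in> S"
  then obtain f' g' where "(f has_derivative f') (at z)" "\<forall>c v. f' (jscale c v) = c * f' v"
    "(g has_derivative g') (at z)" "\<forall>c v. g' (jscale c v) = c * g' v"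
    unfolding chol_def by meson
  then show "\<exists>f'. ((\<lambda>w. f w + g w) has_derivative f') (at z) \<and> (\<forall>c v. f' (jscale c v) = c * f' v)"
    by (intro exI [of _ "\<lambda>h. f' h + g' h"] conjI has_derivative_add)
      (auto simp: algebra_simps)
qed

lemma chol_mult:
  assumes "chol f S" "chol g S" shows "chol (\<lambda>w. f w * g w) S"
proof (rule cholI)
  fix z assume "z \<in> S"
  then obtain f' g' where "(f has_derivative f') (at z)" "\<forall>c v. f' (jscale c v) = c * f' v"
    "(g has_derivative g') (at z)" "\<forall>c v. g' (jscale c v) = c * g' v"
    using assms unfolding chol_def by meson
  then show "\<exists>f'. ((\<lambda>w. f w * g w) has_derivative f') (at z) \<and> (\<forall>c v. f' (jscale c v) = c * f' v)"
    by (intro exI [of _ "\<lambda>h. f z * g' h + f' h * g z"] conjI has_derivative_mult)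
      (auto simp: algebra_simps)
qed

lemma chol_compose_field:
  assumes "chol f S" "\<And>z. z \<in> S \<Longrightarrow> g field_differentiable (at (f z))"
  shows "chol (\<lambda>w. g (f w)) S"
proof (rule cholI)
  fix z assume z: "z \<in> S"
  then obtain f' where f': "(f has_derivative f') (at z)" "\<forall>c v. f' (jscale c v) = c * f' v"
    using assms unfolding chol_def by meson
  obtain d where d: "(g has_derivative (*) d) (at (f z))"
    using assms(2) [OF z] by (auto simp: field_differentiable_def has_field_derivative_def)
  have "((\<lambda>w. g (f w)) has_derivative (\<lambda>h. d * f' h)) (at z)"
    using has_derivative_compose [OF f'(1) d] by simp
  then show "\<exists>f'. ((\<lambda>w. g (f w)) has_derivative f') (at z) \<and> (\<forall>c v. f' (jscale c v) = c * f' v)"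
    using f'(2) by (intro exI [of _ "\<lambda>h. d * f' h"]) (auto simp: mult_ac)
qed

lemma chol_minus: "chol f S \<Longrightarrow> chol (\<lambda>w. - f w) S"
  using chol_mult [OF chol_const [of "-1"]] by simp

lemma chol_diff: "chol f S \<Longrightarrow> chol g S \<Longrightarrow> chol (\<lambda>w. f w - g w) S"
  using chol_add [OF _ chol_minus] by simp

lemma chol_inverse: "chol f S \<Longrightarrow> (\<And>z. z \<in> S \<Longrightarrow> f z \<noteq> 0) \<Longrightarrow> chol (\<lambda>w. inverse (f w)) S"
  by (rule chol_compose_field)
     (auto intro!: field_differentiable_inverse field_differentiable_ident)

lemma chol_divide: "chol f S \<Longrightarrow> chol g S \<Longrightarrow> (\<And>z. z \<in> S \<Longrightarrow> g z \<noteq> 0) \<Longrightarrow> chol (\<lambda>w. f w / g w) S"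
  unfolding divide_inverse by (intro chol_mult chol_inverse)

lemma chol_sum: "(\<And>i. i \<in> I \<Longrightarrow> chol (f i) S) \<Longrightarrow> chol (\<lambda>w. \<Sum>i\<in>I. f i w) S"
  by (induction I rule: infinite_finite_induct) (auto intro: chol_add)

lemma chol_prod: "(\<And>i. i \<in> I \<Longrightarrow> chol (f i) S) \<Longrightarrow> chol (\<lambda>w. \<Prod>i\<in>I. f i w) S"
  by (induction I rule: infinite_finite_induct) (auto intro: chol_mult)

lemma chol_power: "chol f S \<Longrightarrow> chol (\<lambda>w. f w ^ m) S"
  by (induction m) (auto intro: chol_mult)

lemma chol_det: 
  assumes "\<And>i j. chol (\<lambda>w. M w $ i $ j) S"
  shows "chol (\<lambda>w. det (M w)) S"
  unfolding det_def by (intro chol_sum chol_mult chol_prod chol_const assms)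

text \<open>Substitution in the first variable with the parameters kept, as in the passage to the
  coordinate \<open>x - t $ j\<close> at a moving pole.\<close>

lemma chol_compose_Pair:
  assumes "chol f T" "chol g S" "\<And>w. w \<in> S \<Longrightarrow> (g w, snd w) \<in> T"
  shows "chol (\<lambda>w. f (g w, snd w)) S"
proof (rule cholI)
  fix z assume z: "z \<in> S"
  then obtain g' where g': "(g has_derivative g') (at z)" "\<forall>c v. g' (jscale c v) = c * g' v"
    using assms unfolding chol_def by meson
  obtain f' where f': "(f has_derivative f') (at (g z, snd z))" "\<forall>c v. f' (jscale c v) = c * f' v"
    using assms z unfolding chol_def by meson
  have "((\<lambda>w. (g w, snd w)) has_derivative (\<lambda>h. (g' h, snd h))) (at z)"
    by (intro has_derivative_Pair g' has_derivative_snd has_derivative_ident)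
  from has_derivative_compose [OF this f'(1)]
  have "((\<lambda>w. f (g w, snd w)) has_derivative (\<lambda>h. f' (g' h, snd h))) (at z)" .
  moreover have "f' (g' (jscale c v), snd (jscale c v)) = c * f' (g' v, snd v)" for c v
    using f'(2) g'(2) by (metis jscale_Pair snd_jscale)
  ultimately show "\<exists>f'. ((\<lambda>w. f (g w, snd w)) has_derivative f') (at z) \<and> (\<forall>c v. f' (jscale c v) = c * f' v)"
    by blast
qed

lemma chol_slice:
  assumes "chol f S" "(x, t) \<in> S"
  shows "(\<lambda>x. f (x, t)) field_differentiable (at x)"
proof -
  obtain f' where f': "(f has_derivative f') (at (x, t))" "\<forall>c v. f' (jscale c v) = c * f' v"
    using assms unfolding chol_def by meson
  have "((\<lambda>x. (x, t)) has_derivative (\<lambda>h. (h, 0))) (at x)"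
    by (auto intro!: derivative_eq_intros)
  from has_derivative_compose [OF this f'(1)]
  have "((\<lambda>x. f (x, t)) has_derivative (\<lambda>h. f' (h, 0))) (at x)" .
  moreover have "(\<lambda>h. f' (h, 0)) = (*) (f' (1, 0))"
  proof
    fix h
    show "f' (h, 0) = f' (1, 0) * h"
      using f'(2) [rule_format, of h "(1, 0)"] by (simp add: jscale_Pair mult.commute)
  qed
  ultimately show ?thesis
    by (auto simp: field_differentiable_def has_field_derivative_def)
qed

text \<open>Cauchy's inequality on complex lines makes the series of derivatives converge uniformly.\<close>

lemma chol_derivative_bound:
  assumes f: "chol f (ball z (2 * r))" and B: "\<And>y. y \<in> ball z (2 * r) \<Longrightarrow> cmod (f y) \<le> B"
    and r: "0 < r" and y: "y \<in> ball z r"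
    and f': "(f has_derivative f') (at y)" "\<And>c v. f' (jscale c v) = c * f' v"
  shows "cmod (f' h) \<le> 2 * B / r * norm h"
proof (cases "h = 0")
  case True
  then show ?thesis
    using f'(1) by (simp add: has_derivative_bounded_linear linear_simps)
next
  case False
  \<comment> \<open>With this radius the points \<open>y + jscale \<zeta> h\<close> move by at most
    \<open>r / 2\<close> and stay in the larger ball; Cauchy's inequality for the first derivative
    then yields \<open>B / R = 2 * B / r * norm h\<close>.\<close>
  define R where "R = r / (2 * norm h)"
  have R: "0 < R" using r False by (simp add: R_def)
  define g where "g \<zeta> = f (y + jscale \<zeta> h)" for \<zeta>
  have L: "bounded_linear (\<lambda>\<zeta>. jscale \<zeta> h)" by (rule bounded_linear_jscale)
  have in_ball: "y + jscale \<zeta> h \<in> ball z (2 * r)" if "cmod \<zeta> \<le> R" for \<zeta>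
  proof -
    have "norm (jscale \<zeta> h) \<le> R * norm h"
      unfolding norm_jscale using that by (intro mult_right_mono) auto
    also have "\<dots> < r" using r False by (simp add: R_def)
    finally have "norm (jscale \<zeta> h) < r" .
    moreover have "dist z (y + jscale \<zeta> h) \<le> dist z y + norm (jscale \<zeta> h)"
      by (metis add_diff_cancel_left' dist_norm dist_triangle norm_minus_commute)
    ultimately show ?thesis using y by simp
  qed
  have der: "((\<lambda>\<zeta>. f (y + jscale \<zeta> h)) has_field_derivative F' h) (at \<zeta>)"
    if F': "(f has_derivative F') (at (y + jscale \<zeta> h))" "\<And>c v. F' (jscale c v) = c * F' v" for \<zeta> F'
  proof -
    have "((\<lambda>\<zeta>. y + jscale \<zeta> h) has_derivative (\<lambda>c. jscale c h)) (at \<zeta>)"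
      using bounded_linear.has_derivative [OF L has_derivative_ident] by (auto intro!: derivative_eq_intros)
    from has_derivative_compose [OF this F'(1)] show ?thesis
      by (simp add: F'(2) has_field_derivative_def mult_commute_abs)
  qed
  have diff: "g field_differentiable (at \<zeta>)" if "cmod \<zeta> \<le> R" for \<zeta>
    using f in_ball [OF that] der unfolding chol_def g_def field_differentiable_def by meson
  have D0: "(g has_field_derivative f' h) (at 0)"
    using der [of f' 0] f' unfolding g_def by (simp add: jscale_def case_prod_beta zero_prod_def[symmetric])
  have "cmod ((deriv ^^ 1) g 0) \<le> fact 1 * B / R ^ 1"
  proof (rule Cauchy_inequality [OF _ _ R])
    show "g holomorphic_on ball 0 R"
      using diff by (auto simp: holomorphic_on_def intro: field_differentiable_at_within)
    show "continuous_on (cball 0 R) g"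
      using diff by (intro continuous_at_imp_continuous_on) (auto intro: field_differentiable_imp_continuous_at)
    show "cmod (g x) \<le> B" if "cmod (0 - x) = R" for x
      unfolding g_def using that by (intro B in_ball) auto
  qed
  then show ?thesis
    using DERIV_imp_deriv [OF D0] by (simp add: R_def mult_ac)
qed

text \<open>Weierstrass' theorem in several variables. Termwise Frechet differentiation needs
  uniform convergence of the derivatives, and \<open>chol_derivative_bound\<close> turns the
  majorant \<open>M\<close> into a majorant of them on the ball of half the radius.\<close>

lemma chol_suminf:
  assumes S: "open S" and f: "\<And>m. chol (f m) S" and M: "\<And>m z. z \<in> S \<Longrightarrow> cmod (f m z) \<le> M m"
    and "summable M"
  shows "chol (\<lambda>z. \<Sum>m. f m z) S"
proof (rule cholI)
  fix z assume "z \<in> S"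
  then obtain e where e: "0 < e" "ball z e \<subseteq> S"
    using S open_contains_ball by blast
  define r where "r = e / 2"
  have r: "0 < r" "ball z (2 * r) \<subseteq> S" using e by (simp_all add: r_def)
  have sub: "ball z r \<subseteq> S" using subset_ball [of r "2 * r" z] r by auto
  have "\<forall>m y. \<exists>f'. y \<in> S \<longrightarrow> (f m has_derivative f') (at y) \<and> (\<forall>c v. f' (jscale c v) = c * f' v)"
    using f unfolding chol_def by blast
  then obtain f' where f': "\<And>m y. y \<in> S \<Longrightarrow> (f m has_derivative f' m y) (at y)"
    "\<And>m y c v. y \<in> S \<Longrightarrow> f' m y (jscale c v) = c * f' m y v"
    by metis
  have bd: "cmod (f' m y h) \<le> M m * (2 / r * norm h)" if "y \<in> ball z r" for m y h
  proof -
    have "cmod (f' m y h) \<le> 2 * M m / r * norm h"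
      by (rule chol_derivative_bound [OF chol_subset [OF f r(2)] _ r(1) that f'])
        (use M r(2) that sub in blast)+
    then show ?thesis by (simp add: mult_ac)
  qed
  have sf': "summable (\<lambda>m. f' m y h)" if "y \<in> ball z r" for y h
    by (rule summable_comparison_test [OF _ summable_mult2 [OF \<open>summable M\<close>]])
      (use bd [OF that] in blast)
  have "\<exists>g. \<forall>x\<in>ball z r. (\<lambda>n. f n x) sums g x \<and>
      (g has_derivative (\<lambda>h. \<Sum>m. f' m x h)) (at x within ball z r)"
  proof (rule has_derivative_series)
    show "(f n has_derivative f' n x) (at x within ball z r)" if "x \<in> ball z r" for n x
      using f' sub that has_derivative_at_withinI by blast
    show "(\<lambda>n. f n z) sums (\<Sum>n. f n z)"
      by (rule summable_sums, rule summable_comparison_test [OF _ \<open>summable M\<close>]) (use M \<open>z \<in> S\<close> in blast)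
    fix \<epsilon> :: real assume "\<epsilon> > 0"
    \<comment> \<open>The tail of \<open>M\<close> is made this small because the derivative bound
      multiplies it by \<open>2 / r\<close>.\<close>
    then have "0 < \<epsilon> * r / 2" using r by simp
    from suminf_exist_split [OF this \<open>summable M\<close>]
    obtain N where N: "\<And>n. n \<ge> N \<Longrightarrow> norm (\<Sum>i. M (i + n)) < \<epsilon> * r / 2" by blast
    show "\<forall>\<^sub>F n in sequentially. \<forall>x\<in>ball z r. \<forall>h. cmod ((\<Sum>i<n. f' i x h) - (\<Sum>m. f' m x h)) \<le> \<epsilon> * norm h"
      unfolding eventually_sequentially
    proof (intro exI allI impI ballI)
      fix n x h assume n: "N \<le> n" and x: "x \<in> ball z r"
      have sM: "summable (\<lambda>i. M (i + n))" using \<open>summable M\<close> by (simp add: summable_iff_shift)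
      have "cmod ((\<Sum>i<n. f' i x h) - (\<Sum>m. f' m x h)) = cmod (\<Sum>i. f' (i + n) x h)"
        using suminf_split_initial_segment [OF sf' [OF x], of h n] by simp
      also have "\<dots> \<le> (\<Sum>i. M (i + n) * (2 / r * norm h))"
        by (intro norm_suminf_le bd x summable_mult2 sM)
      also have "\<dots> = (\<Sum>i. M (i + n)) * (2 / r * norm h)"
        by (rule suminf_mult2 [OF sM, symmetric])
      also have "\<dots> \<le> (\<epsilon> * r / 2) * (2 / r * norm h)"
        using N [OF n] r by (intro mult_right_mono) auto
      finally show "cmod ((\<Sum>i<n. f' i x h) - (\<Sum>m. f' m x h)) \<le> \<epsilon> * norm h"
        using r by simp
    qed
  qed (use r in auto)
  then obtain g where g: "\<forall>x\<in>ball z r. (\<lambda>n. f n x) sums g x \<and>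
      (g has_derivative (\<lambda>h. \<Sum>m. f' m x h)) (at x within ball z r)" ..
  have "((\<lambda>x. \<Sum>m. f m x) has_derivative (\<lambda>h. \<Sum>m. f' m z h)) (at z)"
  proof (rule has_derivative_transform_within_open)
    show "(g has_derivative (\<lambda>h. \<Sum>m. f' m z h)) (at z)"
      using g r by (metis at_within_open centre_in_ball open_ball)
    show "open (ball z r)" "z \<in> ball z r"
      using r by auto
  qed (use g in \<open>auto simp: sums_iff\<close>)
  moreover have "(\<Sum>m. f' m z (jscale c v)) = c * (\<Sum>m. f' m z v)" for c v
    using f'(2) [OF \<open>z \<in> S\<close>] suminf_mult [OF sf'] r by simp
  ultimately show "\<exists>f'. ((\<lambda>z. \<Sum>m. f m z) has_derivative f') (at z) \<and> (\<forall>c v. f' (jscale c v) = c * f' v)"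
    by blast
qed

section \<open>Matrix-valued holomorphic functions and their inverses\<close>

lemma joint_hol_const [simp]: "joint_holomorphic_on (\<lambda>_. C) S"
  by (simp add: joint_holomorphic_on_chol)

lemma joint_hol_subset: "joint_holomorphic_on F S \<Longrightarrow> T \<subseteq> S \<Longrightarrow> joint_holomorphic_on F T"
  by (auto simp: joint_holomorphic_on_chol intro: chol_subset)

lemma joint_hol_transform:
  "joint_holomorphic_on F S \<Longrightarrow> open S \<Longrightarrow> (\<And>z. z \<in> S \<Longrightarrow> F z = G z) \<Longrightarrow> joint_holomorphic_on G S"
  unfolding joint_holomorphic_on_chol by (blast intro: chol_transform arg_cong [of _ _ "\<lambda>M. M $ _ $ _"])

lemma joint_hol_mult:
  "joint_holomorphic_on F S \<Longrightarrow> joint_holomorphic_on G S \<Longrightarrow> joint_holomorphic_on (\<lambda>w. F w ** G w) S"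
  unfolding joint_holomorphic_on_chol matrix_mult_nth by (auto intro!: chol_sum chol_mult)

lemma joint_hol_scale:
  "chol f S \<Longrightarrow> joint_holomorphic_on G S \<Longrightarrow> joint_holomorphic_on (\<lambda>w. mat_scale (f w) (G w)) S"
  unfolding joint_holomorphic_on_chol by (auto intro!: chol_mult)

lemma joint_hol_sum:
  "(\<And>i. i \<in> I \<Longrightarrow> joint_holomorphic_on (F i) S) \<Longrightarrow> joint_holomorphic_on (\<lambda>w. \<Sum>i\<in>I. F i w) S"
  unfolding joint_holomorphic_on_chol by (auto intro!: chol_sum)

lemma joint_hol_compose_Pair:
  "joint_holomorphic_on F T \<Longrightarrow> chol g S \<Longrightarrow> (\<And>w. w \<in> S \<Longrightarrow> (g w, snd w) \<in> T) \<Longrightarrow>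
   joint_holomorphic_on (\<lambda>w. F (g w, snd w)) S"
  unfolding joint_holomorphic_on_chol
  by (intro allI chol_compose_Pair [where f = "\<lambda>w. F w $ _ $ _"]) auto

lemma joint_hol_continuous_on: 
  assumes "joint_holomorphic_on F S"
  shows "continuous_on S F"
proof -
  have "continuous_on S (\<lambda>w. \<chi> i. \<chi> j. F w $ i $ j)"
    using assms unfolding joint_holomorphic_on_chol
    by (intro continuous_on_vec_lambda chol_continuous_on) auto
  then show ?thesis by simp
qed

lemma joint_hol_mat_deriv:
  assumes "joint_holomorphic_on F S" "(x, t) \<in> S"
  shows "\<exists>F'. mat_deriv (\<lambda>x. F (x, t)) F' x"
proof -
  have "(\<lambda>x. F (x, t) $ i $ j) field_differentiable (at x)" for i j
    using assms chol_slice [of "\<lambda>w. F w $ i $ j" S x t] by (simp add: joint_holomorphic_on_chol)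
  then have "mat_deriv (\<lambda>x. F (x, t)) (\<chi> i j. deriv (\<lambda>x. F (x, t) $ i $ j) x) x"
    by (simp add: mat_deriv_def field_differentiable_derivI)
  then show ?thesis ..
qed

lemma joint_hol_vec:
  assumes "vec_holomorphic_on Q D"
  shows "joint_holomorphic_on (\<lambda>w. Q (snd w)) (UNIV \<times> D)"
  unfolding joint_holomorphic_on_chol
proof (intro allI cholI)
  fix i j and z :: "complex \<times> (complex ^ 'a)" assume "z \<in> UNIV \<times> D"
  then obtain f' where f': "((\<lambda>w. Q w $ i $ j) has_derivative f') (at (snd z))" "\<And>c v. f' (c *s v) = c * f' v"
    using assms unfolding vec_holomorphic_on_def mv_holomorphic_on_def by fastforce
  have "((\<lambda>w. Q (snd w) $ i $ j) has_derivative (\<lambda>h. f' (snd h))) (at z)"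
    using has_derivative_compose [OF has_derivative_snd [OF has_derivative_ident] f'(1)] .
  then show "\<exists>f'. ((\<lambda>w. Q (snd w) $ i $ j) has_derivative f') (at z) \<and> (\<forall>c v. f' (jscale c v) = c * f' v)"
    using f'(2) by (intro exI [of _ "\<lambda>h. f' (snd h)"]) auto
qed

lemma matrix_inv_works:
  assumes "invertible (A :: complex ^ 'k ^ 'k)"
  shows "A ** matrix_inv A = mat 1" "matrix_inv A ** A = mat 1"
  using someI_ex [of "\<lambda>B. A ** B = mat 1 \<and> B ** A = mat 1"] assms
  unfolding invertible_def matrix_inv_def by auto

text \<open>Cramer's rule for the equation that column \<open>j\<close> of the inverse satisfies. It
  exhibits the entries of the inverse as quotients of determinants, whence the inverse is
  holomorphic where it exists.\<close>

lemma matrix_inv_entry: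
  assumes "invertible (A :: complex ^ 'k ^ 'k)"
  shows "matrix_inv A $ k $ j = det (\<chi> i l. if l = k then (mat 1 :: complex ^ 'k ^ 'k) $ i $ j else A $ i $ l) / det A"
proof -
  have "A *v (\<chi> l. matrix_inv A $ l $ j) = (\<chi> i. mat 1 $ i $ j)"
    using matrix_inv_works(1) [OF assms]
    by (simp add: vec_eq_iff matrix_vector_mult_def matrix_mult_nth)
  then have "(\<chi> l. matrix_inv A $ l $ j) =
     (\<chi> k. det (\<chi> i l. if l = k then (\<chi> i. (mat 1 :: complex ^ 'k ^ 'k) $ i $ j) $ i else A $ i $ l) / det A)"
    using assms by (subst (asm) cramer) (auto simp: invertible_det_nz)
  then show ?thesis by (simp add: vec_eq_iff cong: if_cong)
qed

lemma joint_hol_matrix_inv: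
  fixes F :: "complex \<times> (complex ^ 'n) \<Rightarrow> complex ^ 'k ^ 'k"
  assumes "joint_holomorphic_on F S" "open S" "\<And>w. w \<in> S \<Longrightarrow> invertible (F w)"
  shows "joint_holomorphic_on (\<lambda>w. matrix_inv (F w)) S"
  unfolding joint_holomorphic_on_chol
proof (intro allI)
  fix k j
  have "chol (\<lambda>w. det (\<chi> i l. if l = k then (mat 1 :: complex ^ 'k ^ 'k) $ i $ j else F w $ i $ l) / det (F w)) S"
  proof (intro chol_divide chol_det)
    show "chol (\<lambda>w. (\<chi> i l. if l = k then (mat 1 :: complex ^ 'k ^ 'k) $ i $ j else F w $ i $ l) $ i $ l) S" for i l
      using assms(1) by (cases "l = k") (simp_all add: joint_holomorphic_on_chol)
  qed (use assms in \<open>auto simp: joint_holomorphic_on_chol invertible_det_nz\<close>)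
  then show "chol (\<lambda>w. matrix_inv (F w) $ k $ j) S"
    by (rule chol_transform) (simp_all add: assms matrix_inv_entry)
qed

lemma invertible_near_one: "\<exists>e>0. \<forall>A :: complex ^ 'k ^ 'k. norm (A - mat 1) < e \<longrightarrow> invertible A"
proof -
  have "continuous_on UNIV (\<lambda>A :: complex ^ 'k ^ 'k. det A)"
    unfolding det_def by (intro continuous_intros)
  then have "open ((\<lambda>A :: complex ^ 'k ^ 'k. det A) -` (- {0}))"
    by (intro open_vimage) auto
  moreover have "mat 1 \<in> (\<lambda>A :: complex ^ 'k ^ 'k. det A) -` (- {0})" by simp
  ultimately obtain e where "e > 0" "\<And>A :: complex ^ 'k ^ 'k. dist A (mat 1) < e \<Longrightarrow> det A \<noteq> 0"
    unfolding open_dist by (metis ComplD insertI1 vimageE)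
  then show ?thesis
    by (auto simp: invertible_det_nz dist_norm)
qed

text \<open>The value follows by differentiating \<open>F x ** matrix_inv (F x) = mat 1\<close>;
  that a derivative exists is supplied in \<open>mat_deriv_inverse\<close>.\<close>

lemma mat_deriv_matrix_inv:
  assumes F: "\<And>x. x \<in> S \<Longrightarrow> mat_deriv F (F' x) x" and S: "open S" "z \<in> S"
    and inv: "\<And>x. x \<in> S \<Longrightarrow> invertible (F x)" and G: "mat_deriv (\<lambda>x. matrix_inv (F x)) G' z"
  shows "G' = - (matrix_inv (F z) ** F' z ** matrix_inv (F z))"
proof -
  have "mat_deriv (\<lambda>x. F x ** matrix_inv (F x)) (F' z ** matrix_inv (F z) + F z ** G') z"
    by (rule mat_deriv_mult [OF F [OF S(2)] G])
  moreover have "mat_deriv (\<lambda>x. F x ** matrix_inv (F x)) 0 z"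
    by (rule mat_deriv_transform [OF mat_deriv_const [of "mat 1"] S])
      (simp add: matrix_inv_works(1) [OF inv])
  ultimately have "F' z ** matrix_inv (F z) + F z ** G' = 0"
    by (rule mat_deriv_unique)
  then have "matrix_inv (F z) ** (F' z ** matrix_inv (F z)) + (matrix_inv (F z) ** F z) ** G' = 0"
    by (metis matrix_add_ldistrib matrix_mul_assoc matrix_mult_0(2))
  then show ?thesis
    using matrix_inv_works(2) [OF inv [OF S(2)]] by (simp add: matrix_mul_assoc eq_neg_iff_add_eq_0 add.commute)
qed

section \<open>Non-resonant matrices\<close>

lemma mat_scale_minus_right: "mat_scale c (- A) = - mat_scale c A"
  by (simp add: vec_eq_iff)

text \<open>More vectors than the dimension are dependent. Dependence concerns a set of vectors, so
  a repetition among the \<open>v i\<close> is treated apart, by the relation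
  \<open>v i - v j = 0\<close>. Applied to the iterates of an operator, this produces an
  annihilating polynomial.\<close>

lemma iterates_dependent:
  fixes v :: "nat \<Rightarrow> 'a :: euclidean_space"
  shows "\<exists>c N. (\<exists>i\<le>N. c i \<noteq> 0) \<and> (\<Sum>i\<le>N. c i *\<^sub>R v i) = 0"
proof (cases "inj_on v {..DIM('a)}")
  case True
  have "dependent (v ` {..DIM('a)})"
    by (rule dependent_biggerset) (simp add: card_image [OF True])
  then obtain u where "\<exists>x\<in>v ` {..DIM('a)}. u x \<noteq> 0" "(\<Sum>x\<in>v ` {..DIM('a)}. u x *\<^sub>R x) = 0"
    by (subst (asm) dependent_finite) auto
  then show ?thesis
    by (intro exI [of _ "\<lambda>i. u (v i)"] exI [of _ "DIM('a)"]) (auto simp: sum.reindex [OF True])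
next
  case False
  then obtain i j where ij: "i \<le> DIM('a)" "j \<le> DIM('a)" "i \<noteq> j" "v i = v j"
    by (auto simp: inj_on_def)
  define c where "c l = (if l = i then 1 else 0) - (if l = j then 1 else (0::real))" for l
  have "(\<Sum>l\<le>DIM('a). c l *\<^sub>R v l) = v i - v j"
    using ij by (simp add: c_def scaleR_diff_left sum_subtractf if_distrib [of "\<lambda>x. x *\<^sub>R _"] cong: if_cong)
  with ij show ?thesis
    by (intro exI [of _ c] exI [of _ "DIM('a)"]) (auto simp: c_def)
qed

text \<open>The matrix \<open>p(T) X\<close>. The operators in question are right multiplication by
  \<open>A\<close> and the commutator with \<open>A\<close>.\<close>

definition poly_op :: "(complex ^ 'k ^ 'k \<Rightarrow> complex ^ 'k ^ 'k) \<Rightarrow> complex poly \<Rightarrow> complex ^ 'k ^ 'k \<Rightarrow> complex ^ 'k ^ 'k" where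
  "poly_op T p X = (\<Sum>i\<le>degree p. mat_scale (coeff p i) ((T ^^ i) X))"

lemma poly_op_altdef:
  "degree p \<le> n \<Longrightarrow> poly_op T p X = (\<Sum>i\<le>n. mat_scale (coeff p i) ((T ^^ i) X))"
  unfolding poly_op_def by (rule sum.mono_neutral_left) (auto simp: coeff_eq_0)

locale mat_linear =
  fixes T :: "complex ^ 'k::finite ^ 'k \<Rightarrow> complex ^ 'k ^ 'k"
  assumes T_diff: "T (X - Y) = T X - T Y" and T_scale: "T (mat_scale c X) = mat_scale c (T X)"
begin

lemma T_pow_diff: "(T ^^ i) (X - Y) = (T ^^ i) X - (T ^^ i) Y"
  by (induction i) (simp_all add: T_diff)

lemma T_pow_scale: "(T ^^ i) (mat_scale c X) = mat_scale c ((T ^^ i) X)"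
  by (induction i) (simp_all add: T_scale)

lemma poly_op_linear_factor:
  "poly_op T ([:- z, 1:] * q) X = poly_op T q (T X - mat_scale z X)"
proof -
  let ?n = "degree q"
  have "degree ([:- z, 1:] * q) \<le> Suc ?n"
    using degree_mult_le [of "[:- z, 1:]" q] by (simp del: mult_pCons_left)
  then have "poly_op T ([:- z, 1:] * q) X =
      (\<Sum>i\<le>Suc ?n. mat_scale (coeff (pCons 0 q) i - z * coeff q i) ((T ^^ i) X))"
    by (subst poly_op_altdef) (simp_all del: sum.atMost_Suc)
  also have "\<dots> = (\<Sum>i\<le>Suc ?n. mat_scale (coeff (pCons 0 q) i) ((T ^^ i) X)) -
      (\<Sum>i\<le>Suc ?n. mat_scale (coeff q i) ((T ^^ i) (mat_scale z X)))"
    by (simp add: mat_scale_diff_left sum_subtractf T_pow_scale mult_ac del: sum.atMost_Suc)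
  also have "(\<Sum>i\<le>Suc ?n. mat_scale (coeff (pCons 0 q) i) ((T ^^ i) X)) = poly_op T q (T X)"
    unfolding sum.atMost_Suc_shift by (simp add: poly_op_def funpow_swap1 del: funpow.simps) (simp add: funpow_swap1)
  also have "(\<Sum>i\<le>Suc ?n. mat_scale (coeff q i) ((T ^^ i) (mat_scale z X))) = poly_op T q (mat_scale z X)"
    by (rule poly_op_altdef [symmetric]) simp
  finally show ?thesis
    by (simp add: poly_op_def T_pow_diff mat_scale_diff_right sum_subtractf)
qed

text \<open>After splitting off a root \<open>z\<close> of \<open>p\<close>, either \<open>X\<close>
  is itself an eigenvector or \<open>T X - mat_scale z X\<close> is a nonzero matrix annihilated by
  the quotient. The predicate \<open>Inv\<close> plays the part of an invariant subspace in which
  the eigenvector is to be found.\<close>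

lemma eigenvector_of_poly:
  assumes "p \<noteq> 0" "poly_op T p X = 0" "X \<noteq> 0" "Inv X"
    and Inv: "\<And>X z. Inv X \<Longrightarrow> Inv (T X - mat_scale z X)"
  shows "\<exists>z X. X \<noteq> 0 \<and> Inv X \<and> T X = mat_scale z X"
  using assms(1-4)
proof (induction "degree p" arbitrary: p X)
  case 0
  then obtain c where "p = [:c:]"
    by (metis degree_eq_zeroE)
  then show ?case using 0 by (simp add: poly_op_def)
next
  case (Suc n)
  have "\<not> (\<exists>a l. a \<noteq> 0 \<and> l = 0 \<and> p = pCons a l)"
    using Suc.hyps(2) by auto
  then obtain z where "poly p z = 0"
    using fundamental_theorem_of_algebra_alt by blast
  then obtain q where q: "p = [:- z, 1:] * q"
    by (metis poly_eq_0_iff_dvd dvdE)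
  have "q \<noteq> 0" using q Suc.prems by auto
  then have deg: "degree q = n"
    using Suc.hyps(2) unfolding q by (subst (asm) degree_mult_eq) auto
  show ?case
  proof (cases "T X - mat_scale z X = 0")
    case True
    with Suc.prems show ?thesis by auto
  next
    case False
    show ?thesis
      by (rule Suc.hyps(1) [OF deg [symmetric] \<open>q \<noteq> 0\<close> _ False Inv [OF Suc.prems(4)]])
        (use Suc.prems(2) in \<open>simp add: q poly_op_linear_factor del: mult_pCons_left\<close>)
  qed
qed

lemma invariant_eigenvector:
  assumes "X \<noteq> 0" "Inv X" and Inv: "\<And>X z. Inv X \<Longrightarrow> Inv (T X - mat_scale z X)"
  shows "\<exists>z X. X \<noteq> 0 \<and> Inv X \<and> T X = mat_scale z X"
proof -
  obtain c N where c: "\<exists>i\<le>N. c i \<noteq> 0" "(\<Sum>i\<le>N. c i *\<^sub>R (T ^^ i) X) = 0"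
    using iterates_dependent [of "\<lambda>i. (T ^^ i) X"] by blast
  define p where "p = (\<Sum>i\<le>N. monom (complex_of_real (c i)) i)"
  have coeff: "coeff p i = (if i \<le> N then c i else 0)" for i
    by (simp add: p_def coeff_sum coeff_monom)
  have "degree p \<le> N"
    by (rule degree_le) (simp add: coeff)
  then have "poly_op T p X = (\<Sum>i\<le>N. c i *\<^sub>R (T ^^ i) X)"
    by (simp add: poly_op_altdef scaleR_eq_mat_scale coeff)
  moreover have "p \<noteq> 0"
    using c(1) coeff by (metis coeff_0 of_real_eq_0_iff)
  ultimately show ?thesis
    using eigenvector_of_poly [OF _ _ assms(1,2) Inv] c(2) by simp
qed

end

lemma matrix_vector_mult_mat_scale: "mat_scale c A *v v = c *s (A *v v)"
  by (simp add: vec_eq_iff matrix_vector_mult_def sum_distrib_left mult_ac)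

lemma not_eigenvalue_right_inverse:
  assumes "\<not> is_eigenvalue (A :: complex ^ 'k ^ 'k) z"
  shows "\<exists>B. (A - mat_scale z (mat 1)) ** B = mat 1"
proof -
  have "x = 0" if "(A - mat_scale z (mat 1)) *v x = 0" for x
    using that assms
    by (auto simp: is_eigenvalue_def matrix_vector_mult_diff_rdistrib matrix_vector_mult_mat_scale)
  then show ?thesis
    using matrix_left_invertible_ker matrix_left_right_inverse by blast
qed

text \<open>On the solutions of the commutator equation right multiplication by \<open>A\<close> has
  an eigenvector \<open>Y\<close>, with \<open>Y ** A = mat_scale z Y\<close> and
  \<open>A ** Y = mat_scale (z + of_int m) Y\<close>. Columns of \<open>Y\<close> show that
  \<open>z + m\<close> is an eigenvalue of \<open>A\<close>, rows that \<open>z\<close> is one, and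
  non-resonance forbids this.\<close>

lemma non_resonant_commutator:
  fixes A :: "complex ^ 'k ^ 'k"
  assumes A: "non_resonant A" and X: "A ** X - X ** A = mat_scale (of_int m) X" and m: "m \<noteq> 0"
  shows "X = 0"
proof (rule ccontr)
  assume "X \<noteq> 0"
  interpret mat_linear "\<lambda>Y. Y ** A"
    by unfold_locales (simp_all add: mat_algebra)
  have "\<exists>z Y. Y \<noteq> 0 \<and> A ** Y - Y ** A = mat_scale (of_int m) Y \<and> Y ** A = mat_scale z Y"
  proof (rule invariant_eigenvector [where Inv = "\<lambda>Y. A ** Y - Y ** A = mat_scale (of_int m) Y", OF \<open>X \<noteq> 0\<close> X])
    fix Y z assume Y: "A ** Y - Y ** A = mat_scale (of_int m) Y"
    then have "A ** Y = Y ** A + mat_scale (of_int m) Y" by (simp add: algebra_simps)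
    then show "A ** (Y ** A - mat_scale z Y) - (Y ** A - mat_scale z Y) ** A =
        mat_scale (of_int m) (Y ** A - mat_scale z Y)"
      by (simp add: mat_algebra matrix_mul_assoc [of A Y]) (simp add: mat_algebra mult_ac)
  qed
  then obtain z Y where Y: "Y \<noteq> 0" "A ** Y - Y ** A = mat_scale (of_int m) Y" "Y ** A = mat_scale z Y"
    by blast
  then have AY: "A ** Y = mat_scale (z + of_int m) Y"
    by (simp add: mat_scale_add_left algebra_simps)
  obtain i j where ij: "Y $ i $ j \<noteq> 0"
    using Y(1) by (auto simp: vec_eq_iff)
  have "A *v (\<chi> a. Y $ a $ j) = (z + of_int m) *s (\<chi> a. Y $ a $ j)"
  proof -
    have "(A ** Y) $ a $ j = (z + of_int m) * Y $ a $ j" for a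
      using AY by simp
    then show ?thesis
      by (simp add: vec_eq_iff matrix_vector_mult_def matrix_mult_nth distrib_right)
  qed
  moreover have "(\<chi> a. Y $ a $ j) \<noteq> 0"
    using ij by (auto simp: vec_eq_iff)
  ultimately have e1: "is_eigenvalue A (z + of_int m)"
    unfolding is_eigenvalue_def by blast
  \<comment> \<open>The rows of \<open>Y\<close> are left eigenvectors. The definition asks for
    right ones, so the argument runs through the singularity of \<open>A - z\<close>.\<close>
  have e2: "is_eigenvalue A z"
  proof (rule ccontr)
    assume "\<not> is_eigenvalue A z"
    then obtain B where B: "(A - mat_scale z (mat 1)) ** B = mat 1"
      using not_eigenvalue_right_inverse by blast
    have "Y = (Y ** (A - mat_scale z (mat 1))) ** B"
      by (metis B matrix_mul_assoc matrix_mul_rid)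
    also have "\<dots> = 0" using Y(3) by (simp add: mat_algebra)
    finally show False using Y(1) by simp
  qed
  have "(z + of_int m) - z \<noteq> of_int m"
    using A m e1 e2 unfolding non_resonant_def by blast
  then show False by simp
qed

lemma mat_exp_scalar: "mat_exp (mat_scale c (mat 1)) = mat_scale (exp c) (mat 1 :: complex ^ 'k ^ 'k)"
proof -
  have "mat_deriv (\<lambda>w. mat_scale (exp w) (mat 1 :: complex ^ 'k ^ 'k)) (mat 1 ** mat_scale (exp w) (mat 1)) w" for w
    unfolding mat_deriv_def by (auto intro!: derivative_eq_intros)
  from linear_ode_unique [OF this, of c] show ?thesis by simp
qed

lemma mat_deriv_add: "mat_deriv F F' z \<Longrightarrow> mat_deriv G G' z \<Longrightarrow> mat_deriv (\<lambda>z. F z + G z) (F' + G') z"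
  unfolding mat_deriv_def by (auto intro!: derivative_eq_intros)

lemma matrix_mult_invertible_cancel:
  fixes X E :: "complex ^ 'k ^ 'k"
  assumes "X ** E = 0" "invertible E"
  shows "X = 0"
proof -
  have "X = X ** E ** matrix_inv E"
    by (simp add: matrix_inv_works [OF assms(2)] matrix_mul_assoc [symmetric])
  then show ?thesis using assms(1) by simp
qed

text \<open>The eigenvalues of \<open>ad a\<close>, where \<open>a = 2 \<pi> \<i> A\<close>, on the kernel of \<open>exp (ad a) - 1\<close> lie in
  \<open>2 \<pi> \<i> \<int>\<close>, so only \<open>0\<close> is left in the non-resonant case, and \<open>ad a\<close> has no nilpotent part there.\<close>

lemma commute_of_commute_exp:
  fixes A :: "complex ^ 'k ^ 'k"
  assumes A: "non_resonant A"
    and B: "mat_exp (mat_scale (2 * pi * \<i>) A) ** B = B ** mat_exp (mat_scale (2 * pi * \<i>) A)"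
  shows "A ** B = B ** A"
proof (rule ccontr)
  assume "A ** B \<noteq> B ** A"
  then have ne: "A ** B - B ** A \<noteq> 0" by simp
  let ?E = "mat_exp (mat_scale (2 * pi * \<i>) A)"
  \<comment> \<open>\<open>Inv\<close> is the image, under the commutator with \<open>A\<close>, of
    the matrices that commute with \<open>?E\<close>. An eigenvector taken from this image is again
    a commutator, and this is what later excludes a nilpotent part.\<close>
  define Inv where "Inv X \<longleftrightarrow> (\<exists>B. X = A ** B - B ** A \<and> ?E ** B = B ** ?E)" for X
  interpret mat_linear "\<lambda>Y. A ** Y - Y ** A"
    by unfold_locales (simp_all add: mat_algebra)
  have EA: "?E ** A = A ** ?E"
    by (rule mat_exp_commute [symmetric])
  have E_bracket: "?E ** (A ** C - C ** A) = (A ** C - C ** A) ** ?E" if "?E ** C = C ** ?E" for C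
  proof -
    have "?E ** (A ** C) = (A ** C) ** ?E" "?E ** (C ** A) = (C ** A) ** ?E"
      using that EA by (metis matrix_mul_assoc)+
    then show ?thesis by (simp only: matrix_mult_diff_left matrix_mult_diff_right)
  qed
  have "\<exists>z X. X \<noteq> 0 \<and> Inv X \<and> A ** X - X ** A = mat_scale z X"
  proof (rule invariant_eigenvector [where Inv = Inv, OF ne])
    show "Inv (A ** B - B ** A)" unfolding Inv_def using B by blast
    fix X z assume "Inv X"
    then obtain C where C: "X = A ** C - C ** A" "?E ** C = C ** ?E" unfolding Inv_def by blast
    have "?E ** (X - mat_scale z C) = (X - mat_scale z C) ** ?E"
      using E_bracket [OF C(2)] C by (simp only: mat_algebra)
    then show "Inv (A ** X - X ** A - mat_scale z X)"
      unfolding Inv_def by (intro exI [of _ "X - mat_scale z C"]) (simp add: mat_algebra C(1))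
  qed
  then obtain z X C where X: "X \<noteq> 0" "A ** X - X ** A = mat_scale z X" "X = A ** C - C ** A" "?E ** C = C ** ?E"
    unfolding Inv_def by blast
  have EX: "?E ** X = X ** ?E" using E_bracket X by simp
  have AX: "A ** X = X ** A + mat_scale z X" using X(2) by (simp add: algebra_simps)
  \<comment> \<open>Since \<open>A ** X = X ** (A + z)\<close>, \<open>X\<close> intertwines the
    exponentials of \<open>2 * pi * \<i>\<close> times \<open>A + z\<close> and \<open>A\<close>. As
    \<open>X\<close> also commutes with \<open>?E\<close>, the scalar
    \<open>exp (2 * pi * \<i> * z)\<close> must be 1.\<close>
  have "X ** (mat_scale (2 * pi * \<i>) A + mat_scale (2 * pi * \<i> * z) (mat 1)) = mat_scale (2 * pi * \<i>) A ** X"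
    by (simp add: mat_algebra AX mult_ac)
  then have "X ** mat_exp (mat_scale (2 * pi * \<i>) A + mat_scale (2 * pi * \<i> * z) (mat 1)) = ?E ** X"
    by (rule matrix_mult_mat_exp)
  then have "mat_scale (exp (2 * pi * \<i> * z)) X ** ?E = X ** ?E"
  proof -
    have "mat_exp (mat_scale (2 * pi * \<i>) A + mat_scale (2 * pi * \<i> * z) (mat 1)) =
        ?E ** mat_exp (mat_scale (2 * pi * \<i> * z) (mat 1))"
      by (rule mat_exp_add) (simp add: mat_algebra mult_ac)
    with \<open>X ** mat_exp _ = ?E ** X\<close> show ?thesis
      unfolding EX by (simp add: mat_exp_scalar mat_algebra)
  qed
  then have "mat_scale (exp (2 * pi * \<i> * z) - 1) X ** ?E = 0"
    by (simp add: mat_scale_diff_left mat_algebra)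
  then have "mat_scale (exp (2 * pi * \<i> * z) - 1) X = 0"
    using matrix_mult_invertible_cancel invertible_mat_exp by blast
  then have "exp (2 * pi * \<i> * z) = 1" using X(1) by simp
  then obtain m :: int where m: "2 * pi * \<i> * z = of_int (2 * m) * pi * \<i>"
    unfolding exp_eq_1 by (auto simp: complex_eq_iff)
  then have "z = of_int m" by simp
  with X non_resonant_commutator [OF A] have "z = 0"
    by (metis of_int_0)
  define Z where "Z = mat_scale (2 * pi * \<i>) X"
  define a where "a = mat_scale (2 * pi * \<i>) A"
  have aC: "a ** C = C ** a + Z" and aZ: "a ** Z = Z ** a"
    using AX \<open>z = 0\<close> by (simp_all add: a_def Z_def X(3) [symmetric] mat_algebra mult_ac)
      (simp add: X(3) mat_algebra)
  \<comment> \<open>With \<open>z = 0\<close> the commutator \<open>Z\<close> of \<open>a\<close>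
    and \<open>C\<close> commutes with \<open>a\<close>, so conjugation by the exponential of
    \<open>a\<close> sends \<open>C\<close> exactly to \<open>C + Z\<close>. But \<open>C\<close>
    commutes with this exponential, whence \<open>Z = 0\<close>.\<close>
  have "mat_deriv (\<lambda>w. (C + mat_scale w Z) ** mat_exp (mat_scale w a))
      (a ** ((C + mat_scale w Z) ** mat_exp (mat_scale w a))) w" for w
  proof -
    have "mat_deriv (\<lambda>w. C + mat_scale w Z) (0 + Z) w"
      by (rule mat_deriv_add [OF mat_deriv_const]) (auto simp: mat_deriv_def intro!: derivative_eq_intros)
    from mat_deriv_mult [OF this mat_deriv_exp [of a w]]
    have "mat_deriv (\<lambda>w. (C + mat_scale w Z) ** mat_exp (mat_scale w a))
       ((Z + (C + mat_scale w Z) ** a) ** mat_exp (mat_scale w a)) w"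
      by (simp add: mat_algebra)
    moreover have "Z + (C + mat_scale w Z) ** a = a ** (C + mat_scale w Z)"
      by (simp add: mat_algebra aC aZ)
    ultimately show ?thesis
      by (simp add: matrix_mul_assoc)
  qed
  from linear_ode_unique [OF this, of 1] have "(C + Z) ** mat_exp a = mat_exp a ** C"
    by simp
  then have "Z ** mat_exp a = 0"
    using X(4) by (simp add: mat_algebra a_def)
  then have "Z = 0"
    using matrix_mult_invertible_cancel invertible_mat_exp by blast
  then show False using X(1) by (simp add: Z_def)
qed

text \<open>Since \<open>B\<close> commutes with its own exponential, which is also that of
  \<open>A\<close>, it commutes with \<open>A\<close>, and the exponentials can be divided. The
  constant: \<open>2 * pi < 8\<close> and \<open>8 / 32 = 1 / 4\<close>, the bound of
  \<open>mat_exp_eq_one_small\<close>.\<close>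

lemma mat_exp_eq_near:
  fixes A B :: "complex ^ 'k ^ 'k"
  assumes A: "non_resonant A" and near: "norm (A - B) < 1 / 32"
    and eq: "mat_exp (mat_scale (2 * pi * \<i>) A) = mat_exp (mat_scale (2 * pi * \<i>) B)"
  shows "A = B"
proof -
  let ?a = "mat_scale (2 * pi * \<i>) A" and ?b = "mat_scale (2 * pi * \<i>) B"
  have "A ** B = B ** A"
    by (rule commute_of_commute_exp [OF A]) (unfold eq, rule mat_exp_commute [symmetric])
  then have "mat_exp (?a + - ?b) = mat_exp ?a ** mat_exp (- ?b)"
    by (intro mat_exp_add) (simp add: mat_algebra mat_scale_minus_right mult_ac)
  then have "mat_exp (?a - ?b) = mat 1"
    using eq mat_exp_minus(2) [of ?b] by simp
  moreover have "norm (?a - ?b) < 1 / 4"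
  proof -
    have "norm (?a - ?b) = 2 * pi * norm (A - B)"
      by (simp add: mat_scale_diff_right [symmetric] norm_mat_scale norm_mult)
    also have "\<dots> \<le> 8 * norm (A - B)"
      using pi_less_4 by (intro mult_right_mono) auto
    finally show ?thesis using near by simp
  qed
  ultimately have "?a - ?b = 0"
    by (rule mat_exp_eq_one_small)
  then show ?thesis
    by (simp add: mat_scale_diff_right [symmetric])
qed

text \<open>A Sylvester operator, \<open>c\<close> minus the commutator with \<open>A\<close>. For
  \<open>c = m\<close> it is what must be inverted to find the coefficient of order \<open>m\<close>
  in the Frobenius series.\<close>

definition sylv :: "complex \<Rightarrow> complex ^ 'k ^ 'k \<Rightarrow> complex ^ 'k ^ 'k \<Rightarrow> complex ^ 'k ^ 'k" where
  "sylv c A X = mat_scale c X - A ** X + X ** A"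

lemma linear_sylv: "linear (sylv c A)"
  by (rule linearI) (simp_all add: sylv_def mat_algebra scaleR_eq_mat_scale mult_ac mat_scale_minus_left)

text \<open>Non-resonance makes every operator with \<open>m \<ge> 1\<close> injective, hence
  bounded below; a common bound exists because \<open>m * norm X\<close> dominates for
  \<open>m \<ge> 2 * norm A + 1\<close>, which leaves finitely many \<open>m\<close>.\<close>

lemma sylv_lower_bound:
  assumes "non_resonant A"
  shows "\<exists>c>0. \<forall>m X. m \<ge> 1 \<longrightarrow> c * norm X \<le> norm (sylv (of_nat m) A X)"
proof -
  define N where "N = nat \<lceil>2 * norm A + 1\<rceil>"
  have "\<exists>B>0. \<forall>X. B * norm X \<le> norm (sylv (of_nat m) A X)" if "m \<ge> 1" for m
  proof -
    have "inj (sylv (of_nat m) A)"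
      unfolding linear_injective_0 [OF linear_sylv]
    proof (intro allI impI)
      fix X assume "sylv (of_nat m) A X = 0"
      then have "A ** X - X ** A = mat_scale (of_int (int m)) X"
        by (simp add: sylv_def algebra_simps)
      then show "X = 0"
        using non_resonant_commutator [OF assms] that by fastforce
    qed
    from linear_inj_bounded_below_pos [OF linear_sylv this] show ?thesis
      by metis
  qed
  then obtain B where B: "\<And>m. m \<ge> 1 \<Longrightarrow> B m > 0" "\<And>m X. m \<ge> 1 \<Longrightarrow> B m * norm X \<le> norm (sylv (of_nat m) A X)"
    by metis
  \<comment> \<open>The inserted 1 is the bound that holds for \<open>m > N\<close>.\<close>
  define c where "c = Min (insert 1 (B ` {1..N}))"
  have c: "c > 0" "c \<le> 1" "\<And>m. 1 \<le> m \<Longrightarrow> m \<le> N \<Longrightarrow> c \<le> B m"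
    using B(1) unfolding c_def by (auto intro!: Min_le simp del: Min_insert)
  have "c * norm X \<le> norm (sylv (of_nat m) A X)" if "m \<ge> 1" for m X
  proof (cases "m \<le> N")
    case True
    then show ?thesis
      using B(2) [OF that, of X] c(3) [OF that True] mult_right_mono [of c "B m" "norm X"] by simp
  next
    case False
    then have "2 * norm A + 1 \<le> real m"
      unfolding N_def by linarith
    then have "c * norm X \<le> (real m - 2 * norm A) * norm X"
      using c by (intro mult_right_mono) auto
    also have "\<dots> = real m * norm X - norm A * norm X - norm X * norm A"
      by (simp add: algebra_simps)
    also have "\<dots> \<le> norm (mat_scale (of_nat m) X) - norm (A ** X) - norm (X ** A)"
      using norm_matrix_mult_le [of A X] norm_matrix_mult_le [of X A]
      by (simp add: norm_mat_scale mult.commute [of "norm X"])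
    also have "\<dots> \<le> norm (sylv (of_nat m) A X)"
      using norm_triangle_ineq4 [of "sylv (of_nat m) A X" "X ** A - A ** X"]
        norm_triangle_ineq4 [of "X ** A" "A ** X"] by (simp add: sylv_def)
    finally show ?thesis .
  qed
  with c(1) show ?thesis by blast
qed

text \<open>The admissible perturbation does not depend on \<open>m\<close>. So one bound at
  \<open>t0\<close> serves all \<open>m\<close> and all nearby \<open>t\<close>, and the eigenvalues
  need not be followed as \<open>t\<close> moves.\<close>

lemma sylv_lower_bound_perturb:
  assumes "c * norm X \<le> norm (sylv m A X)" "norm (A - B) \<le> c / 4"
  shows "c / 2 * norm X \<le> norm (sylv m B X)"
proof -
  have "sylv m A X = sylv m B X - (A - B) ** X + X ** (A - B)"
    by (simp add: sylv_def mat_algebra)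
  then have "norm (sylv m A X) \<le> norm (sylv m B X) + norm ((A - B) ** X) + norm (X ** (A - B))"
    using norm_triangle_ineq [of "sylv m B X - (A - B) ** X" "X ** (A - B)"]
      norm_triangle_ineq4 [of "sylv m B X" "(A - B) ** X"] by simp
  moreover have "norm ((A - B) ** X) \<le> c / 4 * norm X"
    by (rule order_trans [OF norm_matrix_mult_le mult_right_mono [OF assms(2)]]) simp
  moreover have "norm (X ** (A - B)) \<le> norm X * (c / 4)"
    by (rule order_trans [OF norm_matrix_mult_le mult_left_mono [OF assms(2)]]) simp
  ultimately show ?thesis
    using assms(1) by (simp add: algebra_simps)
qed

section \<open>Frobenius series with parameters\<close>

definition mat_vec :: "complex ^ 'k ^ 'k \<Rightarrow> complex ^ ('k \<times> 'k)" where
  "mat_vec X = (\<chi> p. X $ fst p $ snd p)"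

definition vec_mat :: "complex ^ ('k \<times> 'k) \<Rightarrow> complex ^ 'k ^ 'k" where
  "vec_mat v = (\<chi> i j. v $ (i, j))"

text \<open>\<open>sylv c A\<close> written as a matrix on the flattened space of index pairs, that
  is, \<open>c\<close> minus the Kronecker product of \<open>A\<close> with 1 plus that of 1 with
  the transpose of \<open>A\<close>. In this form the inverse is accessible to Cramer's rule and
  depends holomorphically on \<open>A\<close>.\<close>

definition sylv_mat :: "complex \<Rightarrow> complex ^ 'k ^ 'k \<Rightarrow> complex ^ ('k \<times> 'k) ^ ('k \<times> 'k)" where
  "sylv_mat c A = (\<chi> p q. (if p = q then c else 0) - (if snd p = snd q then A $ fst p $ fst q else 0) +
     (if fst p = fst q then A $ snd q $ snd p else 0))"

lemma vec_mat_vec [simp]: "vec_mat (mat_vec X) = X" and mat_vec_mat [simp]: "mat_vec (vec_mat v) = v"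
  by (simp_all add: vec_mat_def mat_vec_def vec_eq_iff)

lemma sum_UNIV_prod:
  fixes f :: "'k::finite \<times> 'l::finite \<Rightarrow> 'a::comm_monoid_add"
  shows "sum f UNIV = (\<Sum>a\<in>UNIV. \<Sum>b\<in>UNIV. f (a, b))"
  by (simp add: sum.cartesian_product)

lemma sylv_mat_mat_vec: "sylv_mat c A *v mat_vec X = mat_vec (sylv c A X)"
proof -
  have "(sylv_mat c A *v mat_vec X) $ (i, j) = mat_vec (sylv c A X) $ (i, j)" for i j
  proof -
    let ?x = "\<lambda>q. X $ fst q $ snd q"
    have 1: "(\<Sum>q\<in>UNIV. (if (i, j) = q then c else 0) * ?x q) = c * X $ i $ j"
      by (simp add: if_distrib [of "\<lambda>y. y * _"] cong: if_cong)
    have 2: "(\<Sum>q\<in>UNIV. (if j = snd q then A $ i $ fst q else 0) * ?x q) = (A ** X) $ i $ j"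
      by (simp add: sum_UNIV_prod matrix_mult_nth if_distrib [of "\<lambda>y. y * _"] cong: if_cong)
    have 3: "(\<Sum>q\<in>UNIV. (if i = fst q then A $ snd q $ j else 0) * ?x q) = (X ** A) $ i $ j"
      unfolding sum_UNIV_prod
      by (subst sum.swap) (simp add: matrix_mult_nth if_distrib [of "\<lambda>y. y * _"] cong: if_cong, simp add: mult.commute)
    have "(sylv_mat c A *v mat_vec X) $ (i, j) =
        (\<Sum>q\<in>UNIV. (if (i, j) = q then c else 0) * ?x q) -
        (\<Sum>q\<in>UNIV. (if j = snd q then A $ i $ fst q else 0) * ?x q) +
        (\<Sum>q\<in>UNIV. (if i = fst q then A $ snd q $ j else 0) * ?x q)"
      by (simp add: sylv_mat_def matrix_vector_mult_def mat_vec_def ring_distribs sum.distrib sum_subtractf cong: if_cong)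
    then show ?thesis
      unfolding 1 2 3 by (simp add: mat_vec_def sylv_def)
  qed
  then show ?thesis
    by (simp add: vec_eq_iff)
qed

definition sylv_inv :: "complex \<Rightarrow> complex ^ 'k ^ 'k \<Rightarrow> complex ^ 'k ^ 'k \<Rightarrow> complex ^ 'k ^ 'k" where
  "sylv_inv c A R = vec_mat (matrix_inv (sylv_mat c A) *v mat_vec R)"

lemma sylv_inv:
  fixes A :: "complex ^ 'k ^ 'k"
  assumes "\<And>X. sylv c A X = 0 \<Longrightarrow> X = 0"
  shows "invertible (sylv_mat c A)" "sylv c A (sylv_inv c A R) = R"
proof -
  have "v = 0" if "sylv_mat c A *v v = 0" for v
  proof -
    have "mat_vec (sylv c A (vec_mat v)) = 0"
      using that sylv_mat_mat_vec [of c A "vec_mat v"] by simp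
    then have "vec_mat (mat_vec (sylv c A (vec_mat v))) = 0"
      by (simp add: vec_mat_def vec_eq_iff)
    then have "vec_mat v = 0"
      using assms by simp
    then show "v = 0"
      by (simp add: vec_mat_def vec_eq_iff)
  qed
  then show inv: "invertible (sylv_mat c A)"
    by (simp add: invertible_left_inverse matrix_left_invertible_ker)
  have "mat_vec (sylv c A (sylv_inv c A R)) = sylv_mat c A *v (matrix_inv (sylv_mat c A) *v mat_vec R)"
    unfolding sylv_inv_def by (simp flip: sylv_mat_mat_vec)
  also have "\<dots> = mat_vec R"
    using matrix_inv_works(1) [OF inv] by (simp add: matrix_vector_mul_assoc)
  finally show "sylv c A (sylv_inv c A R) = R"
    by (metis vec_mat_vec)
qed

lemma joint_hol_sylv_inv:
  assumes A: "joint_holomorphic_on A S" and R: "joint_holomorphic_on R S" and S: "open S"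
    and inj: "\<And>w X. w \<in> S \<Longrightarrow> sylv c (A w) X = 0 \<Longrightarrow> X = 0"
  shows "joint_holomorphic_on (\<lambda>w. sylv_inv c (A w) (R w)) S"
proof -
  have "chol (\<lambda>w. sylv_mat c (A w) $ p $ q) S" for p q
  proof -
    have "chol (\<lambda>w. (if snd p = snd q then A w $ fst p $ fst q else 0)) S"
      "chol (\<lambda>w. (if fst p = fst q then A w $ snd q $ snd p else 0)) S"
      using A by (cases "snd p = snd q"; cases "fst p = fst q"; simp add: joint_holomorphic_on_chol)+
    then show ?thesis
      unfolding sylv_mat_def vec_lambda_beta by (intro chol_add chol_diff chol_const)
  qed
  then have "joint_holomorphic_on (\<lambda>w. sylv_mat c (A w)) S"
    by (simp add: joint_holomorphic_on_chol)
  then have "joint_holomorphic_on (\<lambda>w. matrix_inv (sylv_mat c (A w))) S"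
    by (rule joint_hol_matrix_inv [OF _ S]) (use inj sylv_inv in blast)
  then show ?thesis
    using R unfolding joint_holomorphic_on_chol
    by (auto simp: sylv_inv_def vec_mat_def mat_vec_def matrix_vector_mult_def intro!: chol_sum chol_mult)
qed

text \<open>Coefficients of the series \<open>G\<close> with \<open>x G' = P G - G P 0\<close> and
  \<open>G = mat 1\<close> at 0, where \<open>P\<close> is the series of the \<open>P l t\<close>:
  in order \<open>m\<close> the terms with \<open>frob P m t\<close> form
  \<open>sylv (of_nat m) (P 0 t)\<close>, and the lower coefficients make up the right-hand
  side.\<close>

fun frob :: "(nat \<Rightarrow> complex ^ 'n \<Rightarrow> complex ^ 'k ^ 'k) \<Rightarrow> nat \<Rightarrow> complex ^ 'n \<Rightarrow> complex ^ 'k ^ 'k" where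
  "frob P m t = (if m = 0 then mat 1
     else sylv_inv (of_nat m) (P 0 t) (\<Sum>l\<in>{..<m}. P (m - l) t ** frob P l t))"

declare frob.simps [simp del]

lemma frob_0 [simp]: "frob P 0 t = mat 1"
  by (simp add: frob.simps)

text \<open>A discrete Gronwall inequality. The majorant reproduces itself, because
  \<open>q * (\<Sum>l<m. (1 + q) ^ l) = (1 + q) ^ m - 1\<close>; the bound drops the last 1.\<close>

lemma geometric_recursion_bound:
  fixes a :: "nat \<Rightarrow> real"
  assumes "q > 0" "\<And>m. m \<ge> 1 \<Longrightarrow> a m \<le> q * (\<Sum>l<m. a l)"  "a 0 \<ge> 0"
  shows "a m \<le> a 0 * (1 + q) ^ m"
proof (induction m rule: less_induct)
  case (less m)
  show ?case
  proof (cases "m = 0")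
    case False
    then have "a m \<le> q * (\<Sum>l<m. a l)" using assms(2) by simp
    also have "\<dots> \<le> q * (\<Sum>l<m. a 0 * (1 + q) ^ l)"
      using less assms(1) by (intro mult_left_mono sum_mono) auto
    also have "\<dots> = a 0 * (q * (\<Sum>l<m. (1 + q) ^ l))"
      by (simp add: sum_distrib_left mult_ac)
    also have "q * (\<Sum>l<m. (1 + q) ^ l) = (1 + q) ^ m - 1"
      using assms(1) power_diff_1_eq [of "1 + q" m] by simp
    also have "a 0 * ((1 + q) ^ m - 1) \<le> a 0 * (1 + q) ^ m"
      using assms(3) by (intro mult_left_mono) auto
    finally show ?thesis .
  qed simp
qed

text \<open>\<open>P l t\<close> are the coefficients of \<open>x\<close> times the coefficient
  matrix of the system, with \<open>P 0 t\<close> the residue. All bounds hold throughout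
  \<open>T\<close>, so the radius \<open>r\<close> is the same for all parameters;
  \<open>\<kappa>\<close> is the ratio of the geometric majorant of the series and controls how far
  the solution departs from \<open>mat 1\<close>.\<close>

locale frobenius =
  fixes P :: "nat \<Rightarrow> complex ^ 'n::finite \<Rightarrow> complex ^ 'k::finite ^ 'k"
    and T :: "(complex ^ 'n) set" and C \<eta> c r \<kappa> :: real
  assumes T: "open T"
    and P: "\<And>l. joint_holomorphic_on (\<lambda>w. P l (snd w)) (UNIV \<times> T)"
    and P_le: "\<And>l t. t \<in> T \<Longrightarrow> l \<ge> 1 \<Longrightarrow> norm (P l t) \<le> C / \<eta> ^ l"
    and lower: "\<And>m t X. t \<in> T \<Longrightarrow> m \<ge> 1 \<Longrightarrow> c * norm X \<le> norm (sylv (of_nat m) (P 0 t) X)"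
    and pos: "C > 0" "\<eta> > 0" "c > 0" "r > 0"
    and r: "r * (1 + C / c) / \<eta> \<le> \<kappa>" "\<kappa> \<le> 1 / 2"
begin

lemma sylv_inj: "t \<in> T \<Longrightarrow> m \<ge> 1 \<Longrightarrow> sylv (of_nat m) (P 0 t) X = 0 \<Longrightarrow> X = 0"
  using lower [of t m X] pos by (simp add: mult_le_0_iff)

lemma frob_rec:
  assumes "t \<in> T" "m \<ge> 1"
  shows "sylv (of_nat m) (P 0 t) (frob P m t) = (\<Sum>l<m. P (m - l) t ** frob P l t)"
  using sylv_inv(2) [OF sylv_inj [OF assms]] assms by (subst frob.simps) simp

lemma frob_hol: "joint_holomorphic_on (\<lambda>w. frob P m (snd w)) (UNIV \<times> T)"
proof (induction m rule: less_induct)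
  case (less m)
  show ?case
  proof (cases "m = 0")
    case False
    have "joint_holomorphic_on (\<lambda>w. sylv_inv (of_nat m) (P 0 (snd w))
        (\<Sum>l\<in>{..<m}. P (m - l) (snd w) ** frob P l (snd w))) (UNIV \<times> T)"
      using less False by (intro joint_hol_sylv_inv joint_hol_sum joint_hol_mult P open_Times T) 
        (use sylv_inj [of _ m] in auto)
    then show ?thesis
      using False by (subst frob.simps) simp
  qed simp
qed

definition b where "b = (1 + C / c) / \<eta>"

lemma b: "b > 0" "b * r \<le> \<kappa>" "\<kappa> > 0"
proof -
  show "b > 0" using pos by (simp add: b_def add_pos_pos)
  then show "b * r \<le> \<kappa>" "\<kappa> > 0" 
    using r pos by (simp_all add: b_def mult.commute) (metis (no_types) b_def mult.commute mult_pos_pos order_less_le_trans times_divide_eq_right \<open>b > 0\<close>)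
qed

lemma frob_le:
  assumes t: "t \<in> T"
  shows "norm (frob P m t) \<le> norm (mat 1 :: complex ^ 'k ^ 'k) * b ^ m"
proof -
  \<comment> \<open>The weight \<open>\<eta> ^ m\<close> absorbs the growth of the
    \<open>P l t\<close> and leaves a recursion with the constant factor
    \<open>C / c\<close>.\<close>
  define a where "a m = norm (frob P m t) * \<eta> ^ m" for m
  have "a m \<le> C / c * (\<Sum>l<m. a l)" if m: "m \<ge> 1" for m
  proof -
    have "c * norm (frob P m t) \<le> norm (\<Sum>l<m. P (m - l) t ** frob P l t)"
      using lower [OF t m, of "frob P m t"] by (simp add: frob_rec [OF t m])
    also have "\<dots> \<le> (\<Sum>l<m. C / \<eta> ^ (m - l) * norm (frob P l t))"
      by (rule sum_norm_le, rule order_trans [OF norm_matrix_mult_le], rule mult_right_mono)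
        (auto intro!: P_le t)
    finally have "c * norm (frob P m t) * \<eta> ^ m \<le> (\<Sum>l<m. C / \<eta> ^ (m - l) * norm (frob P l t)) * \<eta> ^ m"
      using pos by (intro mult_right_mono) auto
    also have "\<dots> = C * (\<Sum>l<m. a l)"
      unfolding sum_distrib_left sum_distrib_right a_def
    proof (intro sum.cong refl)
      fix l assume "l \<in> {..<m}"
      then have "\<eta> ^ m = \<eta> ^ (m - l) * \<eta> ^ l" by (simp flip: power_add)
      then show "C / \<eta> ^ (m - l) * norm (frob P l t) * \<eta> ^ m = C * (norm (frob P l t) * \<eta> ^ l)"
        using pos by simp
    qed
    finally show ?thesis
      using pos by (simp add: a_def field_simps)
  qed
  then have "a m \<le> a 0 * (1 + C / c) ^ m"
    by (rule geometric_recursion_bound [rotated]) (use pos in \<open>auto simp: a_def\<close>)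
  then show ?thesis
    using pos by (simp add: a_def b_def power_divide field_simps)
qed

definition sol :: "complex \<times> (complex ^ 'n) \<Rightarrow> complex ^ 'k ^ 'k" where
  "sol w = (\<chi> i j. \<Sum>m. frob P m (snd w) $ i $ j * fst w ^ m)"

lemma term_le:
  assumes "t \<in> T" "cmod x \<le> r"
  shows "norm (mat_scale (x ^ m) (frob P m t)) \<le> norm (mat 1 :: complex ^ 'k ^ 'k) * \<kappa> ^ m"
proof -
  have "norm (mat_scale (x ^ m) (frob P m t)) \<le> r ^ m * (norm (mat 1 :: complex ^ 'k ^ 'k) * b ^ m)"
    unfolding norm_mat_scale norm_power
    using assms pos frob_le by (intro mult_mono power_mono) auto
  also have "\<dots> = norm (mat 1 :: complex ^ 'k ^ 'k) * (b * r) ^ m"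
    by (simp add: power_mult_distrib)
  also have "\<dots> \<le> norm (mat 1 :: complex ^ 'k ^ 'k) * \<kappa> ^ m"
    using b pos by (intro mult_left_mono power_mono) auto
  finally show ?thesis .
qed

lemma entry_le:
  assumes "t \<in> T" "cmod x \<le> r"
  shows "cmod (frob P m t $ i $ j * x ^ m) \<le> norm (mat 1 :: complex ^ 'k ^ 'k) * \<kappa> ^ m"
  using order_trans [OF norm_mat_entry [of _ i j] term_le [OF assms, of m]] by (simp add: mult.commute)

lemma summable_kappa: "summable (\<lambda>m. norm (mat 1 :: complex ^ 'k ^ 'k) * \<kappa> ^ m)"
  using r b by (intro summable_mult summable_geometric) auto

lemma entry_summable:
  assumes "t \<in> T" "cmod x \<le> r"
  shows "summable (\<lambda>m. cmod (frob P m t $ i $ j * x ^ m))"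
  by (rule summable_comparison_test [OF _ summable_kappa]) (use entry_le [OF assms] in auto)

lemma sol_hol: "joint_holomorphic_on sol (ball 0 r \<times> T)"
  unfolding joint_holomorphic_on_chol sol_def
proof (intro allI)
  fix i j
  have "chol (\<lambda>w. \<Sum>m. frob P m (snd w) $ i $ j * fst w ^ m) (ball 0 r \<times> T)"
  proof (rule chol_suminf [OF _ _ _ summable_kappa])
    show "chol (\<lambda>w. frob P m (snd w) $ i $ j * fst w ^ m) (ball 0 r \<times> T)" for m
      using joint_hol_subset [OF frob_hol, of "ball 0 r \<times> T" m]
      by (intro chol_mult chol_power chol_fst) (auto simp: joint_holomorphic_on_chol)
  qed (use entry_le T in \<open>auto intro: open_Times\<close>)
  then show "chol (\<lambda>w. (\<chi> i j. \<Sum>m. frob P m (snd w) $ i $ j * fst w ^ m) $ i $ j) (ball 0 r \<times> T)"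
    by simp
qed

lemma sol_0: "sol (0, t) = mat 1"
  by (simp add: sol_def vec_eq_iff)

lemma sol_entry_sums:
  assumes "t \<in> T" "cmod x \<le> r"
  shows "(\<lambda>m. frob P m t $ i $ j * x ^ m) sums (sol (x, t) $ i $ j)"
  using summable_norm_cancel [OF entry_summable [OF assms]] by (simp add: sol_def summable_sums)

text \<open>Past the constant term the series is dominated by a geometric one, and
  \<open>\<kappa> / (1 - \<kappa>) \<le> 2 * \<kappa>\<close> because
  \<open>\<kappa> \<le> 1 / 2\<close>. With \<open>\<kappa>\<close> small enough this yields
  invertibility on the whole disc.\<close>

lemma sol_near_one:
  assumes t: "t \<in> T" and x: "cmod x \<le> r"
  shows "norm (sol (x, t) - mat 1) \<le> norm (mat 1 :: complex ^ 'k ^ 'k) * (2 * \<kappa>)"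
proof -
  have sm: "summable (\<lambda>m. norm (mat_scale (x ^ m) (frob P m t)))"
    by (rule summable_comparison_test [OF _ summable_kappa]) (use term_le [OF t x] in auto)
  have S: "(\<lambda>m. mat_scale (x ^ m) (frob P m t)) sums (\<Sum>m. mat_scale (x ^ m) (frob P m t))"
    by (rule summable_sums [OF summable_norm_cancel [OF sm]])
  have "(\<Sum>m. mat_scale (x ^ m) (frob P m t)) $ i $ j = sol (x, t) $ i $ j" for i j
    using bounded_linear.sums [OF bounded_linear_mat_entry S, of i j] sol_entry_sums [OF t x, of i j]
    by (simp add: sums_iff mult.commute)
  then have "(\<lambda>m. mat_scale (x ^ m) (frob P m t)) sums sol (x, t)"
    using S by (metis (no_types, lifting) vec_eq_iff)
  from sums_split_initial_segment [OF this, of 1]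
  have "(\<lambda>m. mat_scale (x ^ Suc m) (frob P (Suc m) t)) sums (sol (x, t) - mat 1)"
    by simp
  moreover have "norm (\<Sum>m. mat_scale (x ^ Suc m) (frob P (Suc m) t)) \<le>
      (\<Sum>m. norm (mat 1 :: complex ^ 'k ^ 'k) * \<kappa> ^ Suc m)"
    using summable_ignore_initial_segment [OF summable_kappa, of 1]
    by (intro norm_suminf_le term_le t x) simp
  moreover have "(\<Sum>m. norm (mat 1 :: complex ^ 'k ^ 'k) * \<kappa> ^ Suc m) = norm (mat 1 :: complex ^ 'k ^ 'k) * (\<kappa> * (1 / (1 - \<kappa>)))"
    using b r by (simp add: suminf_mult summable_geometric suminf_geometric summable_mult)
  moreover have "\<kappa> * (1 / (1 - \<kappa>)) \<le> 2 * \<kappa>"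
    using b r by (simp add: field_simps)
  ultimately show ?thesis
    by (metis (no_types, lifting) mult_left_mono norm_ge_zero order_trans sums_unique)
qed

lemma sol_deriv:
  assumes t: "t \<in> T" and x: "cmod x < r" and G': "mat_deriv (\<lambda>x. sol (x, t)) G' x"
  shows "(\<lambda>m. diffs (\<lambda>m. frob P m t $ i $ j) m * x ^ m) sums (G' $ i $ j)"
proof -
  let ?c = "\<lambda>m. frob P m t $ i $ j"
  have sm: "summable (\<lambda>m. ?c m * z ^ m)" if "cmod z < r" for z
    by (rule summable_norm_cancel [OF entry_summable [OF t]]) (use that in simp)
  have "((\<lambda>x. \<Sum>m. ?c m * x ^ m) has_field_derivative (\<Sum>m. diffs ?c m * x ^ m)) (at x)"
    by (rule termdiffs_strong' [OF sm x])
  moreover have "((\<lambda>x. \<Sum>m. ?c m * x ^ m) has_field_derivative G' $ i $ j) (at x)"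
    using G' by (simp add: mat_deriv_def sol_def)
  ultimately have "(\<Sum>m. diffs ?c m * x ^ m) = G' $ i $ j"
    by (rule DERIV_unique)
  moreover have "summable (\<lambda>m. diffs ?c m * x ^ m)"
    by (rule termdiff_converges [OF x]) (use sm in auto)
  ultimately show ?thesis by (simp add: sums_iff)
qed

text \<open>\<open>sol_ode\<close> carries a factor \<open>x\<close> and says nothing about the
  derivative at \<open>x = 0\<close>. That derivative is read off from the coefficient of order 1;
  at an ordinary point, where \<open>P 0 t = 0\<close>, this supplies the equation at the
  centre.\<close>

lemma sol_deriv_0:
  assumes t: "t \<in> T" and G': "mat_deriv (\<lambda>x. sol (x, t)) G' 0"
  shows "sylv 1 (P 0 t) G' = P 1 t"
proof -
  have "G' $ i $ j = frob P 1 t $ i $ j" for i j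
  proof -
    have "(\<lambda>m. diffs (\<lambda>m. frob P m t $ i $ j) m * 0 ^ m) sums (G' $ i $ j)"
      by (rule sol_deriv [OF t _ G']) (use pos in simp)
    from sums_unique2 [OF powser_sums_zero this] show ?thesis
      by (simp add: diffs_def)
  qed
  then have "G' = frob P 1 t" by (simp add: vec_eq_iff)
  then show ?thesis
    using frob_rec [OF t, of 1] by simp
qed

text \<open>Comparison of the coefficients of \<open>x ^ m\<close>, with the Cauchy product for
  \<open>Pf ** sol (x, t)\<close>. The recursion \<open>frob_rec\<close> is this identity with the
  terms of order \<open>m\<close> collected in \<open>sylv\<close>.\<close>

lemma sol_ode:
  assumes t: "t \<in> T" and x: "cmod x < r" and G': "mat_deriv (\<lambda>x. sol (x, t)) G' x"
    and Pf: "(\<lambda>l. mat_scale (x ^ l) (P l t)) sums Pf"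
  shows "mat_scale x G' = Pf ** sol (x, t) - sol (x, t) ** P 0 t"
proof -
  have xr: "cmod x \<le> r" using x by simp
  have "mat_scale x G' $ i $ j = (Pf ** sol (x, t) - sol (x, t) ** P 0 t) $ i $ j" for i j
  proof -
    let ?c = "\<lambda>i m. frob P m t $ i $ j"
    have "(\<lambda>m. diffs (?c i) m * x ^ m) sums (G' $ i $ j)"
      by (rule sol_deriv [OF t x G'])
    \<comment> \<open>The exponent \<open>m - Suc 0\<close> is 0 for \<open>m = 0\<close>, where the
      factor \<open>of_nat m\<close> vanishes; multiplication by \<open>x\<close> then turns every
      term into one of order \<open>m\<close>.\<close>
    then have "(\<lambda>m. of_nat m * ?c i m * x ^ (m - Suc 0)) sums (G' $ i $ j)"
      using diffs_equiv [of "?c i" x] by (simp add: sums_iff)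
    then have L: "(\<lambda>m. x * (of_nat m * ?c i m * x ^ (m - Suc 0))) sums (mat_scale x G' $ i $ j)"
      unfolding mat_scale_nth by (rule sums_mult)
    have "(\<lambda>m. \<Sum>k\<in>UNIV. \<Sum>l\<le>m. (x ^ l * P l t $ i $ k) * (?c k (m - l) * x ^ (m - l))) sums
        (\<Sum>k\<in>UNIV. Pf $ i $ k * sol (x, t) $ k $ j)"
    proof (rule sums_sum)
      fix k
      have p: "(\<lambda>l. x ^ l * P l t $ i $ k) sums (Pf $ i $ k)"
        using bounded_linear.sums [OF bounded_linear_mat_entry Pf, of i k] by simp
      have "summable (\<lambda>l. cmod (x ^ l * P l t $ i $ k))"
      proof (rule summable_comparison_test)
        \<comment> \<open>The \<open>P l t\<close> are controlled by powers of
          \<open>1 / \<eta>\<close>, so absolute convergence needs \<open>x\<close> inside this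
          radius; the assumption on \<open>r\<close> puts it there.\<close>
        have "cmod x < \<eta>"
        proof -
          have "r * 1 \<le> r * (1 + C / c)" using pos by (intro mult_left_mono) auto
          also have "\<dots> \<le> \<kappa> * \<eta>" using r pos by (simp add: field_simps)
          also have "\<dots> \<le> \<eta>" using r pos b by simp
          finally show ?thesis using x by simp
        qed
        then show "summable (\<lambda>l. C * (cmod x / \<eta>) ^ l)"
          using pos by (intro summable_mult summable_geometric) simp
        show "\<exists>N. \<forall>l\<ge>N. norm (cmod (x ^ l * P l t $ i $ k)) \<le> C * (cmod x / \<eta>) ^ l"
        proof (intro exI [of _ 1] allI impI)
          fix l :: nat assume l: "l \<ge> 1"
          have "cmod (x ^ l) * cmod (P l t $ i $ k) \<le> cmod (x ^ l) * (C / \<eta> ^ l)"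
            by (intro mult_left_mono order_trans [OF norm_mat_entry P_le [OF t l]]) simp
          then show "norm (cmod (x ^ l * P l t $ i $ k)) \<le> C * (cmod x / \<eta>) ^ l"
            by (simp add: norm_mult norm_power power_divide mult.commute)
        qed
      qed
      from Cauchy_product_sums [OF this entry_summable [OF t xr, of k j]]
      show "(\<lambda>m. \<Sum>l\<le>m. (x ^ l * P l t $ i $ k) * (?c k (m - l) * x ^ (m - l))) sums
          (Pf $ i $ k * sol (x, t) $ k $ j)"
        using p sol_entry_sums [OF t xr, of k j] by (simp add: sums_iff)
    qed
    moreover have "(\<lambda>m. \<Sum>k\<in>UNIV. frob P m t $ i $ k * x ^ m * P 0 t $ k $ j) sums
        (\<Sum>k\<in>UNIV. sol (x, t) $ i $ k * P 0 t $ k $ j)"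
      by (intro sums_sum sums_mult2 sol_entry_sums t xr)
    ultimately have "(\<lambda>m. (\<Sum>k\<in>UNIV. \<Sum>l\<le>m. (x ^ l * P l t $ i $ k) * (?c k (m - l) * x ^ (m - l))) -
        (\<Sum>k\<in>UNIV. frob P m t $ i $ k * x ^ m * P 0 t $ k $ j)) sums
        ((Pf ** sol (x, t) - sol (x, t) ** P 0 t) $ i $ j)"
      unfolding vector_minus_component matrix_mult_nth by (rule sums_diff)
    moreover have "(\<Sum>k\<in>UNIV. \<Sum>l\<le>m. (x ^ l * P l t $ i $ k) * (?c k (m - l) * x ^ (m - l))) -
        (\<Sum>k\<in>UNIV. frob P m t $ i $ k * x ^ m * P 0 t $ k $ j) = x * (of_nat m * ?c i m * x ^ (m - Suc 0))" for m
    proof -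
      have rec: "mat_scale (of_nat m) (frob P m t) = (\<Sum>l\<le>m. P (m - l) t ** frob P l t) - frob P m t ** P 0 t"
      proof (cases "m = 0")
        case False
        then have "sylv (of_nat m) (P 0 t) (frob P m t) = (\<Sum>l<m. P (m - l) t ** frob P l t)"
          by (intro frob_rec t) auto
        then show ?thesis
          by (simp add: sylv_def lessThan_Suc_atMost [symmetric] algebra_simps)
      qed simp
      have "(\<Sum>k\<in>UNIV. \<Sum>l\<le>m. (x ^ l * P l t $ i $ k) * (?c k (m - l) * x ^ (m - l))) =
          (\<Sum>l\<le>m. \<Sum>k\<in>UNIV. (x ^ l * P l t $ i $ k) * (?c k (m - l) * x ^ (m - l)))"
        by (rule sum.swap)
      also have "\<dots> = (\<Sum>l\<le>m. x ^ m * (P l t ** frob P (m - l) t) $ i $ j)"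
      proof (intro sum.cong refl)
        fix l assume "l \<in> {..m}"
        then have "x ^ m = x ^ l * x ^ (m - l)" by (simp flip: power_add)
        then show "(\<Sum>k\<in>UNIV. (x ^ l * P l t $ i $ k) * (?c k (m - l) * x ^ (m - l))) =
            x ^ m * (P l t ** frob P (m - l) t) $ i $ j"
          by (simp add: matrix_mult_nth sum_distrib_left mult_ac)
      qed
      also have "\<dots> = x ^ m * (\<Sum>l\<le>m. P (m - l) t ** frob P l t) $ i $ j"
        unfolding sum_component sum_distrib_left 
        unfolding atMost_atLeast0 by (subst sum.atLeastAtMost_rev) simp
      finally have "(\<Sum>k\<in>UNIV. \<Sum>l\<le>m. (x ^ l * P l t $ i $ k) * (?c k (m - l) * x ^ (m - l))) -
        (\<Sum>k\<in>UNIV. frob P m t $ i $ k * x ^ m * P 0 t $ k $ j) =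
         x ^ m * (mat_scale (of_nat m) (frob P m t)) $ i $ j"
        unfolding rec by (simp add: matrix_mult_nth sum_distrib_left algebra_simps)
      then show ?thesis
        by (cases m) (simp_all add: mult_ac)
    qed
    ultimately show ?thesis
      using L sums_unique2 by simp
  qed
  then show ?thesis by (simp add: vec_eq_iff)
qed

end

section \<open>Solutions along a segment\<close>

text \<open>With \<open>e p\<close> the reciprocal of centre minus pole,
  \<open>e p / (1 + e p * x)\<close> is the simple pole in the coordinate \<open>x\<close> measured
  from the centre. The index is shifted by one because of the factor \<open>x\<close> in
  front.\<close>

lemma geometric_matrix_sums:
  fixes e :: "'n \<Rightarrow> complex" and Q :: "'n \<Rightarrow> complex ^ 'k ^ 'k"
  assumes "finite I" "\<And>p. p \<in> I \<Longrightarrow> cmod (e p * x) < 1"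
  shows "(\<lambda>l. mat_scale (x ^ l) (case l of 0 \<Rightarrow> P0 | Suc l \<Rightarrow> \<Sum>p\<in>I. mat_scale ((- 1) ^ l * e p ^ Suc l) (Q p))) sums
    (P0 + mat_scale x (\<Sum>p\<in>I. mat_scale (e p / (1 + e p * x)) (Q p)))"
proof -
  have "(\<lambda>l. \<Sum>p\<in>I. mat_scale (x ^ Suc l * ((- 1) ^ l * e p ^ Suc l)) (Q p)) sums
      (\<Sum>p\<in>I. mat_scale (x * (e p / (1 + e p * x))) (Q p))"
  proof (rule sums_sum)
    fix p assume "p \<in> I"
    then have "(\<lambda>l. (- (e p * x)) ^ l) sums (1 / (1 - (- (e p * x))))"
      by (intro geometric_sums) (use assms in auto)
    then have s: "(\<lambda>l. (x * e p) * (- (e p * x)) ^ l) sums ((x * e p) * (1 / (1 - (- (e p * x)))))"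
      by (rule sums_mult)
    have "bounded_linear (\<lambda>c. mat_scale c (Q p))"
      by (rule bounded_linear_intro [where K = "norm (Q p)"])
        (simp_all add: mat_scale_add_left scaleR_eq_mat_scale norm_mat_scale scaleR_conv_of_real)
    from bounded_linear.sums [OF this s]
    moreover have "x * e p * (- (e p * x)) ^ l = x ^ Suc l * ((- 1) ^ l * e p ^ Suc l)" for l
      unfolding power_minus [of "e p * x"] by (simp add: power_mult_distrib mult_ac)
    ultimately show "(\<lambda>l. mat_scale (x ^ Suc l * ((- 1) ^ l * e p ^ Suc l)) (Q p)) sums
        mat_scale (x * (e p / (1 + e p * x))) (Q p)"
      by simp
  qed
  then have "(\<lambda>l. mat_scale (x ^ Suc l) (\<Sum>p\<in>I. mat_scale ((- 1) ^ l * e p ^ Suc l) (Q p))) sums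
      mat_scale x (\<Sum>p\<in>I. mat_scale (e p / (1 + e p * x)) (Q p))"
    by (simp add: mat_scale_sum)
  from sums_Suc [where f = "\<lambda>l. mat_scale (x ^ l) (case l of 0 \<Rightarrow> P0 | Suc l \<Rightarrow> \<Sum>p\<in>I. mat_scale ((- 1) ^ l * e p ^ Suc l) (Q p))", simplified, OF this [simplified]]
  show ?thesis by (simp add: add.commute)
qed

text \<open>Bounds uniform over the parameters for a system with residue \<open>P0\<close> at the
  centre, 0 in the case of an ordinary point. Other poles enter through \<open>e p\<close>, the
  reciprocal of their offset, so that \<open>\<kappa>0\<close> bounds their proximity and
  \<open>e p t = 0\<close> is a pole sent to infinity.\<close>

definition local_data ::
    "(complex ^ 'n::finite) set \<Rightarrow> 'n set \<Rightarrow> ('n \<Rightarrow> complex ^ 'n \<Rightarrow> complex) \<Rightarrow> (complex ^ 'n \<Rightarrow> complex ^ 'k::finite ^ 'k) \<Rightarrow>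
     ('n \<Rightarrow> complex ^ 'n \<Rightarrow> complex ^ 'k ^ 'k) \<Rightarrow> real \<Rightarrow> real \<Rightarrow> real \<Rightarrow> bool" where
  "local_data T I e P0 Q \<kappa>0 q c \<longleftrightarrow> open T \<and> (\<forall>p. chol (\<lambda>w. e p (snd w)) (UNIV \<times> T)) \<and>
     (\<forall>p. joint_holomorphic_on (\<lambda>w. Q p (snd w)) (UNIV \<times> T)) \<and>
     joint_holomorphic_on (\<lambda>w. P0 (snd w)) (UNIV \<times> T) \<and>
     (\<forall>t\<in>T. \<forall>p\<in>I. cmod (e p t) \<le> \<kappa>0 \<and> norm (Q p t) \<le> q) \<and>
     (\<forall>t\<in>T. \<forall>m\<ge>1. \<forall>X. c * norm X \<le> norm (sylv (of_nat m) (P0 t) X))"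

definition local_coef where
  "local_coef I e Q t x = (\<Sum>p\<in>I. mat_scale (e p t / (1 + e p t * x)) (Q p t))"

text \<open>\<open>G\<close> is the holomorphic factor: multiplied by the power of \<open>x\<close>
  with exponent \<open>P0 t\<close> it becomes a solution. The last clause replaces the equation at
  \<open>x = 0\<close>, where the derivative is multiplied by 0.\<close>

definition local_solution where
  "local_solution T I e P0 Q r G \<longleftrightarrow> joint_holomorphic_on G (ball 0 r \<times> T) \<and>
     (\<forall>t\<in>T. G (0, t) = mat 1 \<and> (\<forall>x\<in>ball 0 r. invertible (G (x, t)) \<and> (\<forall>p\<in>I. 1 + e p t * x \<noteq> 0) \<and>
        (\<exists>G'. mat_deriv (\<lambda>x. G (x, t)) G' x \<and>
           mat_scale x G' = (P0 t + mat_scale x (local_coef I e Q t x)) ** G (x, t) - G (x, t) ** P0 t \<and>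
           (x = 0 \<longrightarrow> sylv 1 (P0 t) G' = local_coef I e Q t 0))))"

text \<open>The order of the quantifiers matters: \<open>r\<close> depends on the bounds
  \<open>\<kappa>0\<close>, \<open>q\<close>, \<open>c\<close> and on the dimensions only. One
  radius thus serves all parameters, and all centres on a segment.\<close>

lemma local_fuchsian_solution:
  assumes pos: "\<kappa>0 > 0" "q \<ge> 0" "c > 0"
  shows "\<exists>r>0. \<forall>(T :: (complex ^ 'n::finite) set) I e (P0 :: _ \<Rightarrow> complex ^ 'k::finite ^ 'k) Q.
    local_data T I e P0 Q \<kappa>0 q c \<longrightarrow> (\<exists>G. local_solution T I e P0 Q r G)"
proof -
  let ?one = "mat 1 :: complex ^ 'k ^ 'k"
  obtain \<epsilon> where \<epsilon>: "\<epsilon> > 0" "\<And>A :: complex ^ 'k ^ 'k. norm (A - mat 1) < \<epsilon> \<Longrightarrow> invertible A"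
    using invertible_near_one by blast
  \<comment> \<open>There are at most \<open>CARD('n)\<close> poles; the 1 keeps \<open>C\<close>
    positive when \<open>q = 0\<close>.\<close>
  define C where "C = real CARD('n) * q + 1"
  have C: "C > 0" using pos by (simp add: C_def add_nonneg_pos)
  \<comment> \<open>Small enough for \<open>sol_near_one\<close> to stay within
    \<open>\<epsilon> / 2\<close> of \<open>mat 1\<close>, hence among invertible matrices.\<close>
  define \<kappa> where "\<kappa> = min (1 / 2) (\<epsilon> / (4 * (norm ?one + 1)))"
  have n1: "norm ?one + 1 > 0" by (simp add: add_nonneg_pos)
  have \<kappa>: "\<kappa> > 0" "\<kappa> \<le> 1 / 2"
    using \<epsilon> n1 unfolding \<kappa>_def by (simp add: zero_less_divide_iff, intro min.cobounded1)
  have \<kappa>\<epsilon>: "norm ?one * (2 * \<kappa>) < \<epsilon>"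
  proof -
    have "norm ?one * (2 * \<kappa>) \<le> (norm ?one + 1) * (2 * (\<epsilon> / (4 * (norm ?one + 1))))"
      using \<kappa> by (intro mult_mono) (auto simp: \<kappa>_def)
    also have "\<dots> = \<epsilon> / 2" using n1 by (simp add: field_simps)
    finally show ?thesis using \<epsilon> by simp
  qed
  \<comment> \<open>This gives equality in the condition on \<open>r\<close> in the locale
    \<open>frobenius\<close>, with \<open>\<eta> = 1 / \<kappa>0\<close>.\<close>
  define r where "r = \<kappa> / (\<kappa>0 * (1 + C / c))"
  have r: "r > 0" using \<kappa> pos C by (simp add: r_def add_pos_pos)
  have r\<kappa>: "r * (1 + C / c) / (1 / \<kappa>0) = \<kappa>"
    using pos C by (simp add: r_def add_pos_pos less_imp_neq [symmetric])
  have "r * \<kappa>0 \<le> r * (\<kappa>0 * (1 + C / c))"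
    using pos C r by (intro mult_left_mono) auto
  then have rk: "r * \<kappa>0 \<le> 1 / 2" using r\<kappa> \<kappa> by (simp add: mult_ac)
  show ?thesis
  proof (intro exI [of _ r] conjI r allI impI)
    fix T :: "(complex ^ 'n) set" and I e and P0 :: "_ \<Rightarrow> complex ^ 'k ^ 'k" and Q
    assume "local_data T I e P0 Q \<kappa>0 q c"
    then have T: "open T" and e: "\<And>p. chol (\<lambda>w. e p (snd w)) (UNIV \<times> T)"
      and Q: "\<And>p. joint_holomorphic_on (\<lambda>w. Q p (snd w)) (UNIV \<times> T)"
      and P0: "joint_holomorphic_on (\<lambda>w. P0 (snd w)) (UNIV \<times> T)"
      and e_le: "\<And>p t. t \<in> T \<Longrightarrow> p \<in> I \<Longrightarrow> cmod (e p t) \<le> \<kappa>0"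
      and Q_le: "\<And>p t. t \<in> T \<Longrightarrow> p \<in> I \<Longrightarrow> norm (Q p t) \<le> q"
      and lower: "\<And>m t X. t \<in> T \<Longrightarrow> m \<ge> 1 \<Longrightarrow> c * norm X \<le> norm (sylv (of_nat m) (P0 t) X)"
      by (auto simp: local_data_def)
    define P where "P l t = (case l of 0 \<Rightarrow> P0 t | Suc l \<Rightarrow> \<Sum>p\<in>I. mat_scale ((- 1) ^ l * e p t ^ Suc l) (Q p t))" for l t
    have P00: "P 0 = P0" by (auto simp: P_def)
    interpret frobenius P T C "1 / \<kappa>0" c r \<kappa>
    proof
      show "joint_holomorphic_on (\<lambda>w. P l (snd w)) (UNIV \<times> T)" for l
      proof (cases l)
        case 0
        then show ?thesis using P0 by (simp add: P_def)
      next
        case (Suc k)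
        then show ?thesis unfolding P_def
          by (simp del: power_Suc) (intro joint_hol_sum joint_hol_scale Q chol_mult chol_power e chol_const)
      qed
      show "norm (P l t) \<le> C / (1 / \<kappa>0) ^ l" if t: "t \<in> T" and "l \<ge> 1" for l t
      proof -
        obtain k where l: "l = Suc k" using \<open>l \<ge> 1\<close> by (cases l) auto
        have "norm (P l t) \<le> (\<Sum>p\<in>I. \<kappa>0 ^ l * q)"
          unfolding l P_def nat.case
        proof (rule sum_norm_le)
          fix p assume p: "p \<in> I"
          show "norm (mat_scale ((- 1) ^ k * e p t ^ Suc k) (Q p t)) \<le> \<kappa>0 ^ Suc k * q"
            unfolding norm_mat_scale norm_mult norm_power
            using e_le [OF t p] Q_le [OF t p] pos by (intro mult_mono) (auto intro!: power_mono mult_mono simp del: power_Suc)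
        qed
        also have "\<dots> \<le> real CARD('n) * (\<kappa>0 ^ l * q)"
          using card_mono [of UNIV I] pos by (simp add: mult_right_mono)
        also have "\<dots> \<le> C * \<kappa>0 ^ l"
          using pos by (simp add: C_def algebra_simps)
        finally show ?thesis using pos by (simp add: power_divide)
      qed
    qed (use T lower C pos r \<kappa> r\<kappa> P00 in auto)
    have "invertible (sol (x, t))" if "t \<in> T" "x \<in> ball 0 r" for x t
      using sol_near_one [of t x] that \<kappa>\<epsilon> by (intro \<epsilon>) auto
    moreover have ex: "cmod (e p t * x) < 1" if "t \<in> T" "x \<in> ball 0 r" "p \<in> I" for x t p
    proof -
      have "cmod (e p t * x) \<le> \<kappa>0 * r"
        unfolding norm_mult using that e_le pos by (intro mult_mono) auto
      then show ?thesis using rk by (simp add: mult.commute)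
    qed
    moreover have "1 + e p t * x \<noteq> 0" if "t \<in> T" "x \<in> ball 0 r" "p \<in> I" for x t p
      using ex [OF that] by (metis add_eq_0_iff less_irrefl norm_minus_cancel norm_one)
    moreover have "\<exists>G'. mat_deriv (\<lambda>x. sol (x, t)) G' x \<and>
        mat_scale x G' = (P0 t + mat_scale x (local_coef I e Q t x)) ** sol (x, t) - sol (x, t) ** P0 t \<and>
        (x = 0 \<longrightarrow> sylv 1 (P0 t) G' = local_coef I e Q t 0)"
      if t: "t \<in> T" and x: "x \<in> ball 0 r" for x t
    proof -
      obtain G' where G': "mat_deriv (\<lambda>x. sol (x, t)) G' x"
        using joint_hol_mat_deriv [OF sol_hol, of x t] t x by auto
      have "(\<lambda>l. mat_scale (x ^ l) (P l t)) sums (P0 t + mat_scale x (local_coef I e Q t x))"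
        unfolding P_def local_coef_def by (rule geometric_matrix_sums) (use ex [OF t x] in auto)
      from sol_ode [OF t _ G' this] have "mat_scale x G' =
          (P0 t + mat_scale x (local_coef I e Q t x)) ** sol (x, t) - sol (x, t) ** P0 t"
        using x P00 by simp
      moreover have "sylv 1 (P0 t) G' = local_coef I e Q t 0" if "x = 0"
        using sol_deriv_0 [OF t, of G'] G' that P00 by (simp add: P_def local_coef_def)
      ultimately show ?thesis using G' by blast
    qed
    ultimately have "local_solution T I e P0 Q r sol"
      using sol_hol sol_0 unfolding local_solution_def by blast
    then show "\<exists>G. local_solution T I e P0 Q r G" by blast
  qed
qed

text \<open>Differentiability of the inverse comes from \<open>joint_hol_matrix_inv\<close> with a
  dummy one-dimensional parameter, the value of the derivative from
  \<open>mat_deriv_matrix_inv\<close>.\<close>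

lemma mat_deriv_inverse:
  fixes F :: "complex \<Rightarrow> complex ^ 'k ^ 'k"
  assumes F: "\<And>x. x \<in> S \<Longrightarrow> mat_deriv F (F' x) x" and S: "open S" "z \<in> S"
    and inv: "\<And>x. x \<in> S \<Longrightarrow> invertible (F x)"
  shows "mat_deriv (\<lambda>x. matrix_inv (F x)) (- (matrix_inv (F z) ** F' z ** matrix_inv (F z))) z"
proof -
  have "joint_holomorphic_on (\<lambda>w. F (fst w)) (S \<times> (UNIV :: (complex ^ 1) set))"
    unfolding joint_holomorphic_on_chol
  proof (intro allI)
    fix i j
    show "chol (\<lambda>w. F (fst w) $ i $ j) (S \<times> (UNIV :: (complex ^ 1) set))"
      by (rule chol_compose_field [OF chol_fst, where g = "\<lambda>x. F x $ i $ j"])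
        (use F in \<open>unfold mat_deriv_def field_differentiable_def, fastforce\<close>)
  qed
  then have "joint_holomorphic_on (\<lambda>w. matrix_inv (F (fst w))) (S \<times> (UNIV :: (complex ^ 1) set))"
    by (rule joint_hol_matrix_inv) (use S inv in \<open>auto intro: open_Times\<close>)
  then obtain G' where "mat_deriv (\<lambda>x. matrix_inv (F x)) G' z"
    using joint_hol_mat_deriv [of _ "S \<times> (UNIV :: (complex ^ 1) set)" z 0] S by fastforce
  with mat_deriv_matrix_inv [OF F S inv] show ?thesis by blast
qed

text \<open>Two solutions of one system differ locally by a constant factor on the right. Uniqueness
  on convex sets and uniqueness of germs on the sphere both rest on this.\<close>

lemma ode_quotient_deriv:
  fixes Y1 Y2 :: "complex \<Rightarrow> complex ^ 'k ^ 'k"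
  assumes S: "open S" and Y1: "\<And>x. x \<in> S \<Longrightarrow> mat_deriv Y1 (B x ** Y1 x) x" "\<And>x. x \<in> S \<Longrightarrow> invertible (Y1 x)"
    and Y2: "mat_deriv Y2 (B x ** Y2 x) x" and x: "x \<in> S"
  shows "mat_deriv (\<lambda>x. matrix_inv (Y1 x) ** Y2 x) 0 x"
proof -
  have "Y1 x ** matrix_inv (Y1 x) = mat 1"
    using Y1(2) [OF x] by (rule matrix_inv_works)
  then have eq: "matrix_inv (Y1 x) ** (B x ** Y1 x) ** matrix_inv (Y1 x) = matrix_inv (Y1 x) ** B x"
    by (simp add: matrix_mul_assoc [symmetric])
  show ?thesis
    using mat_deriv_mult [OF mat_deriv_inverse [OF Y1(1) S x Y1(2)] Y2] unfolding eq
    by (simp add: mat_algebra)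
qed

lemma ode_unique:
  fixes Y1 Y2 :: "complex \<Rightarrow> complex ^ 'k ^ 'k"
  assumes S: "convex S" "open S" and Y1: "\<And>x. x \<in> S \<Longrightarrow> mat_deriv Y1 (B x ** Y1 x) x" "\<And>x. x \<in> S \<Longrightarrow> invertible (Y1 x)"
    and Y2: "\<And>x. x \<in> S \<Longrightarrow> mat_deriv Y2 (B x ** Y2 x) x" and a: "a \<in> S" "Y1 a = Y2 a" and x: "x \<in> S"
  shows "Y1 x = Y2 x"
proof -
  have "matrix_inv (Y1 x) ** Y2 x = matrix_inv (Y1 a) ** Y2 a"
    by (rule mat_deriv_zero_const [OF S ode_quotient_deriv [OF S(2) Y1 Y2] x a(1)])
  also have "\<dots> = mat 1"
    using a matrix_inv_works(2) [OF Y1(2) [OF a(1)]] by simp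
  finally have "Y1 x ** (matrix_inv (Y1 x) ** Y2 x) = Y1 x" by simp
  then show ?thesis
    using matrix_inv_works(1) [OF Y1(2) [OF x]] by (simp add: matrix_mul_assoc)
qed

lemma joint_hol_Un:
  "joint_holomorphic_on F S \<Longrightarrow> joint_holomorphic_on F T \<Longrightarrow> joint_holomorphic_on F (S \<union> T)"
  by (auto simp: joint_holomorphic_on_chol chol_def)

lemma joint_hol_fix_fst:
  assumes "joint_holomorphic_on F (U \<times> T)" "a \<in> U"
  shows "joint_holomorphic_on (\<lambda>w. F (a, snd w)) (UNIV \<times> T)"
  by (rule joint_hol_compose_Pair [OF assms(1)]) (use assms(2) in auto)

lemma mat_deriv_chain_diff: "mat_deriv F F' (z - c) \<Longrightarrow> mat_deriv (\<lambda>z. F (z - c)) F' z"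
proof -
  assume F: "mat_deriv F F' (z - c)"
  have "((\<lambda>z. z - c) has_field_derivative 1) (at z)"
    by (auto intro!: derivative_eq_intros)
  from mat_deriv_compose [of F F' "\<lambda>z. z - c", OF F this] show ?thesis
    by simp
qed

text \<open>The coefficient is written with \<open>d / (b + d * x)\<close> so that one setting
  covers both kinds of base point: a finite one, where \<open>d\<close> is constant and
  \<open>b\<close> moves with the poles, and infinity, where \<open>b\<close> is constant and
  \<open>d\<close> moves and may vanish. The condition \<open>le\<close> is the uniform bound on
  reciprocal distances from points of the segment to the poles.\<close>

locale segment_ode =
  fixes d b :: "'n::finite \<Rightarrow> complex ^ 'n \<Rightarrow> complex" and Q :: "'n \<Rightarrow> complex ^ 'n \<Rightarrow> complex ^ 'k::finite ^ 'k"
    and T :: "(complex ^ 'n) set" and \<kappa>0 q :: real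
  assumes T: "open T" and d: "\<And>p. chol (\<lambda>w. d p (snd w)) (UNIV \<times> T)"
    and b: "\<And>p. chol (\<lambda>w. b p (snd w)) (UNIV \<times> T)"
    and Q: "\<And>p. joint_holomorphic_on (\<lambda>w. Q p (snd w)) (UNIV \<times> T)"
    and pos: "\<kappa>0 > 0" "q \<ge> 0"
    and nz: "\<And>p t s. t \<in> T \<Longrightarrow> s \<in> {0..1} \<Longrightarrow> b p t + d p t * of_real s \<noteq> 0"
    and le: "\<And>p t s. t \<in> T \<Longrightarrow> s \<in> {0..1} \<Longrightarrow> cmod (d p t) \<le> \<kappa>0 * cmod (b p t + d p t * of_real s)"
    and Q_le: "\<And>p t. t \<in> T \<Longrightarrow> norm (Q p t) \<le> q"
begin

definition coef :: "complex ^ 'n \<Rightarrow> complex \<Rightarrow> complex ^ 'k ^ 'k" where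
  "coef t x = (\<Sum>p\<in>UNIV. mat_scale (d p t / (b p t + d p t * x)) (Q p t))"

definition sol_on :: "(complex \<times> (complex ^ 'n) \<Rightarrow> complex ^ 'k ^ 'k) \<Rightarrow> complex set \<Rightarrow> bool" where
  "sol_on Y U \<longleftrightarrow> open U \<and> joint_holomorphic_on Y (U \<times> T) \<and>
     (\<forall>t\<in>T. \<forall>x\<in>U. invertible (Y (x, t)) \<and> mat_deriv (\<lambda>x. Y (x, t)) (coef t x ** Y (x, t)) x \<and>
        (\<forall>p. b p t + d p t * x \<noteq> 0))"

text \<open>Ordinary points are treated as centres with residue 0, where the bound for
  \<open>sylv\<close> holds with constant 1. The radius does not depend on \<open>s\<close>, which
  is what chaining discs requires.\<close>

lemma disc_solution:
  "\<exists>r>0. \<forall>s\<in>{0..1}. \<exists>Y. sol_on Y (ball (of_real s) r) \<and> (\<forall>t\<in>T. Y (of_real s, t) = mat 1)"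
proof -
  obtain r where r: "r > 0" and loc:
    "\<And>(T :: (complex ^ 'n) set) I e (P0 :: _ \<Rightarrow> complex ^ 'k ^ 'k) Q.
       local_data T I e P0 Q \<kappa>0 q 1 \<Longrightarrow> \<exists>G. local_solution T I e P0 Q r G"
    using local_fuchsian_solution [OF pos zero_less_one] by blast
  have "\<exists>Y. sol_on Y (ball (of_real s) r) \<and> (\<forall>t\<in>T. Y (of_real s, t) = mat 1)" if s: "s \<in> {0..1}" for s
  proof -
    define c where "c = complex_of_real s"
    define e where "e p t = d p t / (b p t + d p t * c)" for p t
    have nz': "b p t + d p t * c \<noteq> 0" if "t \<in> T" for p t
      using nz [OF that s] by (simp add: c_def)
    have "local_data T UNIV e (\<lambda>_. 0) Q \<kappa>0 q 1"
      unfolding local_data_def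
    proof (intro conjI ballI allI impI)
      show "chol (\<lambda>w. e p (snd w)) (UNIV \<times> T)" for p
        unfolding e_def by (intro chol_divide chol_add chol_mult d b chol_const) (use nz' in auto)
      show "cmod (e p t) \<le> \<kappa>0" if "t \<in> T" for p t
        using le [OF that s, of p] nz' [OF that, of p] by (simp add: e_def norm_divide field_simps c_def)
      show "1 * norm X \<le> norm (sylv (of_nat m) 0 X)" if "m \<ge> 1" for m and X :: "complex ^ 'k ^ 'k"
        using that mult_right_mono [of 1 "real m" "norm X"] by (simp add: sylv_def norm_mat_scale)
    qed (use T Q Q_le in auto)
    then obtain G where "local_solution T UNIV e (\<lambda>_. 0) Q r G" using loc by blast
    then have G: "joint_holomorphic_on G (ball 0 r \<times> T)"
      "\<And>t. t \<in> T \<Longrightarrow> G (0, t) = mat 1"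
      "\<And>t x. t \<in> T \<Longrightarrow> x \<in> ball 0 r \<Longrightarrow> invertible (G (x, t)) \<and> (\<forall>p\<in>UNIV. 1 + e p t * x \<noteq> 0) \<and>
        (\<exists>G'. mat_deriv (\<lambda>x. G (x, t)) G' x \<and>
           mat_scale x G' = (0 + mat_scale x (local_coef UNIV e Q t x)) ** G (x, t) - G (x, t) ** 0 \<and>
           (x = 0 \<longrightarrow> sylv 1 0 G' = local_coef UNIV e Q t 0))"
      unfolding local_solution_def by blast+
    define Y where "Y w = G (fst w - c, snd w)" for w
    have "sol_on Y (ball c r)"
      unfolding sol_on_def
    proof (intro conjI ballI allI)
      show "joint_holomorphic_on Y (ball c r \<times> T)"
        unfolding Y_def
        by (rule joint_hol_compose_Pair [OF G(1)])
          (auto intro!: chol_diff simp: dist_norm norm_minus_commute)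
      fix t x assume t: "t \<in> T" and x: "x \<in> ball c r"
      then have x': "x - c \<in> ball 0 r" by (simp add: dist_norm norm_minus_commute)
      note Gx = G(3) [OF t x']
      show "invertible (Y (x, t))" using Gx by (simp add: Y_def)
      have ed: "(b p t + d p t * c) * (1 + e p t * (x - c)) = b p t + d p t * x" for p
        using nz' [OF t, of p] by (simp add: e_def field_simps)
      then show "b p t + d p t * x \<noteq> 0" for p
        using nz' [OF t, of p] Gx by (metis UNIV_I mult_eq_0_iff)
      have coef: "coef t x = local_coef UNIV e Q t (x - c)"
        unfolding coef_def local_coef_def
      proof (intro sum.cong refl)
        fix p
        have "d p t / (b p t + d p t * x) = e p t / (1 + e p t * (x - c))"
          unfolding ed [symmetric] by (simp add: e_def)
        then show "mat_scale (d p t / (b p t + d p t * x)) (Q p t) = mat_scale (e p t / (1 + e p t * (x - c))) (Q p t)"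
          by simp
      qed
      obtain G' where G': "mat_deriv (\<lambda>x. G (x, t)) G' (x - c)"
        "mat_scale (x - c) G' = mat_scale (x - c) (coef t x) ** G (x - c, t)"
        "x - c = 0 \<longrightarrow> sylv 1 0 G' = local_coef UNIV e Q t 0"
        using Gx unfolding coef by auto
      \<comment> \<open>Away from the centre the factor \<open>x - c\<close> can be cancelled; at
        the centre the separate clause on the derivative takes over.\<close>
      have "G' = coef t x ** G (x - c, t)"
      proof (cases "x = c")
        case True
        then show ?thesis
          using G'(3) G(2) [OF t] coef by (simp add: sylv_def)
      next
        case False
        have "mat_scale (x - c) (G' - coef t x ** G (x - c, t)) = 0"
          using G'(2) by (simp add: mat_scale_diff_right mat_scale_mult_left)
        then show ?thesis using False by simp
      qed
      then show "mat_deriv (\<lambda>x. Y (x, t)) (coef t x ** Y (x, t)) x"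
        using mat_deriv_chain_diff [OF G'(1)] by (simp add: Y_def)
    qed simp
    moreover have "\<forall>t\<in>T. Y (c, t) = mat 1" using G(2) by (simp add: Y_def)
    ultimately show ?thesis unfolding c_def by blast
  qed
  with r show ?thesis by blast
qed

lemma sol_on_mult_const:
  assumes "sol_on Y U" "joint_holomorphic_on (\<lambda>w. K (snd w)) (UNIV \<times> T)" "\<And>t. t \<in> T \<Longrightarrow> invertible (K t)"
  shows "sol_on (\<lambda>w. Y w ** K (snd w)) U"
  using assms joint_hol_subset [OF assms(2), of "U \<times> T"] unfolding sol_on_def
  by (auto intro!: joint_hol_mult invertible_mult simp: matrix_mul_assoc dest!: mat_deriv_mult_const)

text \<open>Discs of the common radius \<open>r\<close> around equally spaced centres are added one
  at a time, each carrying the local solution multiplied on the right by the value reached at its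
  centre. Uniqueness makes the pieces agree on overlaps.\<close>

lemma segment_solution:
  "\<exists>U Y. of_real ` {0..1} \<subseteq> U \<and> sol_on Y U \<and> (\<forall>t\<in>T. Y (0, t) = mat 1)"
proof -
  obtain r where r: "r > 0" and disc:
    "\<And>s. s \<in> {0..1} \<Longrightarrow> \<exists>Y. sol_on Y (ball (of_real s) r) \<and> (\<forall>t\<in>T. Y (of_real s, t) = mat 1)"
    using disc_solution by blast
  obtain N where N: "N > 0" "1 / real N < r"
    using r real_arch_inverse [of r] by (auto simp: inverse_eq_divide)
  define c where "c k = complex_of_real (real k / real N)" for k
  define U where "U i = (\<Union>k\<in>{..i}. ball (c k) r)" for i
  have c_diff: "dist (c i) (c (Suc i)) < r" for i
    using N by (simp add: c_def dist_norm add_divide_distrib norm_divide flip: of_real_diff)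
  have "i \<le> N \<Longrightarrow> \<exists>Y. sol_on Y (U i) \<and> (\<forall>t\<in>T. Y (0, t) = mat 1)" for i
  proof (induction i)
    case 0
    then show ?case
      using disc [of 0] by (simp add: U_def c_def)
  next
    case (Suc i)
    then obtain Y where Y: "sol_on Y (U i)" "\<And>t. t \<in> T \<Longrightarrow> Y (0, t) = mat 1" by auto
    define c' where "c' = c (Suc i)"
    obtain \<Phi> where \<Phi>: "sol_on \<Phi> (ball c' r)" "\<And>t. t \<in> T \<Longrightarrow> \<Phi> (c', t) = mat 1"
      using disc [of "real (Suc i) / real N"] Suc.prems N unfolding c'_def c_def by auto
    have c'U: "c' \<in> U i" using c_diff [of i] unfolding U_def c'_def by auto
    define Z where "Z w = \<Phi> w ** Y (c', snd w)" for w
    have Z: "sol_on Z (ball c' r)"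
      unfolding Z_def
    proof (rule sol_on_mult_const [where K = "\<lambda>t. Y (c', t)", OF \<Phi>(1)])
      show "joint_holomorphic_on (\<lambda>w. Y (c', snd w)) (UNIV \<times> T)"
        using joint_hol_fix_fst [OF _ c'U] Y(1) by (auto simp: sol_on_def)
      show "invertible (Y (c', t))" if "t \<in> T" for t
        using Y(1) that c'U by (auto simp: sol_on_def)
    qed
    have agree: "Y (x, t) = Z (x, t)" if x: "x \<in> U i" "x \<in> ball c' r" and t: "t \<in> T" for x t
    proof -
      obtain k where k: "k \<le> i" "x \<in> ball (c k) r" using x(1) by (auto simp: U_def)
      \<comment> \<open>If \<open>x\<close> lies in the new disc and in an old one, the ball around
        \<open>x\<close> contains both centres, hence by convexity \<open>c i\<close> between them.
        So \<open>x\<close> lies in the last old disc as well, and uniqueness is applied on the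
        convex intersection of two discs.\<close>
      have "c i \<in> closed_segment (c k) c'"
      proof -
        define u where "u = (real i - real k) / (real (Suc i) - real k)"
        have u: "0 \<le> u" "u \<le> 1" using k by (auto simp: u_def)
        have "u * (real (Suc i) - real k) = real i - real k"
          using k by (simp add: u_def)
        then have "real i = (1 - u) * real k + u * real (Suc i)"
          by (simp add: algebra_simps)
        then have "real i / real N = (1 - u) * (real k / real N) + u * (real (Suc i) / real N)"
          by (metis (no_types, lifting) add_divide_distrib times_divide_eq_right)
        then have "c i = (1 - u) *\<^sub>R c k + u *\<^sub>R c'"
          unfolding c_def c'_def scaleR_conv_of_real by (metis of_real_add of_real_mult)
        then show ?thesis using u by (auto simp: in_segment)
      qed
      moreover have "closed_segment (c k) c' \<subseteq> ball x r"
        using k(2) x(2) by (intro closed_segment_subset) (auto simp: dist_commute)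
      ultimately have x_in: "x \<in> ball (c i) r" by (auto simp: dist_commute)
      have sub: "ball (c i) r \<subseteq> U i" by (auto simp: U_def)
      show ?thesis
      proof (rule ode_unique [of "ball (c i) r \<inter> ball c' r" _ "coef t" _ c'])
        show "c' \<in> ball (c i) r \<inter> ball c' r" using c_diff [of i] r by (simp add: c'_def)
        show "Y (c', t) = Z (c', t)" using \<Phi>(2) t by (simp add: Z_def)
      qed (use Y(1) Z sub t x_in x in \<open>auto simp: sol_on_def convex_Int\<close>)
    qed
    define W where "W w = (if fst w \<in> U i then Y w else Z w)" for w
    have WZ: "W (x, t) = Z (x, t)" if "x \<in> ball c' r" "t \<in> T" for x t
      using that agree by (auto simp: W_def)
    have USuc: "U (Suc i) = U i \<union> ball c' r" by (auto simp: U_def c'_def atMost_Suc)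
    have oU: "open (U i)" by (auto simp: U_def)
    have "sol_on W (U (Suc i))"
      unfolding sol_on_def
    proof (intro conjI ballI)
      show "open (U (Suc i))" by (auto simp: U_def)
      have "joint_holomorphic_on W (U i \<times> T)"
        by (rule joint_hol_transform [of Y]) (use Y(1) T oU in \<open>auto simp: W_def sol_on_def open_Times\<close>)
      moreover have "joint_holomorphic_on W (ball c' r \<times> T)"
        by (rule joint_hol_transform [of Z]) (use Z T WZ in \<open>auto simp: sol_on_def open_Times\<close>)
      ultimately show "joint_holomorphic_on W (U (Suc i) \<times> T)"
        unfolding USuc Sigma_Un_distrib1 by (rule joint_hol_Un)
      fix t x assume t: "t \<in> T" and x: "x \<in> U (Suc i)"
      have "(\<exists>S Y. open S \<and> x \<in> S \<and> sol_on Y S \<and> (\<forall>x\<in>S. Y (x, t) = W (x, t)))"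
      proof (cases "x \<in> U i")
        case True
        then show ?thesis using oU Y(1) by (intro exI [of _ "U i"] exI [of _ Y]) (auto simp: W_def)
      next
        case False
        then have "x \<in> ball c' r" using x USuc by auto
        then show ?thesis using Z WZ t by (intro exI [of _ "ball c' r"] exI [of _ Z]) auto
      qed
      then obtain S Y where S: "open S" "x \<in> S" "sol_on Y S" "\<And>x. x \<in> S \<Longrightarrow> Y (x, t) = W (x, t)" by blast
      then have "mat_deriv (\<lambda>x. Y (x, t)) (coef t x ** W (x, t)) x"
        using t by (metis sol_on_def)
      then show "mat_deriv (\<lambda>x. W (x, t)) (coef t x ** W (x, t)) x"
        by (rule mat_deriv_transform [OF _ S(1,2)]) (use S in auto)
      show "invertible (W (x, t))" "\<forall>p. b p t + d p t * x \<noteq> 0"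
        using S t by (metis sol_on_def)+
    qed
    moreover have "W (0, t) = mat 1" if "t \<in> T" for t
    proof -
      have "0 \<in> U i" using r by (auto simp: U_def c_def intro!: bexI [of _ 0])
      then show ?thesis using Y(2) that by (simp add: W_def)
    qed
    ultimately show ?case by blast
  qed
  then obtain Y where Y: "sol_on Y (U N)" "\<forall>t\<in>T. Y (0, t) = mat 1" by blast
  have "complex_of_real s \<in> U N" if s: "s \<in> {0..1}" for s
  proof -
    define k where "k = nat \<lfloor>s * N\<rfloor>"
    have k: "real k \<le> s * N" "s * N < real k + 1"
      using s by (auto simp: k_def of_nat_nat)
    have "s * real N \<le> 1 * real N" using s by (intro mult_right_mono) auto
    then have "real k \<le> N" using k by linarith
    then have "k \<le> N" by simp
    moreover have "\<bar>s - real k / N\<bar> < r"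
    proof -
      have "s - real k / N = (s * N - real k) / N" using N by (simp add: field_simps)
      then have "\<bar>s - real k / N\<bar> \<le> 1 / N" using k N by (simp add: divide_right_mono)
      then show ?thesis using N by simp
    qed
    then have "complex_of_real s \<in> ball (c k) r"
      unfolding c_def mem_ball dist_norm of_real_diff [symmetric] norm_of_real
      by (simp add: abs_minus_commute)
    ultimately show ?thesis by (auto simp: U_def)
  qed
  with Y show ?thesis by blast
qed

end

section \<open>Analytic continuation on the Riemann sphere\<close>

text \<open>Once the finite part of a neighbourhood of infinity is open, its complement is closed,
  and compactness of the complement amounts to boundedness.\<close>

lemma openin_sphere:
  "openin riemann_sphere V \<longleftrightarrow> open {z. Some z \<in> V} \<and> (None \<in> V \<longrightarrow> bounded {z. Some z \<notin> V})"
proof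
  assume "openin riemann_sphere V"
  then consider U where "open U" "V = Some ` U"
    | C where "compact C" "V = insert None (Some ` (UNIV - C))"
    by (auto simp: riemann_sphere_def openin_Alexandroff_compactification)
  then show "open {z. Some z \<in> V} \<and> (None \<in> V \<longrightarrow> bounded {z. Some z \<notin> V})"
  proof cases
    case (1 U)
    then have "{z. Some z \<in> V} = U" by auto
    with 1 show ?thesis by auto
  next
    case (2 C)
    then have "{z. Some z \<in> V} = - C" "{z. Some z \<notin> V} = C" by auto
    with 2 show ?thesis
      by (simp add: compact_imp_bounded compact_imp_closed open_Compl)
  qed
next
  assume V: "open {z. Some z \<in> V} \<and> (None \<in> V \<longrightarrow> bounded {z. Some z \<notin> V})"
  show "openin riemann_sphere V"
  proof (cases "None \<in> V")
    case True
    have "{z. Some z \<notin> V} = - {z. Some z \<in> V}" by auto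
    then have "compact {z. Some z \<notin> V}"
      using V True by (simp add: compact_eq_bounded_closed closed_Compl)
    moreover have "V = insert None (Some ` (UNIV - {z. Some z \<notin> V}))"
    proof (intro set_eqI)
      fix p show "p \<in> V \<longleftrightarrow> p \<in> insert None (Some ` (UNIV - {z. Some z \<notin> V}))"
        using True by (cases p) auto
    qed
    ultimately show ?thesis
      unfolding riemann_sphere_def openin_Alexandroff_compactification
      by (auto simp: compact_imp_closed)
  next
    case False
    have "V = Some ` {z. Some z \<in> V}"
    proof (intro set_eqI)
      fix p show "p \<in> V \<longleftrightarrow> p \<in> Some ` {z. Some z \<in> V}"
        using False by (cases p) auto
    qed
    then show ?thesis
      using V unfolding riemann_sphere_def openin_Alexandroff_compactification by auto
  qed
qed

lemma openin_sphere_Some: "open S \<Longrightarrow> openin riemann_sphere (Some ` S)"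
  by (simp add: openin_sphere image_iff)

lemma topspace_sphere [simp]: "topspace riemann_sphere = UNIV"
  by (auto simp: riemann_sphere_def) (metis UNIV_I image_iff option.exhaust)

text \<open>The inverse of the coordinate \<open>c / (x - b)\<close>, in which infinity is 0 and
  \<open>b + c\<close> is 1; it carries the real segment from 0 to 1 to a path from infinity to
  \<open>b + c\<close>.\<close>

definition moebius_chart :: "complex \<Rightarrow> complex \<Rightarrow> complex \<Rightarrow> complex option" where
  "moebius_chart b c w = (if w = 0 then None else Some (b + c / w))"

lemma at_infinity_chart_eq: "at_infinity_chart = moebius_chart 0 1"
  by (auto simp: at_infinity_chart_def moebius_chart_def)

lemma open_vimage_moebius_chart:
  assumes c: "c \<noteq> 0" and V: "openin riemann_sphere V"
  shows "open {w. moebius_chart b c w \<in> V}"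
proof -
  let ?O = "{z. Some z \<in> V}"
  have O: "open ?O" using V openin_sphere by blast
  have "open ((- {0}) \<inter> (\<lambda>w. b + c / w) -` ?O)"
    by (rule continuous_open_preimage) (auto intro!: continuous_intros O)
  moreover have "(- {0}) \<inter> (\<lambda>w. b + c / w) -` ?O = {w. w \<noteq> 0 \<and> moebius_chart b c w \<in> V}"
    by (auto simp: moebius_chart_def)
  ultimately have O': "open {w. w \<noteq> 0 \<and> moebius_chart b c w \<in> V}" by simp
  show ?thesis
  proof (cases "None \<in> V")
    case False
    then have "{w. moebius_chart b c w \<in> V} = {w. w \<noteq> 0 \<and> moebius_chart b c w \<in> V}"
      by (auto simp: moebius_chart_def)
    with O' show ?thesis by simp
  next
    case True
    then obtain R where R: "\<And>z. Some z \<notin> V \<Longrightarrow> cmod z \<le> R"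
      using V by (auto simp: openin_sphere bounded_iff)
    \<comment> \<open>The summand \<open>cmod b\<close> compensates for the shift:
      \<open>cmod (c / w) > R'\<close> keeps \<open>b + c / w\<close> outside the disc of radius
      \<open>R\<close>.\<close>
    define R' where "R' = max R 0 + cmod b + 1"
    have R': "R' > 0" "R' > R + cmod b" by (simp_all add: R'_def max_def add_nonneg_pos)
    have "moebius_chart b c w \<in> V" if w: "cmod w < cmod c / R'" for w
    proof (cases "w = 0")
      case False
      then have "R' < cmod (c / w)"
        using w R' by (simp add: norm_divide field_simps)
      moreover have "cmod (c / w) \<le> cmod (b + c / w) + cmod b"
        by (metis add_diff_cancel_left' norm_triangle_ineq4)
      ultimately have "R < cmod (b + c / w)" using R' by linarith
      then show ?thesis using R False by (force simp: moebius_chart_def)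
    qed (use True in \<open>simp add: moebius_chart_def\<close>)
    moreover have "0 < cmod c / R'" using c R' by simp
    ultimately have "{w. moebius_chart b c w \<in> V} = {w. w \<noteq> 0 \<and> moebius_chart b c w \<in> V} \<union> ball 0 (cmod c / R')"
      by auto
    with O' show ?thesis by auto
  qed
qed

lemma openin_moebius_chart_image:
  assumes c: "c \<noteq> 0" and W: "open W"
  shows "openin riemann_sphere (moebius_chart b c ` W)"
proof -
  have eq: "Some z \<in> moebius_chart b c ` W \<longleftrightarrow> z \<noteq> b \<and> c / (z - b) \<in> W" for z
  proof
    assume "Some z \<in> moebius_chart b c ` W"
    then obtain w where "w \<in> W" "w \<noteq> 0" "z = b + c / w"
      by (auto simp: moebius_chart_def split: if_splits)
    then show "z \<noteq> b \<and> c / (z - b) \<in> W" using c by simp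
  next
    assume "z \<noteq> b \<and> c / (z - b) \<in> W"
    then show "Some z \<in> moebius_chart b c ` W"
      using c by (intro image_eqI [of _ _ "c / (z - b)"]) (auto simp: moebius_chart_def)
  qed
  have "open ((- {b}) \<inter> (\<lambda>z. c / (z - b)) -` W)"
    by (rule continuous_open_preimage) (auto intro!: continuous_intros W)
  moreover have "(- {b}) \<inter> (\<lambda>z. c / (z - b)) -` W = {z. Some z \<in> moebius_chart b c ` W}"
    by (auto simp: eq)
  moreover have "bounded {z. Some z \<notin> moebius_chart b c ` W}" if "None \<in> moebius_chart b c ` W"
  proof -
    have "0 \<in> W" using that by (auto simp: moebius_chart_def split: if_splits)
    then obtain s where s: "s > 0" "ball 0 s \<subseteq> W" using W open_contains_ball by blast
    have "z \<in> cball b (cmod c / s)" if "Some z \<notin> moebius_chart b c ` W" for z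
    proof (cases "z = b")
      case False
      then have "c / (z - b) \<notin> ball 0 s" using that s by (auto simp: eq)
      then show ?thesis using s False by (simp add: norm_divide field_simps dist_norm norm_minus_commute)
    qed (use s in simp)
    then show ?thesis by (intro bounded_subset [OF bounded_cball]) auto
  qed
  ultimately show ?thesis by (simp add: openin_sphere)
qed

text \<open>A coordinate centred at \<open>p\<close>, so that infinity and finite points can be
  handled alike on discs around 0.\<close>

definition chart :: "complex option \<Rightarrow> complex \<Rightarrow> complex option" where
  "chart p w = (case p of None \<Rightarrow> at_infinity_chart w | Some a \<Rightarrow> Some (a + w))"

lemma chart_0 [simp]: "chart p 0 = p"
  by (auto simp: chart_def at_infinity_chart_def split: option.splits)

lemma open_vimage_chart:
  assumes "openin riemann_sphere V" shows "open {w. chart p w \<in> V}"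
proof (cases p)
  case None
  then show ?thesis
    using open_vimage_moebius_chart [OF _ assms, of 1 0] by (simp add: chart_def at_infinity_chart_eq)
next
  case (Some a)
  have "open ((\<lambda>w. a + w) -` {z. Some z \<in> V})"
    by (rule open_vimage) (use assms in \<open>auto simp: openin_sphere intro!: continuous_intros\<close>)
  then show ?thesis by (simp add: chart_def Some vimage_def)
qed

lemma openin_chart_image:
  assumes "open W" shows "openin riemann_sphere (chart p ` W)"
proof (cases p)
  case None
  then show ?thesis
    using openin_moebius_chart_image [OF _ assms, of 1 0] by (simp add: chart_def at_infinity_chart_eq [symmetric] image_def)
next
  case (Some a)
  have "chart p ` W = Some ` ((+) a ` W)" by (auto simp: chart_def Some)
  then show ?thesis
    using openin_sphere_Some open_translation [OF assms, of a] by simp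
qed

lemma chart_ball:
  assumes "openin riemann_sphere V" "p \<in> V"
  obtains r where "r > 0" "chart p ` ball 0 r \<subseteq> V"
proof -
  have "0 \<in> {w. chart p w \<in> V}" using assms by simp
  then obtain r where "r > 0" "ball 0 r \<subseteq> {w. chart p w \<in> V}"
    using open_vimage_chart [OF assms(1), of p] open_contains_ball by blast
  then show ?thesis by (intro that [of r]) auto
qed

lemma sphere_holomorphic_chart:
  assumes "sphere_holomorphic_on f U" "chart p ` S \<subseteq> U"
  shows "(\<lambda>w. f (chart p w) $ i $ j) holomorphic_on S"
proof (cases p)
  case None
  then have "(\<lambda>w. f (at_infinity_chart w) $ i $ j) holomorphic_on S"
    using assms unfolding sphere_holomorphic_on_def
    by (elim conjE allE [of _ i] allE [of _ j]) (auto elim!: holomorphic_on_subset simp: chart_def)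
  then show ?thesis by (simp add: chart_def None)
next
  case (Some a)
  have "(\<lambda>z. f (Some z) $ i $ j) holomorphic_on (\<lambda>w. a + w) ` S"
    using assms Some unfolding sphere_holomorphic_on_def
    by (elim conjE allE [of _ i] allE [of _ j]) (auto elim!: holomorphic_on_subset simp: chart_def)
  then have "((\<lambda>z. f (Some z) $ i $ j) \<circ> (\<lambda>w. a + w)) holomorphic_on S"
    by (intro holomorphic_on_compose holomorphic_intros)
  then show ?thesis by (simp add: chart_def Some o_def)
qed

lemma sphere_holomorphic_on_openin: "sphere_holomorphic_on f U \<Longrightarrow> openin riemann_sphere U"
  by (simp add: sphere_holomorphic_on_def)

lemma sphere_holomorphic_Some:
  assumes "open S" and "\<And>i j. (\<lambda>x. f (Some x) $ i $ j) holomorphic_on S"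
  shows "sphere_holomorphic_on f (Some ` S)"
  unfolding sphere_holomorphic_on_def
proof (intro conjI allI)
  show "openin riemann_sphere (Some ` S)" by (rule openin_sphere_Some [OF assms(1)])
  fix i j
  show "(\<lambda>z. f (Some z) $ i $ j) holomorphic_on {z. Some z \<in> Some ` S}"
    using assms(2) by (simp add: image_iff)
  have "((\<lambda>x. f (Some x) $ i $ j) \<circ> (\<lambda>w. 1 / w)) holomorphic_on {w. w \<noteq> 0 \<and> 1 / w \<in> S}"
    by (intro holomorphic_on_compose holomorphic_on_subset [OF assms(2)]) (auto intro!: holomorphic_intros)
  then have "((\<lambda>x. f (Some x) $ i $ j) \<circ> (\<lambda>w. 1 / w)) holomorphic_on {w. at_infinity_chart w \<in> Some ` S}"
    by (rule holomorphic_on_subset) (auto simp: at_infinity_chart_def split: if_splits)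
  then show "(\<lambda>w. f (at_infinity_chart w) $ i $ j) holomorphic_on {w. at_infinity_chart w \<in> Some ` S}"
    by (rule holomorphic_transform) (auto simp: at_infinity_chart_def split: if_splits)
qed

section \<open>Germs and uniqueness of continuation\<close>

definition germ_eq :: "complex option \<Rightarrow> (complex option \<Rightarrow> complex ^ 'k ^ 'k) \<Rightarrow> complex option set \<Rightarrow>
    (complex option \<Rightarrow> complex ^ 'k ^ 'k) \<Rightarrow> complex option set \<Rightarrow> bool" where
  "germ_eq p f U g W \<longleftrightarrow> (\<exists>V. openin riemann_sphere V \<and> p \<in> V \<and> V \<subseteq> U \<inter> W \<and> (\<forall>z\<in>V. f z = g z))"

lemma germ_eq_sym: "germ_eq p f U g W \<Longrightarrow> germ_eq p g W f U"
  unfolding germ_eq_def by (metis inf_commute)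

lemma germ_eq_trans:
  assumes "germ_eq p f U g W" "germ_eq p g W h X"
  shows "germ_eq p f U h X"
proof -
  obtain V V' where "openin riemann_sphere V \<and> p \<in> V \<and> V \<subseteq> U \<inter> W \<and> (\<forall>z\<in>V. f z = g z)"
    "openin riemann_sphere V' \<and> p \<in> V' \<and> V' \<subseteq> W \<inter> X \<and> (\<forall>z\<in>V'. g z = h z)"
    using assms unfolding germ_eq_def by blast
  then show ?thesis
    unfolding germ_eq_def by (intro exI [of _ "V \<inter> V'"]) (auto intro: openin_Int)
qed

lemma germ_eq_refl: "openin riemann_sphere U \<Longrightarrow> p \<in> U \<Longrightarrow> germ_eq p f U f U"
  unfolding germ_eq_def by blast

lemma analytic_continuation_along_germ:
  "analytic_continuation_along \<gamma> u U \<longleftrightarrow>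
     (\<forall>s\<in>{0..1}. \<gamma> s \<in> U s \<and> sphere_holomorphic_on (u s) (U s)) \<and>
     (\<forall>s\<in>{0..1}. \<exists>\<epsilon>>0. \<forall>s'\<in>{0..1}. \<bar>s' - s\<bar> < \<epsilon> \<longrightarrow> germ_eq (\<gamma> s') (u s) (U s) (u s') (U s'))"
  by (simp add: analytic_continuation_along_def germ_eq_def)

lemma pathin_nbhd:
  assumes "pathin X \<gamma>" "openin X V" "s \<in> {0..1}" "\<gamma> s \<in> V"
  shows "\<exists>\<epsilon>>0. \<forall>s'\<in>{0..1}. \<bar>s' - s\<bar> < \<epsilon> \<longrightarrow> \<gamma> s' \<in> V"
proof -
  have "openin (top_of_set {0..1}) {x \<in> {0..1}. \<gamma> x \<in> V}"
    using assms(1,2) openin_continuous_map_preimage by (fastforce simp: pathin_def)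
  then obtain \<epsilon> where "\<epsilon> > 0" "ball s \<epsilon> \<inter> {0..1} \<subseteq> {x \<in> {0..1}. \<gamma> x \<in> V}"
    using assms(3,4) unfolding openin_contains_ball by blast
  then show ?thesis
    by (intro exI [of _ \<epsilon>]) (auto simp: dist_real_def abs_minus_commute subset_iff)
qed

text \<open>The identity theorem in the coordinate \<open>chart p\<close>: the germ at any single
  point \<open>q\<close> of the disc decides equality on the whole disc.\<close>

lemma germ_eq_propagate:
  assumes f: "sphere_holomorphic_on f U" and g: "sphere_holomorphic_on g W"
    and sub: "chart p ` ball 0 r \<subseteq> U \<inter> W" and q: "q \<in> chart p ` ball 0 r" and eq: "germ_eq q f U g W"
    and z: "z \<in> chart p ` ball 0 r"
  shows "f z = g z"
proof -
  obtain V where V: "openin riemann_sphere V" "q \<in> V" "\<And>z. z \<in> V \<Longrightarrow> f z = g z"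
    using eq unfolding germ_eq_def by blast
  obtain w where w: "w \<in> ball 0 r" "z = chart p w" using z by auto
  have "f (chart p w) $ i $ j = g (chart p w) $ i $ j" for i j
  proof (rule analytic_continuation_open [of "{w. chart p w \<in> V} \<inter> ball 0 r" "ball 0 r"
        "\<lambda>w. f (chart p w) $ i $ j" "\<lambda>w. g (chart p w) $ i $ j" w])
    show "open ({w. chart p w \<in> V} \<inter> ball 0 r)"
      using open_vimage_chart [OF V(1)] by (intro open_Int) auto
    show "{w. chart p w \<in> V} \<inter> ball 0 r \<noteq> {}" using q V(2) by auto
    show "(\<lambda>w. f (chart p w) $ i $ j) holomorphic_on ball 0 r" "(\<lambda>w. g (chart p w) $ i $ j) holomorphic_on ball 0 r"
      using sub by (auto intro!: sphere_holomorphic_chart [OF f] sphere_holomorphic_chart [OF g])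
  qed (use V w in auto)
  then show ?thesis by (simp add: w vec_eq_iff)
qed

text \<open>Agreement of germs is locally constant in the parameter of the path, and the interval is
  connected.\<close>

lemma analytic_continuation_unique:
  assumes path: "pathin riemann_sphere \<gamma>"
    and u: "analytic_continuation_along \<gamma> u U" and v: "analytic_continuation_along \<gamma> v W"
    and start: "germ_eq (\<gamma> 0) (u 0) (U 0) (v 0) (W 0)"
  shows "germ_eq (\<gamma> 1) (u 1) (U 1) (v 1) (W 1)"
proof (rule connected_induction_simple [of "{0..1}" 0 1 "\<lambda>s. germ_eq (\<gamma> s) (u s) (U s) (v s) (W s)"])
  fix s :: real assume s: "s \<in> {0..1}"
  have hol: "sphere_holomorphic_on (u s) (U s)" "sphere_holomorphic_on (v s) (W s)" "\<gamma> s \<in> U s \<inter> W s"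
    using u v s unfolding analytic_continuation_along_def by auto
  then have "openin riemann_sphere (U s \<inter> W s)"
    by (intro openin_Int sphere_holomorphic_on_openin)
  then obtain r where r: "r > 0" "chart (\<gamma> s) ` ball 0 r \<subseteq> U s \<inter> W s"
    using chart_ball hol(3) by blast
  let ?N = "chart (\<gamma> s) ` ball 0 r"
  have N: "openin riemann_sphere ?N" "\<gamma> s \<in> ?N"
    using openin_chart_image r by (auto intro!: image_eqI [of _ _ 0])
  obtain e1 where e1: "e1 > 0" "\<And>s'. s' \<in> {0..1} \<Longrightarrow> \<bar>s' - s\<bar> < e1 \<Longrightarrow> \<gamma> s' \<in> ?N"
    using pathin_nbhd [OF path N(1) s N(2)] by blast
  obtain e2 where e2: "e2 > 0" "\<And>s'. s' \<in> {0..1} \<Longrightarrow> \<bar>s' - s\<bar> < e2 \<Longrightarrow> germ_eq (\<gamma> s') (u s) (U s) (u s') (U s')"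
    using u s unfolding analytic_continuation_along_germ by blast
  obtain e3 where e3: "e3 > 0" "\<And>s'. s' \<in> {0..1} \<Longrightarrow> \<bar>s' - s\<bar> < e3 \<Longrightarrow> germ_eq (\<gamma> s') (v s) (W s) (v s') (W s')"
    using v s unfolding analytic_continuation_along_germ by blast
  define e where "e = min e1 (min e2 e3)"
  \<comment> \<open>For \<open>s'\<close> near \<open>s\<close> agreement at
    \<open>\<gamma> s'\<close> is equivalent to a condition on \<open>?N\<close> in which
    \<open>s'\<close> does not occur, so it holds for all such \<open>s'\<close> or for
    none.\<close>
  have iff: "germ_eq (\<gamma> s') (u s') (U s') (v s') (W s') \<longleftrightarrow> (\<forall>z\<in>?N. u s z = v s z)"
    if "s' \<in> {0..1}" "\<bar>s' - s\<bar> < e" for s'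
  proof
    assume "germ_eq (\<gamma> s') (u s') (U s') (v s') (W s')"
    with e2(2) e3(2) that have "germ_eq (\<gamma> s') (u s) (U s) (v s) (W s)"
      unfolding e_def by (meson germ_eq_sym germ_eq_trans min_less_iff_conj)
    moreover have "\<gamma> s' \<in> ?N"
      using that by (intro e1) (auto simp: e_def)
    ultimately show "\<forall>z\<in>?N. u s z = v s z"
      using germ_eq_propagate [OF hol(1,2) r(2)] by blast
  next
    assume "\<forall>z\<in>?N. u s z = v s z"
    then have "germ_eq (\<gamma> s') (u s) (U s) (v s) (W s)"
      unfolding germ_eq_def using N r e1 that by (intro exI [of _ ?N]) (auto simp: e_def)
    with e2(2) e3(2) that show "germ_eq (\<gamma> s') (u s') (U s') (v s') (W s')"
      unfolding e_def by (meson germ_eq_sym germ_eq_trans min_less_iff_conj)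
  qed
  show "\<exists>T. openin (top_of_set {0..1}) T \<and> s \<in> T \<and> (\<forall>x\<in>T. \<forall>y\<in>T. germ_eq (\<gamma> x) (u x) (U x) (v x) (W x) \<longrightarrow>
      germ_eq (\<gamma> y) (u y) (U y) (v y) (W y))"
    by (rule exI [of _ "{0..1} \<inter> ball s e"])
      (use s iff e1 e2 e3 in \<open>auto simp: e_def dist_real_def abs_minus_commute openin_open_Int\<close>)
qed (use start in auto)

lemma solves_fuchsian_mat_deriv:
  assumes "solves_fuchsian_on Q t Y U" "Some x \<in> U"
  shows "mat_deriv (\<lambda>z. Y (Some z)) (fuchsian_coeff Q t x ** Y (Some x)) x"
  using assms unfolding solves_fuchsian_on_def mat_deriv_def by blast

lemma solves_fuchsian_germ_unique:
  assumes Y: "solves_fuchsian_on Q t Y U" and Z: "solves_fuchsian_on Q t Z W"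
    and inv: "\<And>z. z \<in> U \<Longrightarrow> invertible (Y z)"
    and p: "p \<in> U" "p \<in> W" "Y p = Z p"
  shows "germ_eq p Y U Z W"
proof -
  have hol: "sphere_holomorphic_on Y U" "sphere_holomorphic_on Z W"
    using Y Z by (auto simp: solves_fuchsian_on_def)
  then have "openin riemann_sphere (U \<inter> W)"
    by (intro openin_Int sphere_holomorphic_on_openin)
  then obtain r where r: "r > 0" "chart p ` ball 0 r \<subseteq> U \<inter> W"
    using chart_ball p by blast
  define F where "F w = Y (chart p w)" for w
  define G where "G w = Z (chart p w)" for w
  have der: "\<exists>F'. mat_deriv (\<lambda>w. f (chart p w)) F' w"
    if f: "sphere_holomorphic_on f X" "chart p ` ball 0 r \<subseteq> X" and w: "w \<in> ball 0 r" for f :: "_ \<Rightarrow> complex ^ 'b ^ 'b" and X w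
  proof -
    have "((\<lambda>w. f (chart p w) $ i $ j) has_field_derivative deriv (\<lambda>w. f (chart p w) $ i $ j) w) (at w)" for i j
      using sphere_holomorphic_chart [OF f] w by (intro holomorphic_derivI [OF _ open_ball])
    then have "mat_deriv (\<lambda>w. f (chart p w)) (\<chi> i j. deriv (\<lambda>w. f (chart p w) $ i $ j) w) w"
      by (simp add: mat_deriv_def)
    then show ?thesis ..
  qed
  obtain F' where F': "\<And>w. w \<in> ball 0 r \<Longrightarrow> mat_deriv F (F' w) w"
    using der [OF hol(1)] r(2) unfolding F_def by (metis le_infE)
  obtain G' where G': "\<And>w. w \<in> ball 0 r \<Longrightarrow> mat_deriv G (G' w) w"
    using der [OF hol(2)] r(2) unfolding G_def by (metis le_infE)
  have invF: "invertible (F w)" if "w \<in> ball 0 r" for w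
    using inv r(2) that unfolding F_def by blast
  define H where "H w = matrix_inv (F w) ** G w" for w
  have H': "\<exists>H'. mat_deriv H H' w" if w: "w \<in> ball 0 r" for w
    using mat_deriv_mult [OF mat_deriv_inverse [OF F' _ w invF] G' [OF w]] unfolding H_def by auto
  have H0: "mat_deriv H 0 w" if w: "w \<in> ball 0 r" and fin: "chart p w = Some x" for w x
  proof -
    let ?h = "\<lambda>x. matrix_inv (Y (Some x)) ** Z (Some x)"
    have x: "Some x \<in> U \<inter> W" using r(2) w fin by (metis image_subset_iff)
    have oUW: "open {x. Some x \<in> U \<inter> W}"
      using \<open>openin riemann_sphere (U \<inter> W)\<close> openin_sphere by blast
    have h: "mat_deriv ?h 0 x"
      by (rule ode_quotient_deriv [where B = "fuchsian_coeff Q t" and S = "{x. Some x \<in> U \<inter> W}"])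
        (use oUW x inv in \<open>auto intro: solves_fuchsian_mat_deriv [OF Y] solves_fuchsian_mat_deriv [OF Z]\<close>)
    have "\<exists>g g' S. (g has_field_derivative g') (at w) \<and> g w = x \<and> open S \<and> w \<in> S \<and> (\<forall>w\<in>S. chart p w = Some (g w))"
    proof (cases p)
      case None
      then have "w \<noteq> 0" using fin by (auto simp: chart_def at_infinity_chart_def split: if_splits)
      moreover have "((\<lambda>w. 1 / w) has_field_derivative - 1 / w\<^sup>2) (at w)"
        using \<open>w \<noteq> 0\<close> by (auto intro!: derivative_eq_intros simp: power2_eq_square)
      ultimately show ?thesis
        using fin None by (intro exI [of _ "\<lambda>w. 1 / w"] exI [of _ "- 1 / w\<^sup>2"] exI [of _ "- {0}"])
          (auto simp: chart_def at_infinity_chart_def)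
    next
      case (Some a)
      have "((\<lambda>w. a + w) has_field_derivative 1) (at w)" by (auto intro!: derivative_eq_intros)
      with Some fin show ?thesis
        by (intro exI [of _ "\<lambda>w. a + w"] exI [of _ 1] exI [of _ UNIV]) (auto simp: chart_def)
    qed
    then obtain g g' S where g: "(g has_field_derivative g') (at w)" "g w = x" "open S" "w \<in> S"
      "\<And>w. w \<in> S \<Longrightarrow> chart p w = Some (g w)"
      by blast
    from mat_deriv_compose [of ?h 0 g, OF _ g(1)] h g(2) have "mat_deriv (\<lambda>w. ?h (g w)) 0 w" by simp
    then show ?thesis
      by (rule mat_deriv_transform [OF _ g(3,4)]) (use g(5) in \<open>simp add: H_def F_def G_def\<close>)
  qed
  have "H w = H 0" if w: "w \<in> ball 0 r" for w
  proof -
    have "H w $ i $ j = H 0 $ i $ j" for i j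
    proof -
      have "(\<lambda>w. H w $ i $ j) constant_on ball 0 r"
      \<comment> \<open>The centre is excepted because it may be infinity; continuity suffices
        there.\<close>
      proof (rule DERIV_zero_connected_constant_on [where K = "{0}"])
        show "continuous_on (ball 0 r) (\<lambda>w. H w $ i $ j)"
          by (intro continuous_at_imp_continuous_on ballI)
            (use H' in \<open>unfold mat_deriv_def, blast intro: DERIV_isCont\<close>)
        show "\<forall>w\<in>ball 0 r - {0}. ((\<lambda>w. H w $ i $ j) has_field_derivative 0) (at w)"
        proof
          fix w :: complex assume w: "w \<in> ball 0 r - {0}"
          then obtain x where "chart p w = Some x"
            by (cases p) (auto simp: chart_def at_infinity_chart_def)
          then show "((\<lambda>w. H w $ i $ j) has_field_derivative 0) (at w)"
            using H0 w by (auto simp: mat_deriv_def)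
        qed
      qed auto
      then show ?thesis using w r by (auto simp: constant_on_def)
    qed
    then show ?thesis by (simp add: vec_eq_iff)
  qed
  moreover have "H 0 = mat 1"
    using invF [of 0] r p(3) by (simp add: H_def F_def G_def matrix_inv_works)
  ultimately have "F w = G w" if w: "w \<in> ball 0 r" for w
  proof -
    have "F w ** (matrix_inv (F w) ** G w) = F w"
      using w \<open>H 0 = mat 1\<close> \<open>\<And>w. w \<in> ball 0 r \<Longrightarrow> H w = H 0\<close> by (simp add: H_def)
    then show ?thesis
      using matrix_inv_works(1) [OF invF [OF w]] by (simp add: matrix_mul_assoc)
  qed
  then show ?thesis
    unfolding germ_eq_def F_def G_def
    using openin_chart_image r by (intro exI [of _ "chart p ` ball 0 r"]) (auto intro!: image_eqI [of _ _ 0])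
qed

text \<open>\<open>continued_solution\<close> is a definite description, and one explicit
  continuation evaluates it: any competitor has the same initial germ by uniqueness for the
  equation, and the same final germ by uniqueness of continuation.\<close>

lemma continued_solution_eqI:
  assumes path: "pathin riemann_sphere \<gamma>" "\<gamma> 0 = x0"
    and u: "analytic_continuation_along \<gamma> u U"
    and u0: "solves_fuchsian_on Q t (u 0) (U 0)" "u 0 x0 = mat 1" "\<And>z. z \<in> U 0 \<Longrightarrow> invertible (u 0 z)"
  shows "continued_solution Q x0 t \<gamma> = u 1 (\<gamma> 1)"
  unfolding continued_solution_def
proof (rule the_equality)
  show "\<exists>u' U. analytic_continuation_along \<gamma> u' U \<and> solves_fuchsian_on Q t (u' 0) (U 0) \<and> u' 0 x0 = mat 1 \<and> u 1 (\<gamma> 1) = u' 1 (\<gamma> 1)"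
    using u u0 by blast
  fix M assume "\<exists>u U. analytic_continuation_along \<gamma> u U \<and> solves_fuchsian_on Q t (u 0) (U 0) \<and> u 0 x0 = mat 1 \<and> M = u 1 (\<gamma> 1)"
  then obtain v W where v: "analytic_continuation_along \<gamma> v W" "solves_fuchsian_on Q t (v 0) (W 0)" "v 0 x0 = mat 1" "M = v 1 (\<gamma> 1)"
    by blast
  have "x0 \<in> U 0" "x0 \<in> W 0"
    using u v(1) path(2) unfolding analytic_continuation_along_def by auto
  then have "germ_eq (\<gamma> 0) (u 0) (U 0) (v 0) (W 0)"
    unfolding path(2) by (intro solves_fuchsian_germ_unique [OF u0(1) v(2) u0(3)]) (simp_all add: u0 v)
  from analytic_continuation_unique [OF path(1) u v(1) this] show "M = u 1 (\<gamma> 1)"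
    unfolding v(4) germ_eq_def by auto
qed

section \<open>Continuation along joined paths\<close>

lemma pathin_path_join:
  assumes "pathin X \<alpha>" "pathin X \<beta>" "\<alpha> 1 = \<beta> 0"
  shows "pathin X (path_join \<alpha> \<beta>)"
proof -
  have "continuous_map (top_of_set {0..1}) X (\<lambda>s. if s \<le> 1 / 2 then \<alpha> (2 * s) else \<beta> (2 * s - 1))"
  proof (rule continuous_map_cases_le)
    have "continuous_map (subtopology (top_of_set {0..1}) {s \<in> topspace (top_of_set {0..1}). s \<le> 1 / 2}) (top_of_set {0..1}) (\<lambda>s::real. 2 * s)"
      by (auto simp: subtopology_subtopology intro!: continuous_intros)
    from continuous_map_compose [OF this assms(1) [unfolded pathin_def]]
    show "continuous_map (subtopology (top_of_set {0..1}) {s \<in> topspace (top_of_set {0..1}). s \<le> 1 / 2}) X (\<lambda>s. \<alpha> (2 * s))"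
      by (simp add: o_def)
    have "continuous_map (subtopology (top_of_set {0..1}) {s \<in> topspace (top_of_set {0..1}). 1 / 2 \<le> s}) (top_of_set {0..1}) (\<lambda>s::real. 2 * s - 1)"
      by (auto simp: subtopology_subtopology intro!: continuous_intros)
    from continuous_map_compose [OF this assms(2) [unfolded pathin_def]]
    show "continuous_map (subtopology (top_of_set {0..1}) {s \<in> topspace (top_of_set {0..1}). 1 / 2 \<le> s}) X (\<lambda>s. \<beta> (2 * s - 1))"
      by (simp add: o_def)
  qed (use assms(3) in \<open>auto intro!: continuous_intros simp: mult.commute [of "2::real"]\<close>)
  then show ?thesis
    by (simp add: pathin_def path_join_def [abs_def])
qed

lemma pathin_Some: "path \<mu> \<Longrightarrow> pathin riemann_sphere (Some \<circ> \<mu>)"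
  unfolding pathin_def riemann_sphere_def path_def
  by (rule continuous_map_compose [OF _ continuous_map_Some]) simp

lemma analytic_continuation_path_join:
  assumes \<beta>: "pathin riemann_sphere \<beta>"
    and u: "analytic_continuation_along \<alpha> u U" and v: "analytic_continuation_along \<beta> v W"
    and eq: "\<alpha> 1 = \<beta> 0" "germ_eq (\<beta> 0) (u 1) (U 1) (v 0) (W 0)"
  shows "analytic_continuation_along (path_join \<alpha> \<beta>) (\<lambda>s. if s \<le> 1 / 2 then u (2 * s) else v (2 * s - 1))
    (\<lambda>s. if s \<le> 1 / 2 then U (2 * s) else W (2 * s - 1))"
  unfolding analytic_continuation_along_germ
proof (intro conjI ballI)
  fix s :: real assume s: "s \<in> {0..1}"
  show "path_join \<alpha> \<beta> s \<in> (if s \<le> 1 / 2 then U (2 * s) else W (2 * s - 1))"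
    "sphere_holomorphic_on (if s \<le> 1 / 2 then u (2 * s) else v (2 * s - 1)) (if s \<le> 1 / 2 then U (2 * s) else W (2 * s - 1))"
    using u v s unfolding analytic_continuation_along_germ by (auto simp: path_join_def)
  have ul: "\<exists>\<epsilon>>0. \<forall>s'\<in>{0..1/2}. \<bar>s' - s\<bar> < \<epsilon> \<longrightarrow> germ_eq (\<alpha> (2 * s')) (u (2 * s)) (U (2 * s)) (u (2 * s')) (U (2 * s'))"
    if "s \<le> 1 / 2"
  proof -
    have "2 * s \<in> {0..1}" using s that by auto
    then obtain \<epsilon> where "\<epsilon> > 0" "\<And>s'. s' \<in> {0..1} \<Longrightarrow> \<bar>s' - 2 * s\<bar> < \<epsilon> \<Longrightarrow> germ_eq (\<alpha> s') (u (2 * s)) (U (2 * s)) (u s') (U s')"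
      using u unfolding analytic_continuation_along_germ by blast
    moreover have "\<bar>2 * s' - 2 * s\<bar> = 2 * \<bar>s' - s\<bar>" for s'
      unfolding right_diff_distrib [symmetric] abs_mult by simp
    ultimately show ?thesis by (intro exI [of _ "\<epsilon> / 2"]) auto
  qed
  have vl: "\<exists>\<epsilon>>0. \<forall>s'\<in>{1/2..1}. \<bar>s' - s\<bar> < \<epsilon> \<longrightarrow> germ_eq (\<beta> (2 * s' - 1)) (v (2 * s - 1)) (W (2 * s - 1)) (v (2 * s' - 1)) (W (2 * s' - 1))"
    if "s \<ge> 1 / 2"
  proof -
    have "2 * s - 1 \<in> {0..1}" using s that by auto
    then obtain \<epsilon> where "\<epsilon> > 0" "\<And>s'. s' \<in> {0..1} \<Longrightarrow> \<bar>s' - (2 * s - 1)\<bar> < \<epsilon> \<Longrightarrow> germ_eq (\<beta> s') (v (2 * s - 1)) (W (2 * s - 1)) (v s') (W s')"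
      using v unfolding analytic_continuation_along_germ by blast
    moreover have "\<bar>2 * s' - 1 - (2 * s - 1)\<bar> = 2 * \<bar>s' - s\<bar>" for s'
    proof -
      have "2 * s' - 1 - (2 * s - 1) = 2 * (s' - s)" by simp
      then show ?thesis by (simp only: abs_mult)
    qed
    ultimately show ?thesis by (intro exI [of _ "\<epsilon> / 2"]) auto
  qed
  consider "s < 1 / 2" | "s > 1 / 2" | "s = 1 / 2" by linarith
  then show "\<exists>\<epsilon>>0. \<forall>s'\<in>{0..1}. \<bar>s' - s\<bar> < \<epsilon> \<longrightarrow>
      germ_eq (path_join \<alpha> \<beta> s') (if s \<le> 1 / 2 then u (2 * s) else v (2 * s - 1)) (if s \<le> 1 / 2 then U (2 * s) else W (2 * s - 1))
        (if s' \<le> 1 / 2 then u (2 * s') else v (2 * s' - 1)) (if s' \<le> 1 / 2 then U (2 * s') else W (2 * s' - 1))"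
  proof cases
    case 1
    then obtain \<epsilon> where "\<epsilon> > 0" "\<forall>s'\<in>{0..1/2}. \<bar>s' - s\<bar> < \<epsilon> \<longrightarrow> germ_eq (\<alpha> (2 * s')) (u (2 * s)) (U (2 * s)) (u (2 * s')) (U (2 * s'))"
      using ul by auto
    then show ?thesis
      using 1 by (intro exI [of _ "min \<epsilon> (1 / 2 - s)"]) (auto simp: path_join_def)
  next
    case 2
    then obtain \<epsilon> where "\<epsilon> > 0" "\<forall>s'\<in>{1/2..1}. \<bar>s' - s\<bar> < \<epsilon> \<longrightarrow> germ_eq (\<beta> (2 * s' - 1)) (v (2 * s - 1)) (W (2 * s - 1)) (v (2 * s' - 1)) (W (2 * s' - 1))"
      using vl by auto
    then show ?thesis
      using 2 by (intro exI [of _ "min \<epsilon> (s - 1 / 2)"]) (auto simp: path_join_def)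
  next
    case 3
    obtain e1 where e1: "e1 > 0" "\<forall>s'\<in>{0..1/2}. \<bar>s' - s\<bar> < e1 \<longrightarrow> germ_eq (\<alpha> (2 * s')) (u (2 * s)) (U (2 * s)) (u (2 * s')) (U (2 * s'))"
      using ul 3 by auto
    obtain e2 where e2: "e2 > 0" "\<forall>s'\<in>{1/2..1}. \<bar>s' - s\<bar> < e2 \<longrightarrow> germ_eq (\<beta> (2 * s' - 1)) (v (2 * s - 1)) (W (2 * s - 1)) (v (2 * s' - 1)) (W (2 * s' - 1))"
      using vl 3 by auto
    obtain V where V: "openin riemann_sphere V" "\<beta> 0 \<in> V" "V \<subseteq> U 1 \<inter> W 0" "\<forall>z\<in>V. u 1 z = v 0 z"
      using eq(2) unfolding germ_eq_def by blast
    obtain e3 where e3: "e3 > 0" "\<And>s'. s' \<in> {0..1} \<Longrightarrow> \<bar>s' - 0\<bar> < e3 \<Longrightarrow> \<beta> s' \<in> V"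
      using pathin_nbhd [OF \<beta> V(1), of 0] V(2) by auto
    \<comment> \<open>The joined family takes the element \<open>u 1\<close> at the junction, so
      comparison with later elements passes through \<open>v 0\<close>; the two agree near
      \<open>\<beta> 0\<close>, where \<open>\<beta>\<close> stays for a short while.\<close>
    have "germ_eq (\<beta> (2 * s' - 1)) (u 1) (U 1) (v (2 * s' - 1)) (W (2 * s' - 1))"
      if s': "1 / 2 < s'" "s' \<le> 1" "\<bar>s' - s\<bar> < min e2 (e3 / 2)" for s'
    proof (rule germ_eq_trans)
      have "\<beta> (2 * s' - 1) \<in> V" using s' 3 by (intro e3) auto
      then show "germ_eq (\<beta> (2 * s' - 1)) (u 1) (U 1) (v 0) (W 0)"
        using V unfolding germ_eq_def by blast
      show "germ_eq (\<beta> (2 * s' - 1)) (v 0) (W 0) (v (2 * s' - 1)) (W (2 * s' - 1))"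
        using e2(2) s' 3 by auto
    qed
    then show ?thesis
      using e1 e2 e3 unfolding 3 by (intro exI [of _ "min e1 (min e2 (e3 / 2))"]) (auto simp: path_join_def)
  qed
qed

text \<open>Meant for the leg \<open>\<alpha>\<close> and its reverse, along which a single solution
  is defined on one neighbourhood of the whole path.\<close>

lemma analytic_continuation_const:
  assumes "sphere_holomorphic_on Y U" "\<And>s. s \<in> {0..1} \<Longrightarrow> \<gamma> s \<in> U"
  shows "analytic_continuation_along \<gamma> (\<lambda>_. Y) (\<lambda>_. U)"
  unfolding analytic_continuation_along_germ
  using assms germ_eq_refl [OF sphere_holomorphic_on_openin [OF assms(1)]] zero_less_one by blast

section \<open>Solutions near a pole\<close>

lemma polydisc_mono: "\<delta> \<le> \<delta>' \<Longrightarrow> polydisc t \<delta> \<subseteq> polydisc t \<delta>'"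
  by (auto simp: polydisc_def intro: less_le_trans)

lemma mem_polydisc_centre [simp]: "\<delta> > 0 \<Longrightarrow> t \<in> polydisc t \<delta>"
  by (simp add: polydisc_def)

lemma open_polydisc: "open (polydisc t0 \<delta>)"
proof -
  have "polydisc t0 \<delta> = (\<Inter>p\<in>UNIV. (\<lambda>t. t $ p) -` ball (t0 $ p) \<delta>)"
    by (auto simp: polydisc_def)
  then show ?thesis
    by (simp only:) (intro open_INT open_vimage ballI; auto intro!: continuous_intros)
qed

lemma eventually_polydisc:
  assumes "eventually P (nhds t0)"
  shows "\<exists>\<delta>>0. \<forall>t\<in>polydisc (t0 :: complex ^ 'n) \<delta>. P t"
proof -
  obtain e where e: "e > 0" "\<And>t. dist t t0 < e \<Longrightarrow> P t"
    using assms by (auto simp: eventually_nhds_metric)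
  \<comment> \<open>The norm is at most the sum of the moduli of the coordinates, so each coordinate
    takes an equal share of \<open>e\<close>.\<close>
  define \<delta> where "\<delta> = e / real CARD('n)"
  have "P t" if t: "t \<in> polydisc t0 \<delta>" for t
  proof (rule e(2))
    have "norm (t - t0) \<le> (\<Sum>p\<in>UNIV. norm ((t - t0) $ p))"
      by (simp add: norm_vec_def L2_set_le_sum)
    also have "\<dots> < (\<Sum>p\<in>(UNIV :: 'n set). \<delta>)"
      using t by (intro sum_strict_mono) (auto simp: polydisc_def dist_norm norm_minus_commute)
    finally show "dist t t0 < e" by (simp add: dist_norm \<delta>_def)
  qed
  then show ?thesis using e by (intro exI [of _ \<delta>]) (auto simp: \<delta>_def)
qed

lemma eventually_near:
  fixes F :: "complex ^ 'n \<Rightarrow> 'b :: real_normed_vector"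
  assumes F: "continuous_on (UNIV \<times> D) (\<lambda>w :: complex \<times> _. F (snd w))"
    and D: "open D" "t0 \<in> D" and e: "e > 0"
  shows "eventually (\<lambda>t. norm (F t0 - F t) < e) (nhds t0)"
proof -
  have "continuous_on D (\<lambda>t. F (snd (0 :: complex, t)))"
    by (rule continuous_on_compose2 [OF F]) (auto intro!: continuous_intros)
  then have "isCont F t0" using D by (simp add: continuous_on_eq_continuous_at)
  then have "(F \<longlongrightarrow> F t0) (nhds t0)"
    by (simp add: continuous_at_imp_continuous_within isCont_def tendsto_nhds_iff)
  then show ?thesis
    using e by (auto simp: tendsto_iff dist_norm norm_minus_commute)
qed

text \<open>The germ at \<open>m\<close> of \<open>G (x - a)\<^bsup>A\<^esup> K\<close>, where \<open>c\<close> is the value of \<open>log (x - a)\<close> at \<open>m\<close> and the logarithm is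
  normalized by subtracting \<open>l0\<close>.\<close>

definition log_element ::
    "(complex \<Rightarrow> complex ^ 'k ^ 'k) \<Rightarrow> complex ^ 'k ^ 'k \<Rightarrow> complex ^ 'k ^ 'k \<Rightarrow> complex \<Rightarrow> complex \<Rightarrow> complex \<Rightarrow> complex \<Rightarrow>
     complex option \<Rightarrow> complex ^ 'k ^ 'k" where
  "log_element G A K a l0 c m z = (case z of None \<Rightarrow> 0
     | Some x \<Rightarrow> G x ** mat_exp (mat_scale (c + Ln ((x - a) / (m - a)) - l0) A) ** K)"

text \<open>The points of the disc whose direction from \<open>a\<close> makes an acute angle with
  that of \<open>m\<close>; there the principal logarithm of \<open>(x - a) / (m - a)\<close> is
  holomorphic.\<close>

definition log_domain :: "complex \<Rightarrow> real \<Rightarrow> complex \<Rightarrow> complex set" where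
  "log_domain a \<rho> m = {x \<in> ball a \<rho>. Re ((x - a) / (m - a)) > 0}"

lemma open_log_domain: "m \<noteq> a \<Longrightarrow> open (log_domain a \<rho> m)"
  unfolding log_domain_def Collect_conj_eq Collect_mem_eq
  by (intro open_Int open_ball open_Collect_less continuous_intros) auto

lemma log_domain_centre: "m \<in> ball a \<rho> \<Longrightarrow> m \<noteq> a \<Longrightarrow> m \<in> log_domain a \<rho> m"
  by (simp add: log_domain_def)

lemma log_domain_ne: "x \<in> log_domain a \<rho> m \<Longrightarrow> x \<noteq> a"
  by (auto simp: log_domain_def)

lemma Ln_quotient_deriv:
  assumes "x \<in> log_domain a \<rho> m" "m \<noteq> a"
  shows "((\<lambda>x. c + Ln ((x - a) / (m - a)) - l0) has_field_derivative 1 / (x - a)) (at x)"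
proof -
  have "(x - a) / (m - a) \<notin> \<real>\<^sub>\<le>\<^sub>0"
    using assms by (auto simp: log_domain_def complex_nonpos_Reals_iff)
  moreover have "((\<lambda>x. (x - a) / (m - a)) has_field_derivative 1 / (m - a)) (at x)"
    using assms(2) by (auto intro!: derivative_eq_intros)
  ultimately have "((\<lambda>x. Ln ((x - a) / (m - a))) has_field_derivative inverse ((x - a) / (m - a)) * (1 / (m - a))) (at x)"
    by (intro DERIV_chain2 [OF has_field_derivative_Ln])
  then have "((\<lambda>x. Ln ((x - a) / (m - a))) has_field_derivative 1 / (x - a)) (at x)"
    using assms(2) by (simp add: inverse_eq_divide)
  from DERIV_diff [OF DERIV_add [OF DERIV_const [of c] this] DERIV_const [of l0]] show ?thesis
    by simp
qed

text \<open>Differentiating the power contributes \<open>A / (x - a)\<close> to the right of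
  \<open>G x\<close>, which cancels the second term in the derivative of \<open>G\<close> and leaves
  the system with coefficient \<open>B\<close>.\<close>

lemma log_element_deriv:
  assumes x: "x \<in> log_domain a \<rho> m" and m: "m \<noteq> a" and G: "mat_deriv G (B ** G x - mat_scale (1 / (x - a)) (G x ** A)) x"
  shows "mat_deriv (\<lambda>x. log_element G A K a l0 c m (Some x)) (B ** log_element G A K a l0 c m (Some x)) x"
proof -
  let ?E = "mat_exp (mat_scale (c + Ln ((x - a) / (m - a)) - l0) A)"
  have "mat_deriv (\<lambda>x. mat_exp (mat_scale (c + Ln ((x - a) / (m - a)) - l0) A))
      (mat_scale (1 / (x - a)) (A ** ?E)) x"
    by (rule mat_deriv_compose [OF mat_deriv_exp Ln_quotient_deriv [OF x m]])
  from mat_deriv_mult_const [OF mat_deriv_mult [OF G this], of K]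
  show ?thesis
    by (simp add: log_element_def mat_algebra)
qed

locale log_solution =
  fixes G :: "complex \<Rightarrow> complex ^ 'k::finite ^ 'k" and A K :: "complex ^ 'k ^ 'k" and a l0 :: complex and \<rho> :: real
    and Q :: "'n::finite \<Rightarrow> complex ^ 'n \<Rightarrow> complex ^ 'k ^ 'k" and t :: "complex ^ 'n"
  assumes G: "\<And>x. x \<in> ball a \<rho> \<Longrightarrow> x \<noteq> a \<Longrightarrow>
      mat_deriv G (fuchsian_coeff Q t x ** G x - mat_scale (1 / (x - a)) (G x ** A)) x"
    and avoid: "\<And>x p. x \<in> ball a \<rho> \<Longrightarrow> x \<noteq> a \<Longrightarrow> x \<noteq> t $ p"
begin

abbreviation "elt \<equiv> log_element G A K a l0"

lemma log_element_solves:
  assumes m: "m \<noteq> a"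
  shows "solves_fuchsian_on Q t (elt c m) (Some ` log_domain a \<rho> m)"
proof -
  have D: "mat_deriv (\<lambda>x. elt c m (Some x)) (fuchsian_coeff Q t x ** elt c m (Some x)) x"
    if "x \<in> log_domain a \<rho> m" for x
    using that m log_domain_ne [OF that] G by (intro log_element_deriv) (auto simp: log_domain_def)
  have "sphere_holomorphic_on (elt c m) (Some ` log_domain a \<rho> m)"
  proof (rule sphere_holomorphic_Some [OF open_log_domain [OF m]])
    show "(\<lambda>x. elt c m (Some x) $ i $ j) holomorphic_on log_domain a \<rho> m" for i j
      using D unfolding mat_deriv_def holomorphic_on_def field_differentiable_def
      by (meson has_field_derivative_at_within)
  qed
  moreover have "Some (t $ p) \<notin> Some ` log_domain a \<rho> m" for p
    using avoid [of "t $ p" p] log_domain_ne [of "t $ p" a \<rho> m] by (auto simp: log_domain_def)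
  ultimately show ?thesis
    using D unfolding solves_fuchsian_on_def mat_deriv_def by (auto simp: image_iff)
qed

text \<open>Neighbouring elements are built with logarithms of the same number, which differ by a
  multiple of \<open>2 * pi * \<i>\<close>; an estimate of the difference by
  \<open>3 < 2 * pi\<close> shows that it is 0.\<close>

lemma analytic_continuation_log_element:
  assumes \<mu>: "path \<mu>" "path_image \<mu> \<subseteq> ball a \<rho> - {a}"
    and l: "continuous_on {0..1} l" "\<And>s. s \<in> {0..1} \<Longrightarrow> exp (l s) = \<mu> s - a"
  shows "analytic_continuation_along (Some \<circ> \<mu>) (\<lambda>s. elt (l s) (\<mu> s)) (\<lambda>s. Some ` log_domain a \<rho> (\<mu> s))"
  unfolding analytic_continuation_along_germ
proof (intro conjI ballI)
  have \<mu>s: "\<mu> s \<in> ball a \<rho>" "\<mu> s \<noteq> a" if "s \<in> {0..1}" for s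
    using \<mu>(2) that unfolding path_image_def by blast+
  fix s :: real assume s: "s \<in> {0..1}"
  show "(Some \<circ> \<mu>) s \<in> Some ` log_domain a \<rho> (\<mu> s)"
    using log_domain_centre \<mu>s [OF s] by auto
  show "sphere_holomorphic_on (elt (l s) (\<mu> s)) (Some ` log_domain a \<rho> (\<mu> s))"
    using log_element_solves [OF \<mu>s(2) [OF s]] by (simp add: solves_fuchsian_on_def)
  \<comment> \<open>On \<open>O' s\<close> the principal logarithm is smaller than 1. Two such terms
    and the variation of \<open>l\<close>, less than 1 too, give the bound 3.\<close>
  define O' where "O' s = {x \<in> log_domain a \<rho> (\<mu> s). cmod (Ln ((x - a) / (\<mu> s - a))) < 1}" for s
  have O': "open (O' s)" "\<mu> s \<in> O' s" if s: "s \<in> {0..1}" for s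
  proof -
    have "continuous_on (log_domain a \<rho> (\<mu> s)) (\<lambda>x. Ln ((x - a) / (\<mu> s - a)))"
      using Ln_quotient_deriv [OF _ \<mu>s(2) [OF s], of _ \<rho> 0 0]
      by (intro continuous_at_imp_continuous_on ballI) (auto intro: DERIV_isCont)
    then have "open (log_domain a \<rho> (\<mu> s) \<inter> (\<lambda>x. Ln ((x - a) / (\<mu> s - a))) -` ball 0 1)"
      by (intro continuous_open_preimage open_log_domain \<mu>s s) auto
    moreover have "log_domain a \<rho> (\<mu> s) \<inter> (\<lambda>x. Ln ((x - a) / (\<mu> s - a))) -` ball 0 1 = O' s"
      by (auto simp: O'_def)
    ultimately show "open (O' s)" by simp
    show "\<mu> s \<in> O' s" using \<mu>s [OF s] by (simp add: O'_def log_domain_centre)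
  qed
  obtain e1 where e1: "e1 > 0" "\<And>s'. s' \<in> {0..1} \<Longrightarrow> \<bar>s' - s\<bar> < e1 \<Longrightarrow> (Some \<circ> \<mu>) s' \<in> Some ` O' s"
    using pathin_nbhd [OF pathin_Some [OF \<mu>(1)] openin_sphere_Some [OF O'(1) [OF s]] s] O'(2) [OF s] by auto
  obtain e2 where e2: "e2 > 0" "\<And>s'. s' \<in> {0..1} \<Longrightarrow> \<bar>s' - s\<bar> < e2 \<Longrightarrow> cmod (l s' - l s) < 1"
    using l(1) s unfolding continuous_on_iff dist_norm dist_real_def by (metis zero_less_one real_norm_def)
  have "germ_eq ((Some \<circ> \<mu>) s') (elt (l s) (\<mu> s)) (Some ` log_domain a \<rho> (\<mu> s)) (elt (l s') (\<mu> s')) (Some ` log_domain a \<rho> (\<mu> s'))"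
    if s': "s' \<in> {0..1}" "\<bar>s' - s\<bar> < min e1 e2" for s'
    unfolding germ_eq_def
  proof (intro exI conjI ballI)
    let ?V = "Some ` (O' s \<inter> O' s')"
    show "openin riemann_sphere ?V"
      using O' s s' by (intro openin_sphere_Some open_Int) auto
    show "(Some \<circ> \<mu>) s' \<in> ?V" using e1(2) [of s'] s' O'(2) by auto
    show "?V \<subseteq> Some ` log_domain a \<rho> (\<mu> s) \<inter> Some ` log_domain a \<rho> (\<mu> s')"
      by (auto simp: O'_def)
    fix z assume "z \<in> ?V"
    then obtain x where x: "z = Some x" "x \<in> O' s" "x \<in> O' s'" by auto
    have xa: "x \<noteq> a" using x log_domain_ne by (auto simp: O'_def)
    define d where "d = (l s + Ln ((x - a) / (\<mu> s - a))) - (l s' + Ln ((x - a) / (\<mu> s' - a)))"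
    have "exp d = 1"
      unfolding d_def exp_diff exp_add using xa l(2) s s' \<mu>s by simp
    moreover have "cmod d < 3"
    proof -
      have "d = (l s - l s') + Ln ((x - a) / (\<mu> s - a)) - Ln ((x - a) / (\<mu> s' - a))" by (simp add: d_def)
      then have "cmod d \<le> cmod (l s - l s') + cmod (Ln ((x - a) / (\<mu> s - a))) + cmod (Ln ((x - a) / (\<mu> s' - a)))"
        using norm_triangle_ineq4 [of "l s - l s' + Ln ((x - a) / (\<mu> s - a))" "Ln ((x - a) / (\<mu> s' - a))"]
          norm_triangle_ineq [of "l s - l s'" "Ln ((x - a) / (\<mu> s - a))"] by simp
      then show ?thesis
        using e2(2) [of s'] s' x by (auto simp: O'_def norm_minus_commute)
    qed
    ultimately have "d = 0"
    proof -
      obtain n :: int where n: "Re d = 0" "Im d = of_int (2 * n) * pi"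
        using \<open>exp d = 1\<close> exp_eq_1 by blast
      have "\<bar>Im d\<bar> < 2 * pi"
        using abs_Im_le_cmod [of d] \<open>cmod d < 3\<close> pi_gt3 by linarith
      then have "2 * pi * \<bar>real_of_int n\<bar> < 2 * pi * 1"
        using n(2) by (simp add: abs_mult)
      then have "\<bar>real_of_int n\<bar> < 1"
        by (rule mult_left_less_imp_less) simp
      then have "n = 0" by linarith
      then show ?thesis using n by (simp add: complex_eq_iff)
    qed
    then show "elt (l s) (\<mu> s) z = elt (l s') (\<mu> s') z"
      by (simp add: log_element_def x(1) d_def)
  qed
  then show "\<exists>\<epsilon>>0. \<forall>s'\<in>{0..1}. \<bar>s' - s\<bar> < \<epsilon> \<longrightarrow>
      germ_eq ((Some \<circ> \<mu>) s') (elt (l s) (\<mu> s)) (Some ` log_domain a \<rho> (\<mu> s)) (elt (l s') (\<mu> s')) (Some ` log_domain a \<rho> (\<mu> s'))"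
    using e1(1) e2(1) by (intro exI [of _ "min e1 e2"]) auto
qed

end

text \<open>The coordinate \<open>x - t $ j\<close> keeps the moving pole at the centre.
  \<open>local_fuchsian_solution\<close> with residue \<open>Q j t\<close> then applies uniformly
  near \<open>t0\<close>, the bound from \<open>sylv_lower_bound\<close> at \<open>t0\<close> being
  halved by the perturbation.\<close>

lemma singular_local_solution:
  fixes Q :: "'n::finite \<Rightarrow> complex ^ 'n \<Rightarrow> complex ^ 'k::finite ^ 'k"
  assumes D: "open D" "D \<subseteq> distinct_coords" "t0 \<in> D" and Q: "\<And>p. vec_holomorphic_on (Q p) D"
    and nr: "non_resonant (Q j t0)"
  shows "\<exists>\<rho>>0. \<exists>\<delta>>0. \<exists>G. ereal \<rho> \<le> half_gap t0 j \<and> polydisc t0 \<delta> \<subseteq> D \<and>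
     joint_holomorphic_on G {(x, t). t \<in> polydisc t0 \<delta> \<and> x \<in> ball (t $ j) \<rho>} \<and>
     (\<forall>t\<in>polydisc t0 \<delta>. \<forall>x\<in>ball (t $ j) \<rho>. invertible (G (x, t)) \<and>
        (x \<noteq> t $ j \<longrightarrow> (\<forall>p. x \<noteq> t $ p) \<and>
           mat_deriv (\<lambda>x. G (x, t)) (fuchsian_coeff Q t x ** G (x, t) - mat_scale (1 / (x - t $ j)) (G (x, t) ** Q j t)) x))"
proof -
  \<comment> \<open>The 1 makes \<open>g\<close> meaningful when there is no other pole.\<close>
  define g where "g = Min (insert 1 ((\<lambda>p. dist (t0 $ j) (t0 $ p)) ` (- {j})))"
  have "t0 \<in> distinct_coords" using D by auto
  then have g: "g > 0" "\<And>p. p \<noteq> j \<Longrightarrow> g \<le> dist (t0 $ j) (t0 $ p)"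
    by (auto simp: g_def distinct_coords_def simp del: Min_insert intro!: Min_le)
  obtain c where c: "c > 0" "\<And>m X. m \<ge> 1 \<Longrightarrow> c * norm X \<le> norm (sylv (of_nat m) (Q j t0) X)"
    using sylv_lower_bound [OF nr] by auto
  define q where "q = (\<Sum>p\<in>UNIV. norm (Q p t0)) + 1"
  have q: "q \<ge> 0" by (simp add: q_def add_nonneg_nonneg sum_nonneg)
  note QD = joint_hol_vec [OF Q]
  obtain \<delta>1 where \<delta>1: "\<delta>1 > 0" "\<And>t. t \<in> polydisc t0 \<delta>1 \<Longrightarrow> t \<in> D \<and> norm (Q j t0 - Q j t) < c / 4 \<and> (\<forall>p. norm (Q p t0 - Q p t) < 1)"
  proof -
    have "eventually (\<lambda>t. t \<in> D) (nhds t0)"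
      using D by (auto simp: eventually_nhds)
    moreover have "eventually (\<lambda>t. norm (Q j t0 - Q j t) < c / 4) (nhds t0)"
      using D c by (intro eventually_near [OF joint_hol_continuous_on [OF QD]]) auto
    moreover have "eventually (\<lambda>t. \<forall>p. norm (Q p t0 - Q p t) < 1) (nhds t0)"
      using D by (intro eventually_all_finite eventually_near [OF joint_hol_continuous_on [OF QD]]) auto
    ultimately have "eventually (\<lambda>t. t \<in> D \<and> norm (Q j t0 - Q j t) < c / 4 \<and> (\<forall>p. norm (Q p t0 - Q p t) < 1)) (nhds t0)"
      by (intro eventually_conj)
    then show ?thesis using eventually_polydisc that by blast
  qed
  \<comment> \<open>Each of two poles moves by less than \<open>g / 4\<close>, so their distance
    stays at least \<open>g / 2\<close> and its reciprocal is bounded by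
    \<open>2 / g\<close>.\<close>
  define \<delta> where "\<delta> = min \<delta>1 (g / 4)"
  have \<delta>: "\<delta> > 0" using \<delta>1 g by (simp add: \<delta>_def)
  let ?T = "polydisc t0 \<delta>"
  have T1: "t \<in> D" "norm (Q j t0 - Q j t) < c / 4" "norm (Q p t0 - Q p t) < 1" if "t \<in> ?T" for t p
    using \<delta>1(2) [of t] polydisc_mono [of \<delta> \<delta>1 t0] that by (auto simp: \<delta>_def)
  then have TD: "?T \<subseteq> D" by auto
  have sep: "g / 2 \<le> dist (t $ j) (t $ p)" if "t \<in> ?T" "p \<noteq> j" for t p
  proof -
    have "dist (t0 $ j) (t $ j) < g / 4" "dist (t0 $ p) (t $ p) < g / 4"
      using that by (auto simp: polydisc_def \<delta>_def)
    moreover have "dist (t0 $ j) (t0 $ p) \<le> dist (t0 $ j) (t $ j) + dist (t $ j) (t $ p) + dist (t0 $ p) (t $ p)"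
      using dist_triangle [of "t0 $ j" "t0 $ p" "t $ j"] dist_triangle2 [of "t $ j" "t0 $ p" "t $ p"] by linarith
    ultimately show ?thesis using g(2) [OF that(2)] by linarith
  qed
  define e where "e p t = 1 / (t $ j - t $ p)" for p and t :: "complex ^ 'n"
  obtain r where r: "r > 0" and loc:
    "\<And>(T :: (complex ^ 'n) set) I e (P0 :: _ \<Rightarrow> complex ^ 'k ^ 'k) Q.
       local_data T I e P0 Q (2 / g) q (c / 2) \<Longrightarrow> \<exists>G. local_solution T I e P0 Q r G"
    using local_fuchsian_solution [of "2 / g" q "c / 2"] g q c by auto
  have "local_data ?T (- {j}) e (Q j) Q (2 / g) q (c / 2)"
    unfolding local_data_def
  proof (intro conjI ballI allI impI)
    show "chol (\<lambda>w. e p (snd w)) (UNIV \<times> ?T)" for p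
    proof (cases "p = j")
      case True
      then show ?thesis by (simp add: e_def)
    next
      case False
      show ?thesis unfolding e_def
        by (intro chol_divide chol_diff chol_const chol_coord) (use sep [OF _ False] g in force)
    qed
    show "joint_holomorphic_on (\<lambda>w. Q p (snd w)) (UNIV \<times> ?T)" for p
      by (rule joint_hol_subset [OF QD]) (use TD in auto)
    show "joint_holomorphic_on (\<lambda>w. Q j (snd w)) (UNIV \<times> ?T)"
      by (rule joint_hol_subset [OF QD]) (use TD in auto)
    show "cmod (e p t) \<le> 2 / g" if "t \<in> ?T" "p \<in> - {j}" for p t
    proof -
      have "g / 2 \<le> cmod (t $ j - t $ p)" using sep [OF that(1), of p] that by (simp add: dist_norm)
      then have "1 / cmod (t $ j - t $ p) \<le> 1 / (g / 2)"
        using g(1) by (intro divide_left_mono mult_pos_pos) auto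
      then show ?thesis by (simp add: e_def norm_divide)
    qed
    show "norm (Q p t) \<le> q" if "t \<in> ?T" for p t
    proof -
      have "norm (Q p t) \<le> norm (Q p t0) + norm (Q p t0 - Q p t)"
        by (metis norm_minus_commute norm_triangle_sub)
      moreover have "norm (Q p t0) \<le> (\<Sum>p\<in>UNIV. norm (Q p t0))"
        by (rule member_le_sum) auto
      ultimately show ?thesis using T1(3) [OF that, of p] by (simp add: q_def)
    qed
    show "c / 2 * norm X \<le> norm (sylv (of_nat m) (Q j t) X)" if "t \<in> ?T" "1 \<le> m" for t m X
      by (rule sylv_lower_bound_perturb [OF c(2)]) (use T1(2) [OF that(1)] that in auto)
  qed (rule open_polydisc)
  then obtain G0 where "local_solution ?T (- {j}) e (Q j) Q r G0" using loc by blast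
  then have G0: "joint_holomorphic_on G0 (ball 0 r \<times> ?T)"
    "\<And>t x. t \<in> ?T \<Longrightarrow> x \<in> ball 0 r \<Longrightarrow> invertible (G0 (x, t)) \<and> (\<forall>p\<in>-{j}. 1 + e p t * x \<noteq> 0) \<and>
      (\<exists>G'. mat_deriv (\<lambda>x. G0 (x, t)) G' x \<and>
         mat_scale x G' = (Q j t + mat_scale x (local_coef (- {j}) e Q t x)) ** G0 (x, t) - G0 (x, t) ** Q j t)"
    unfolding local_solution_def by blast+
  \<comment> \<open>\<open>r\<close> is the radius of the series, and \<open>g / 2\<close> is at
    most the half gap at \<open>t0\<close>.\<close>
  define \<rho> where "\<rho> = min r (g / 2)"
  have \<rho>: "\<rho> > 0" "\<rho> \<le> r" using r g by (auto simp: \<rho>_def)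
  have gap: "ereal \<rho> \<le> half_gap t0 j"
    unfolding half_gap_def
  proof (rule INF_greatest)
    fix p assume "p \<in> {p. p \<noteq> j}"
    then show "ereal \<rho> \<le> ereal (dist (t0 $ j) (t0 $ p) / 2)"
      using g(2) [of p] by (simp add: \<rho>_def min_def)
  qed
  define G where "G w = G0 (fst w - snd w $ j, snd w)" for w
  have "joint_holomorphic_on G {(x, t). t \<in> ?T \<and> x \<in> ball (t $ j) \<rho>}"
    unfolding G_def by (rule joint_hol_compose_Pair [OF G0(1)])
      (use \<rho> in \<open>auto intro!: chol_diff simp: dist_norm norm_minus_commute\<close>)
  moreover have "invertible (G (x, t)) \<and>
        (x \<noteq> t $ j \<longrightarrow> (\<forall>p. x \<noteq> t $ p) \<and>
           mat_deriv (\<lambda>x. G (x, t)) (fuchsian_coeff Q t x ** G (x, t) - mat_scale (1 / (x - t $ j)) (G (x, t) ** Q j t)) x)"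
    if t: "t \<in> ?T" and x: "x \<in> ball (t $ j) \<rho>" for t x
  proof (intro conjI impI)
    define y where "y = x - t $ j"
    have y: "y \<in> ball 0 r" using x \<rho> by (simp add: y_def dist_norm norm_minus_commute)
    note Gy = G0(2) [OF t y]
    show "invertible (G (x, t))" using Gy by (simp add: G_def y_def)
    assume ne: "x \<noteq> t $ j"
    then have y0: "y \<noteq> 0" by (simp add: y_def)
    have ep: "(t $ j - t $ p) * (1 + e p t * y) = x - t $ p" "t $ j \<noteq> t $ p" if "p \<noteq> j" for p
    proof -
      show ne: "t $ j \<noteq> t $ p" using sep [OF t that] g by auto
      show "(t $ j - t $ p) * (1 + e p t * y) = x - t $ p"
        using ne by (simp add: e_def y_def distrib_left)
    qed
    have xp: "x \<noteq> t $ p" for p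
    proof (cases "p = j")
      case False
      have "1 + e p t * y \<noteq> 0" using Gy False by blast
      then show ?thesis using ep [OF False] by (metis mult_eq_0_iff right_minus_eq)
    qed (use ne in simp)
    then show "\<forall>p. x \<noteq> t $ p" by blast
    have frac: "e p t / (1 + e p t * y) = 1 / (x - t $ p)" if "p \<noteq> j" for p
      unfolding ep(1) [OF that, symmetric] by (simp add: e_def)
    have "fuchsian_coeff Q t x = mat_scale (1 / y) (Q j t) + (\<Sum>p\<in>-{j}. mat_scale (1 / (x - t $ p)) (Q p t))"
      unfolding fuchsian_coeff_def y_def by (subst sum.remove [of _ j]) (auto simp: Compl_eq_Diff_UNIV)
    also have "(\<Sum>p\<in>-{j}. mat_scale (1 / (x - t $ p)) (Q p t)) = local_coef (- {j}) e Q t y"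
      unfolding local_coef_def by (intro sum.cong refl) (simp add: frac)
    finally have B: "mat_scale y (fuchsian_coeff Q t x) = Q j t + mat_scale y (local_coef (- {j}) e Q t y)"
      using y0 by (simp add: mat_scale_add_right)
    obtain G' where G': "mat_deriv (\<lambda>x. G0 (x, t)) G' y"
      "mat_scale y G' = mat_scale y (fuchsian_coeff Q t x) ** G0 (y, t) - G0 (y, t) ** Q j t"
      using Gy unfolding B by blast
    have "G' = mat_scale (1 / y) (mat_scale y G')" using y0 by simp
    also have "\<dots> = fuchsian_coeff Q t x ** G0 (y, t) - mat_scale (1 / y) (G0 (y, t) ** Q j t)"
      unfolding G'(2) using y0 by (simp add: mat_algebra)
    finally show "mat_deriv (\<lambda>x. G (x, t)) (fuchsian_coeff Q t x ** G (x, t) - mat_scale (1 / (x - t $ j)) (G (x, t) ** Q j t)) x"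
      using mat_deriv_chain_diff [of "\<lambda>x. G0 (x, t)" G' x "t $ j"] G'(1) by (simp add: G_def y_def)
  qed
  ultimately show ?thesis
    using \<rho>(1) \<delta> gap TD by blast
qed

section \<open>Continuation from the base point\<close>

text \<open>Real lines are negligible sets and a nonempty open set is not.\<close>

lemma exists_point_off_lines:
  fixes v :: "'i \<Rightarrow> complex"
  assumes "finite I" "\<And>p. p \<in> I \<Longrightarrow> v p \<noteq> 0" "open S" "S \<noteq> {}"
  shows "\<exists>x\<in>S. \<forall>p\<in>I. \<forall>s::real. x \<noteq> a + of_real s * v p"
proof -
  \<comment> \<open>\<open>\<i> * v p\<close> is orthogonal to \<open>v p\<close> over the reals, so
    this is the line through \<open>a\<close> in direction \<open>v p\<close>.\<close>
  define L where "L p = {x. (\<i> * v p) \<bullet> x = (\<i> * v p) \<bullet> a}" for p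
  have "negligible (\<Union>p\<in>I. L p)"
    using assms(1,2) unfolding L_def by (intro negligible_Union) (auto intro!: negligible_hyperplane)
  moreover have "\<not> negligible S"
    by (rule open_not_negligible [OF assms(3,4)])
  ultimately have "\<not> S \<subseteq> (\<Union>p\<in>I. L p)"
    using negligible_subset by blast
  then obtain x where x: "x \<in> S" "x \<notin> (\<Union>p\<in>I. L p)"
    by blast
  have on_line: "a + of_real s * v p \<in> L p" for s p
  proof -
    have "(\<i> * v p) \<bullet> v p = 0" by (simp add: inner_complex_def)
    then show ?thesis
      by (simp add: L_def inner_add_right flip: scaleR_conv_of_real)
  qed
  show ?thesis
  proof (intro bexI [of _ x] ballI allI notI)
    fix p and s :: real assume "p \<in> I" and eq: "x = a + of_real s * v p"
    then have "x \<in> (\<Union>p\<in>I. L p)" using on_line [of s p] unfolding eq by (intro UN_I)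
    with x(2) show False by contradiction
  qed (rule x(1))
qed

text \<open>At \<open>t0\<close> compactness of the segment bounds the denominators below by some
  \<open>m\<close>; nearby they stay above \<open>m / 2\<close>. The last clause, on the
  denominators at \<open>t0\<close>, becomes the distance that the path must keep from the
  poles.\<close>

lemma segment_ode_near:
  fixes Q :: "'n::finite \<Rightarrow> complex ^ 'n \<Rightarrow> complex ^ 'k::finite ^ 'k"
  assumes D: "open D" "t0 \<in> D" and d: "\<And>p. chol (\<lambda>w. d p (snd w)) (UNIV \<times> D)"
    and b: "\<And>p. chol (\<lambda>w. b p (snd w)) (UNIV \<times> D)"
    and Q: "\<And>p. joint_holomorphic_on (\<lambda>w. Q p (snd w)) (UNIV \<times> D)"
    and nz: "\<And>p s. s \<in> {0..1} \<Longrightarrow> b p t0 + d p t0 * of_real s \<noteq> 0"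
  shows "\<exists>\<delta>>0. \<exists>\<kappa>0 q. polydisc t0 \<delta> \<subseteq> D \<and> segment_ode d b Q (polydisc t0 \<delta>) \<kappa>0 q \<and>
    (\<forall>p. \<forall>s\<in>{0..1}. \<delta> < cmod (b p t0 + d p t0 * of_real s))"
proof -
  have "\<exists>m>0. \<forall>s\<in>{0..1}. m \<le> cmod (b p t0 + d p t0 * of_real s)" for p
  proof -
    have cont: "continuous_on {0..1} (\<lambda>s::real. cmod (b p t0 + d p t0 * of_real s))"
      by (intro continuous_intros)
    obtain s where "s \<in> {0..1}" "\<forall>s'\<in>{0..1}. cmod (b p t0 + d p t0 * of_real s) \<le> cmod (b p t0 + d p t0 * of_real s')"
      using continuous_attains_inf [OF compact_Icc _ cont] by auto
    then show ?thesis
      using nz by (intro exI [of _ "cmod (b p t0 + d p t0 * of_real s)"]) auto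
  qed
  then obtain m' where m': "\<And>p. m' p > 0" "\<And>p s. s \<in> {0..1} \<Longrightarrow> m' p \<le> cmod (b p t0 + d p t0 * of_real s)"
    by metis
  define m where "m = Min (range m')"
  have m: "m > 0" "\<And>p s. s \<in> {0..1} \<Longrightarrow> m \<le> cmod (b p t0 + d p t0 * of_real s)"
  proof -
    show "m > 0" using m'(1) by (simp add: m_def)
    have "m \<le> m' p" for p by (simp add: m_def)
    then show "m \<le> cmod (b p t0 + d p t0 * of_real s)" if "s \<in> {0..1}" for p s
      using m'(2) [OF that] order_trans by blast
  qed
  define M where "M = (\<Sum>p\<in>UNIV. cmod (d p t0)) + m"
  define q where "q = (\<Sum>p\<in>UNIV. norm (Q p t0)) + 1"
  have M: "M > 0" and q: "q \<ge> 0"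
    using m by (simp_all add: M_def q_def add_nonneg_pos add_nonneg_nonneg sum_nonneg)
  have "eventually (\<lambda>t. t \<in> D) (nhds t0)"
    using D by (auto simp: eventually_nhds)
  moreover have "eventually (\<lambda>t. \<forall>p. cmod (d p t0 - d p t) < m / 4) (nhds t0)"
    using D m by (intro eventually_all_finite eventually_near [OF chol_continuous_on [OF d]]) auto
  moreover have "eventually (\<lambda>t. \<forall>p. cmod (b p t0 - b p t) < m / 4) (nhds t0)"
    using D m by (intro eventually_all_finite eventually_near [OF chol_continuous_on [OF b]]) auto
  moreover have "eventually (\<lambda>t. \<forall>p. norm (Q p t0 - Q p t) < 1) (nhds t0)"
    using D by (intro eventually_all_finite eventually_near [OF joint_hol_continuous_on [OF Q]]) auto
  ultimately have "eventually (\<lambda>t. t \<in> D \<and> (\<forall>p. cmod (d p t0 - d p t) < m / 4) \<and>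
      (\<forall>p. cmod (b p t0 - b p t) < m / 4) \<and> (\<forall>p. norm (Q p t0 - Q p t) < 1)) (nhds t0)"
    by (intro eventually_conj)
  then obtain \<delta>1 where \<delta>1: "\<delta>1 > 0" "\<And>t. t \<in> polydisc t0 \<delta>1 \<Longrightarrow> t \<in> D \<and> (\<forall>p. cmod (d p t0 - d p t) < m / 4) \<and>
      (\<forall>p. cmod (b p t0 - b p t) < m / 4) \<and> (\<forall>p. norm (Q p t0 - Q p t) < 1)"
    using eventually_polydisc by blast
  define \<delta> where "\<delta> = min \<delta>1 (m / 2)"
  have \<delta>: "\<delta> > 0" "\<delta> < m" using \<delta>1 m by (auto simp: \<delta>_def)
  have near: "t \<in> D" "cmod (d p t0 - d p t) < m / 4" "cmod (b p t0 - b p t) < m / 4" "norm (Q p t0 - Q p t) < 1"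
    if "t \<in> polydisc t0 \<delta>" for t p
    using \<delta>1(2) [of t] polydisc_mono [of \<delta> \<delta>1 t0] that by (auto simp: \<delta>_def)
  have sub: "polydisc t0 \<delta> \<subseteq> D" using near by auto
  have lower: "m / 2 \<le> cmod (b p t + d p t * of_real s)" if t: "t \<in> polydisc t0 \<delta>" and s: "s \<in> {0..1}" for p t s
  proof -
    have "b p t0 + d p t0 * of_real s = (b p t + d p t * of_real s) + ((b p t0 - b p t) + (d p t0 - d p t) * of_real s)"
      by (simp add: algebra_simps)
    then have "cmod (b p t0 + d p t0 * of_real s) \<le> cmod (b p t + d p t * of_real s) +
        cmod ((b p t0 - b p t) + (d p t0 - d p t) * of_real s)"
      by (metis norm_triangle_ineq)
    moreover have "cmod ((b p t0 - b p t) + (d p t0 - d p t) * of_real s) \<le> cmod (b p t0 - b p t) + cmod ((d p t0 - d p t) * of_real s)"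
      by (rule norm_triangle_ineq)
    moreover have "cmod ((d p t0 - d p t) * of_real s) \<le> cmod (d p t0 - d p t) * 1"
      unfolding norm_mult using s by (intro mult_left_mono) auto
    ultimately show ?thesis
      using m(2) [OF s, of p] near(2,3) [OF t, of p] by linarith
  qed
  have "segment_ode d b Q (polydisc t0 \<delta>) (2 * M / m) q"
  proof
    show "chol (\<lambda>w. d p (snd w)) (UNIV \<times> polydisc t0 \<delta>)" "chol (\<lambda>w. b p (snd w)) (UNIV \<times> polydisc t0 \<delta>)"
      "joint_holomorphic_on (\<lambda>w. Q p (snd w)) (UNIV \<times> polydisc t0 \<delta>)" for p
      using sub by (auto intro!: chol_subset [OF d] chol_subset [OF b] joint_hol_subset [OF Q])
    show "norm (Q p t) \<le> q" if "t \<in> polydisc t0 \<delta>" for p t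
    proof -
      have "norm (Q p t) \<le> norm (Q p t0) + norm (Q p t0 - Q p t)"
        by (metis norm_minus_commute norm_triangle_sub)
      moreover have "norm (Q p t0) \<le> (\<Sum>p\<in>UNIV. norm (Q p t0))"
        by (rule member_le_sum) auto
      ultimately show ?thesis using near(4) [OF that, of p] by (simp add: q_def)
    qed
    fix p t and s :: real assume t: "t \<in> polydisc t0 \<delta>" and s: "s \<in> {0..1}"
    show "b p t + d p t * of_real s \<noteq> 0"
      using lower [OF t s, of p] m by auto
    have "cmod (d p t) \<le> cmod (d p t0) + cmod (d p t0 - d p t)"
      by (metis norm_minus_commute norm_triangle_sub)
    moreover have "cmod (d p t0) \<le> (\<Sum>p\<in>UNIV. cmod (d p t0))"
      by (rule member_le_sum) auto
    ultimately have "cmod (d p t) \<le> M"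
      using near(2) [OF t, of p] m by (simp add: M_def)
    also have "M = 2 * M / m * (m / 2)" using m by simp
    also have "\<dots> \<le> 2 * M / m * cmod (b p t + d p t * of_real s)"
      using lower [OF t s, of p] M m by (intro mult_left_mono) auto
    finally show "cmod (d p t) \<le> 2 * M / m * cmod (b p t + d p t * of_real s)" .
  qed (use open_polydisc q M m in auto)
  moreover have "\<delta> < cmod (b p t0 + d p t0 * of_real s)" if "s \<in> {0..1}" for p s
    using m(2) [OF that, of p] \<delta> by linarith
  ultimately show ?thesis using \<delta>(1) sub by blast
qed

text \<open>Since \<open>U\<close> contains the whole path and does not depend on \<open>t\<close>,
  the solution is continued along \<open>\<alpha>\<close> by a constant family of elements.
  Dependence on \<open>t\<close> is recorded at the end point \<open>xj\<close>, where the solution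
  is matched with the Frobenius series.\<close>

definition start_element where
  "start_element D Q x0 t0 xj \<delta> U Y \<alpha> \<longleftrightarrow> \<delta> > 0 \<and> polydisc t0 \<delta> \<subseteq> D \<and>
     pathin riemann_sphere \<alpha> \<and> \<alpha> 0 = x0 \<and> \<alpha> 1 = Some xj \<and>
     (\<forall>s\<in>{0..1}. \<alpha> s \<in> U \<and> (\<forall>z p. \<alpha> s = Some z \<longrightarrow> \<delta> < cmod (z - t0 $ p))) \<and>
     (\<forall>t\<in>polydisc t0 \<delta>. solves_fuchsian_on Q t (\<lambda>z. Y (z, t)) U \<and> Y (x0, t) = mat 1 \<and> (\<forall>z\<in>U. invertible (Y (z, t)))) \<and>
     joint_holomorphic_on (\<lambda>w. Y (Some xj, snd w)) (UNIV \<times> polydisc t0 \<delta>)"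

lemma mat_deriv_holomorphic:
  assumes "\<And>x. x \<in> S \<Longrightarrow> \<exists>F'. mat_deriv F F' x"
  shows "(\<lambda>x. F x $ i $ j) holomorphic_on S"
  using assms unfolding mat_deriv_def holomorphic_on_def field_differentiable_def
  by (meson has_field_derivative_at_within)

text \<open>In the coordinate \<open>w = (x - a) / e\<close> the path is the unit interval and
  \<open>b p t + d p t * w = x - t $ p\<close>. No denominator vanishes on it at \<open>t0\<close>,
  since \<open>xj\<close> is off the lines through \<open>a\<close> and the poles.\<close>

lemma start_element_finite:
  fixes Q :: "'n::finite \<Rightarrow> complex ^ 'n \<Rightarrow> complex ^ 'k::finite ^ 'k"
  assumes D: "open D" "t0 \<in> D" and Q: "\<And>p. vec_holomorphic_on (Q p) D"
    and a: "\<And>p. a \<noteq> t0 $ p" and S: "open S" "S \<noteq> {}"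
  shows "\<exists>xj\<in>S. \<exists>\<delta> U Y \<alpha>. start_element D Q (Some a) t0 xj \<delta> U Y \<alpha>"
proof -
  obtain xj where xj: "xj \<in> S" "\<And>p s. xj \<noteq> a + of_real s * (t0 $ p - a)"
    using exists_point_off_lines [of UNIV "\<lambda>p. t0 $ p - a" S a] a S by (metis UNIV_I finite right_minus_eq)
  define e where "e = xj - a"
  have e: "e \<noteq> 0" using xj(2) [of 0] by (simp add: e_def)
  define d where "d p t = e" for p :: 'n and t :: "complex ^ 'n"
  define b where "b p t = a - t $ p" for p and t :: "complex ^ 'n"
  have nz: "b p t0 + d p t0 * of_real s \<noteq> 0" for p and s :: real
  proof
    assume eq: "b p t0 + d p t0 * of_real s = 0"
    have "s \<noteq> 0" using eq a [of p] by (auto simp: b_def)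
    then have "xj = a + of_real (1 / s) * (t0 $ p - a)"
      using eq by (simp add: b_def d_def e_def field_simps)
    then show False using xj(2) by blast
  qed
  have "chol (\<lambda>w. d p (snd w)) (UNIV \<times> D)" "chol (\<lambda>w. b p (snd w)) (UNIV \<times> D)" for p
    unfolding d_def b_def by (auto intro!: chol_diff)
  from segment_ode_near [where d = d and b = b and Q = Q, OF D this joint_hol_vec [OF Q] nz]
  obtain \<delta> \<kappa>0 q where \<delta>: "\<delta> > 0" "polydisc t0 \<delta> \<subseteq> D" and ode: "segment_ode d b Q (polydisc t0 \<delta>) \<kappa>0 q"
    and m: "\<And>p s. s \<in> {0..1} \<Longrightarrow> \<delta> < cmod (b p t0 + d p t0 * of_real s)"
    by blast
  interpret segment_ode d b Q "polydisc t0 \<delta>" \<kappa>0 q by (rule ode)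
  obtain W Y where W: "of_real ` {0..1} \<subseteq> W" and Y: "sol_on Y W" "\<And>t. t \<in> polydisc t0 \<delta> \<Longrightarrow> Y (0, t) = mat 1"
    using segment_solution by blast
  have oW: "open W" using Y(1) by (simp add: sol_on_def)
  have W01: "0 \<in> W" "1 \<in> W" using W by (auto simp: image_subset_iff dest: bspec [of _ _ 0] bspec [of _ _ 1])
  define V where "V = {x. (x - a) / e \<in> W}"
  have oV: "open V"
  proof -
    have "open ((\<lambda>x. (x - a) / e) -` W)"
      by (rule open_vimage [OF oW]) (use e in \<open>auto intro!: continuous_intros\<close>)
    then show ?thesis by (simp add: V_def vimage_def)
  qed
  define Z where "Z w = (case fst w of None \<Rightarrow> 0 | Some x \<Rightarrow> Y ((x - a) / e, snd w))" for w
  have der: "mat_deriv (\<lambda>x. Z (Some x, t)) (fuchsian_coeff Q t x ** Z (Some x, t)) x"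
    and inv: "invertible (Z (Some x, t))" and av: "x \<noteq> t $ p"
    if t: "t \<in> polydisc t0 \<delta>" and x: "x \<in> V" for t x p
  proof -
    define w where "w = (x - a) / e"
    have w: "w \<in> W" using x by (simp add: V_def w_def)
    have bd: "b p t + d p t * w = x - t $ p" for p
      using e by (simp add: b_def d_def w_def)
    have sol: "invertible (Y (w, t))" "mat_deriv (\<lambda>x. Y (x, t)) (coef t w ** Y (w, t)) w" "b p t + d p t * w \<noteq> 0"
      using Y(1) t w unfolding sol_on_def by blast+
    show "invertible (Z (Some x, t))" using sol by (simp add: Z_def w_def)
    show "x \<noteq> t $ p" using sol(3) bd by auto
    have "((\<lambda>x. (x - a) / e) has_field_derivative 1 / e) (at x)"
      using e by (auto intro!: derivative_eq_intros)
    from mat_deriv_compose [of "\<lambda>x. Y (x, t)", OF _ this] sol(2)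
    have "mat_deriv (\<lambda>x. Y ((x - a) / e, t)) (mat_scale (1 / e) (coef t w ** Y (w, t))) x"
      by (simp add: w_def)
    moreover have "mat_scale (1 / e) (coef t w) = fuchsian_coeff Q t x"
      unfolding coef_def fuchsian_coeff_def mat_scale_sum using e by (simp add: bd) (simp add: d_def)
    ultimately show "mat_deriv (\<lambda>x. Z (Some x, t)) (fuchsian_coeff Q t x ** Z (Some x, t)) x"
      by (simp add: Z_def w_def mat_scale_mult_left [symmetric])
  qed
  have "solves_fuchsian_on Q t (\<lambda>z. Z (z, t)) (Some ` V)" if t: "t \<in> polydisc t0 \<delta>" for t
    unfolding solves_fuchsian_on_def
  proof (intro conjI allI impI)
    show "sphere_holomorphic_on (\<lambda>z. Z (z, t)) (Some ` V)"
      by (rule sphere_holomorphic_Some [OF oV], rule mat_deriv_holomorphic) (use der [OF t] in blast)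
    show "Some (t $ p) \<notin> Some ` V" for p using av [OF t] by blast
    show "((\<lambda>z. Z (Some z, t) $ i $ j) has_field_derivative (fuchsian_coeff Q t x ** Z (Some x, t)) $ i $ j) (at x)"
      if "Some x \<in> Some ` V" for x i j
      using der [OF t, of x] that by (auto simp: mat_deriv_def)
  qed
  moreover have "Z (Some a, t) = mat 1" if "t \<in> polydisc t0 \<delta>" for t
    using Y(2) [OF that] by (simp add: Z_def)
  moreover have "joint_holomorphic_on (\<lambda>w. Z (Some xj, snd w)) (UNIV \<times> polydisc t0 \<delta>)"
  proof -
    have "joint_holomorphic_on Y (W \<times> polydisc t0 \<delta>)" using Y(1) by (simp add: sol_on_def)
    from joint_hol_fix_fst [OF this W01(2)] show ?thesis
      using e by (simp add: Z_def e_def)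
  qed
  moreover have "pathin riemann_sphere (\<lambda>s. Some (a + of_real s * e))"
    using pathin_Some [of "\<lambda>s. a + of_real s * e"] by (simp add: path_def o_def continuous_intros)
  moreover have "Some (a + of_real s * e) \<in> Some ` V \<and> (\<forall>z p. Some (a + of_real s * e) = Some z \<longrightarrow> \<delta> < cmod (z - t0 $ p))"
    if s: "s \<in> {0..1}" for s :: real
  proof -
    have "of_real s \<in> W" using W s by auto
    then show ?thesis
      using m [OF s] e by (auto simp: V_def b_def d_def algebra_simps)
  qed
  ultimately have "start_element D Q (Some a) t0 xj \<delta> (Some ` V) Z (\<lambda>s. Some (a + of_real s * e))"
    unfolding start_element_def using \<delta> inv by (auto simp: e_def)
  with xj(1) show ?thesis by blast
qed

text \<open>In the coordinate \<open>w = c / (x - b)\<close> the equation becomes \<open>dY/dw = (\<Sum>p. (b - t\<^sub>p) / (c + (b - t\<^sub>p) w) Q\<^sub>p) Y\<close>,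
  because \<open>\<Sum>p. Q\<^sub>p = 0\<close> removes the pole at \<open>w = 0\<close>.\<close>

lemma start_element_infinite:
  fixes Q :: "'n::finite \<Rightarrow> complex ^ 'n \<Rightarrow> complex ^ 'k::finite ^ 'k"
  assumes D: "open D" "t0 \<in> D" "D \<subseteq> distinct_coords" and Q: "\<And>p. vec_holomorphic_on (Q p) D"
    and sumQ: "\<And>t. t \<in> D \<Longrightarrow> (\<Sum>p\<in>UNIV. Q p t) = 0" and S: "open S" "S \<noteq> {}"
  shows "\<exists>xj\<in>S. \<exists>\<delta> U Y \<alpha>. start_element D Q None t0 xj \<delta> U Y \<alpha>"
proof -
  \<comment> \<open>Any pole will do as the centre \<open>b0\<close>. Distinctness makes the
    directions to the others nonzero; its own denominator at \<open>t0\<close> is the constant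
    \<open>c\<close>, so it excludes just the point \<open>b0\<close> and no line.\<close>
  define j :: 'n where "j = undefined"
  define b0 where "b0 = t0 $ j"
  have "t0 \<in> distinct_coords" using D by auto
  then have ne: "t0 $ p - b0 \<noteq> 0" if "p \<noteq> j" for p
    using that by (auto simp: b0_def distinct_coords_def)
  obtain xj where xj: "xj \<in> S - {b0}" "\<And>p s. p \<noteq> j \<Longrightarrow> xj \<noteq> b0 + of_real s * (t0 $ p - b0)"
  proof -
    have "S - {b0} \<noteq> {}"
    proof
      assume "S - {b0} = {}"
      then have "S = {b0}" using S by auto
      then show False using S(1) not_open_singleton by metis
    qed
    moreover have "open (S - {b0})" using S by (simp add: open_delete)
    ultimately have "\<exists>x\<in>S - {b0}. \<forall>p\<in>- {j}. \<forall>s::real. x \<noteq> b0 + of_real s * (t0 $ p - b0)"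
      using ne by (intro exists_point_off_lines) auto
    then show ?thesis using that by auto
  qed
  define c where "c = xj - b0"
  have c: "c \<noteq> 0" using xj(1) by (simp add: c_def)
  define d where "d p t = b0 - t $ p" for p and t :: "complex ^ 'n"
  define b where "b p t = c" for p :: 'n and t :: "complex ^ 'n"
  have nz: "b p t0 + d p t0 * of_real s \<noteq> 0" for p and s :: real
  proof
    assume eq: "b p t0 + d p t0 * of_real s = 0"
    then have pj: "p \<noteq> j" using c by (auto simp: b_def d_def b0_def)
    have "xj = b0 + of_real s * (t0 $ p - b0)"
      using eq by (simp add: b_def d_def c_def algebra_simps)
    then show False using xj(2) [OF pj] by blast
  qed
  have "chol (\<lambda>w. d p (snd w)) (UNIV \<times> D)" "chol (\<lambda>w. b p (snd w)) (UNIV \<times> D)" for p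
    unfolding d_def b_def by (auto intro!: chol_diff)
  from segment_ode_near [where d = d and b = b and Q = Q, OF D(1,2) this joint_hol_vec [OF Q] nz]
  obtain \<delta> \<kappa>0 q where \<delta>: "\<delta> > 0" "polydisc t0 \<delta> \<subseteq> D" and ode: "segment_ode d b Q (polydisc t0 \<delta>) \<kappa>0 q"
    and m: "\<And>p s. s \<in> {0..1} \<Longrightarrow> \<delta> < cmod (b p t0 + d p t0 * of_real s)"
    by blast
  interpret segment_ode d b Q "polydisc t0 \<delta>" \<kappa>0 q by (rule ode)
  obtain W Y where W: "of_real ` {0..1} \<subseteq> W" and Y: "sol_on Y W" "\<And>t. t \<in> polydisc t0 \<delta> \<Longrightarrow> Y (0, t) = mat 1"
    using segment_solution by blast
  have oW: "open W" using Y(1) by (simp add: sol_on_def)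
  have W01: "0 \<in> W" "1 \<in> W" using W by (auto simp: image_subset_iff dest: bspec [of _ _ 0] bspec [of _ _ 1])
  define U where "U = moebius_chart b0 c ` W"
  have SU: "Some x \<in> U \<longleftrightarrow> x \<noteq> b0 \<and> c / (x - b0) \<in> W" for x
  proof
    assume "Some x \<in> U"
    then obtain w where "w \<in> W" "w \<noteq> 0" "x = b0 + c / w"
      by (auto simp: U_def moebius_chart_def split: if_splits)
    then show "x \<noteq> b0 \<and> c / (x - b0) \<in> W" using c by simp
  next
    assume "x \<noteq> b0 \<and> c / (x - b0) \<in> W"
    then show "Some x \<in> U"
      using c unfolding U_def by (intro image_eqI [of _ _ "c / (x - b0)"]) (auto simp: moebius_chart_def)
  qed
  define Z where "Z w = (case fst w of None \<Rightarrow> Y (0, snd w) | Some x \<Rightarrow> Y (c / (x - b0), snd w))" for w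
  have Yd: "invertible (Y (w, t))" "mat_deriv (\<lambda>x. Y (x, t)) (coef t w ** Y (w, t)) w" "b p t + d p t * w \<noteq> 0"
    if "t \<in> polydisc t0 \<delta>" "w \<in> W" for t w p
    using Y(1) that unfolding sol_on_def by blast+
  have der: "mat_deriv (\<lambda>x. Z (Some x, t)) (fuchsian_coeff Q t x ** Z (Some x, t)) x"
    and av: "x \<noteq> t $ p"
    if t: "t \<in> polydisc t0 \<delta>" and x: "Some x \<in> U" for t x p
  proof -
    define w where "w = c / (x - b0)"
    have w: "w \<in> W" and xb: "x - b0 \<noteq> 0" using x by (simp_all add: SU w_def)
    have bd: "(x - b0) * (b p t + d p t * w) = c * (x - t $ p)" for p
      using xb by (simp add: b_def d_def w_def field_simps)
    have xt: "x \<noteq> t $ p" for p using Yd(3) [OF t w, of p] bd [of p] xb c by auto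
    then show "x \<noteq> t $ p" .
    have "((\<lambda>x. c / (x - b0)) has_field_derivative - c / (x - b0)\<^sup>2) (at x)"
      using xb by (auto intro!: derivative_eq_intros simp: power2_eq_square)
    from mat_deriv_compose [of "\<lambda>x. Y (x, t)", OF _ this] Yd(2) [OF t w]
    have "mat_deriv (\<lambda>x. Y (c / (x - b0), t)) (mat_scale (- c / (x - b0)\<^sup>2) (coef t w ** Y (w, t))) x"
      by (simp add: w_def)
    moreover have "mat_scale (- c / (x - b0)\<^sup>2) (coef t w) = fuchsian_coeff Q t x"
    proof -
      \<comment> \<open>Partial fractions, with the derivative of \<open>c / (x - b0)\<close> in
        front. The term \<open>1 / (x - b0)\<close> is the same for all \<open>p\<close> and
        disappears with the sum of the residues.\<close>
      have "- c / (x - b0)\<^sup>2 * (d p t / (b p t + d p t * w)) = 1 / (x - t $ p) - 1 / (x - b0)" for p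
      proof -
        have 1: "b p t + d p t * w = c * (x - t $ p) / (x - b0)"
          using bd [of p] xb by (simp add: eq_divide_eq mult.commute)
        have 2: "d p t = (x - t $ p) - (x - b0)" by (simp add: d_def)
        have 3: "- c / u\<^sup>2 * ((v - u) / (c * v / u)) = 1 / v - 1 / u" if "u \<noteq> 0" "v \<noteq> 0" for u v
          using that c by (simp add: field_simps power2_eq_square)
        show ?thesis
          unfolding 1 unfolding 2 by (rule 3) (use xb xt [of p] in auto)
      qed
      then have "mat_scale (- c / (x - b0)\<^sup>2) (coef t w) =
          (\<Sum>p\<in>UNIV. mat_scale (1 / (x - t $ p)) (Q p t)) - (\<Sum>p\<in>UNIV. mat_scale (1 / (x - b0)) (Q p t))"
        unfolding coef_def mat_scale_sum mat_scale_mat_scale sum_subtractf [symmetric]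
        by (simp add: mat_scale_diff_left)
      also have "(\<Sum>p\<in>UNIV. mat_scale (1 / (x - b0)) (Q p t)) = 0"
        unfolding mat_scale_sum [symmetric] using sumQ t \<delta>(2) by auto
      finally show ?thesis by (simp add: fuchsian_coeff_def)
    qed
    ultimately show "mat_deriv (\<lambda>x. Z (Some x, t)) (fuchsian_coeff Q t x ** Z (Some x, t)) x"
      by (simp add: Z_def w_def mat_scale_mult_left [symmetric])
  qed
  have inv: "invertible (Z (z, t))" if "t \<in> polydisc t0 \<delta>" "z \<in> U" for z t
    using Yd(1) [OF that(1)] W01 that(2) by (cases z) (auto simp: Z_def SU)
  have "solves_fuchsian_on Q t (\<lambda>z. Z (z, t)) U" if t: "t \<in> polydisc t0 \<delta>" for t
    unfolding solves_fuchsian_on_def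
  proof (intro conjI allI impI)
    show "sphere_holomorphic_on (\<lambda>z. Z (z, t)) U"
      unfolding sphere_holomorphic_on_def
    proof (intro conjI allI)
      show "openin riemann_sphere U"
        unfolding U_def by (rule openin_moebius_chart_image [OF c oW])
      show "(\<lambda>z. Z (Some z, t) $ i $ j) holomorphic_on {z. Some z \<in> U}" for i j
        by (rule mat_deriv_holomorphic) (use der [OF t] in blast)
      fix i j
      have hY: "(\<lambda>w. Y (w, t) $ i $ j) holomorphic_on W"
        by (rule mat_deriv_holomorphic) (use Yd(2) [OF t] in blast)
      \<comment> \<open>The passage from the standard coordinate \<open>1 / x\<close> at infinity to
        \<open>c / (x - b0)\<close>, which is regular at infinity.\<close>
      let ?g = "\<lambda>v. c * v / (1 - b0 * v)"
      have g: "1 - b0 * v \<noteq> 0 \<and> ?g v \<in> W \<and> Z (at_infinity_chart v, t) = Y (?g v, t)" if "at_infinity_chart v \<in> U" for v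
      proof (cases "v = 0")
        case True
        then show ?thesis using W01 by (simp add: Z_def at_infinity_chart_def)
      next
        case False
        then have v: "1 / v \<noteq> b0" "c / (1 / v - b0) \<in> W" using that by (simp_all add: at_infinity_chart_def SU)
        then have "1 - b0 * v \<noteq> 0" using False by (auto simp: field_simps)
        moreover have "c / (1 / v - b0) = ?g v"
          using False by (simp add: field_simps)
        ultimately show ?thesis using v False by (simp add: Z_def at_infinity_chart_def)
      qed
      have "((\<lambda>w. Y (w, t) $ i $ j) \<circ> ?g) holomorphic_on {v. at_infinity_chart v \<in> U}"
        by (intro holomorphic_on_compose holomorphic_on_subset [OF hY] holomorphic_intros) (use g in auto)
      then show "(\<lambda>w. Z (at_infinity_chart w, t) $ i $ j) holomorphic_on {w. at_infinity_chart w \<in> U}"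
        by (rule holomorphic_transform) (use g in auto)
    qed
    show "Some (t $ p) \<notin> U" for p using av [OF t] by blast
    show "((\<lambda>z. Z (Some z, t) $ i $ j) has_field_derivative (fuchsian_coeff Q t x ** Z (Some x, t)) $ i $ j) (at x)"
      if "Some x \<in> U" for x i j
      using der [OF t, of x] that by (auto simp: mat_deriv_def)
  qed
  moreover have "Z (None, t) = mat 1" if "t \<in> polydisc t0 \<delta>" for t
    using Y(2) [OF that] by (simp add: Z_def)
  moreover have "joint_holomorphic_on (\<lambda>w. Z (Some xj, snd w)) (UNIV \<times> polydisc t0 \<delta>)"
  proof -
    have "joint_holomorphic_on Y (W \<times> polydisc t0 \<delta>)" using Y(1) by (simp add: sol_on_def)
    from joint_hol_fix_fst [OF this W01(2)] show ?thesis
      using c by (simp add: Z_def c_def)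
  qed
  moreover have "pathin riemann_sphere (\<lambda>s. moebius_chart b0 c (of_real s))"
    unfolding pathin_def continuous_map_def
  proof (intro conjI allI impI)
    fix V assume V: "openin riemann_sphere V"
    have "openin (top_of_set {0..1}) ({0..1::real} \<inter> of_real -` {w. moebius_chart b0 c w \<in> V})"
      by (rule continuous_openin_preimage_gen [OF _ open_vimage_moebius_chart [OF c V]]) (auto intro!: continuous_intros)
    moreover have "{0..1::real} \<inter> of_real -` {w. moebius_chart b0 c w \<in> V} =
        {x \<in> topspace (top_of_set {0..1}). moebius_chart b0 c (of_real x) \<in> V}" by auto
    ultimately show "openin (top_of_set {0..1}) {x \<in> topspace (top_of_set {0..1}). moebius_chart b0 c (of_real x) \<in> V}"
      by simp
  qed auto
  moreover have "moebius_chart b0 c (of_real s) \<in> U \<and> (\<forall>z p. moebius_chart b0 c (of_real s) = Some z \<longrightarrow> \<delta> < cmod (z - t0 $ p))"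
    if s: "s \<in> {0..1}" for s :: real
  proof (intro conjI allI impI)
    have "complex_of_real s \<in> W" using W s by auto
    then show "moebius_chart b0 c (of_real s) \<in> U" unfolding U_def by (rule imageI)
    fix z p assume "moebius_chart b0 c (of_real s) = Some z"
    then have s0: "s \<noteq> 0" and z: "z = b0 + c / of_real s" by (auto simp: moebius_chart_def split: if_splits)
    have "(z - t0 $ p) * of_real s = b p t0 + d p t0 * of_real s"
      using s0 by (simp add: z b_def d_def algebra_simps)
    \<comment> \<open>The available bound is on the denominator, which is \<open>z - t0 $ p\<close>
      times \<open>s\<close>; since \<open>s \<le> 1\<close> it passes to the distance.\<close>
    then have "\<delta> < cmod (z - t0 $ p) * \<bar>s\<bar>"
      using m [OF s, of p] by (metis norm_mult norm_of_real)
    also have "\<dots> \<le> cmod (z - t0 $ p) * 1"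
      using s by (intro mult_left_mono) auto
    finally show "\<delta> < cmod (z - t0 $ p)" by simp
  qed
  ultimately have "start_element D Q None t0 xj \<delta> U Z (\<lambda>s. moebius_chart b0 c (of_real s))"
    unfolding start_element_def using \<delta> inv by (auto simp: c_def moebius_chart_def)
  with xj(1) show ?thesis by blast
qed

section \<open>Monodromy around a pole\<close>

lemma non_resonant_similar:
  fixes A K :: "complex ^ 'k ^ 'k"
  assumes "non_resonant A" "invertible K"
  shows "non_resonant (matrix_inv K ** A ** K)"
proof -
  have "is_eigenvalue A z" if ev: "is_eigenvalue (matrix_inv K ** A ** K) z" for z
  proof -
    obtain v where v: "v \<noteq> 0" "(matrix_inv K ** A ** K) *v v = z *s v"
      using ev by (auto simp: is_eigenvalue_def)
    have "A ** K = K ** (matrix_inv K ** A ** K)"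
      by (simp add: matrix_mul_assoc matrix_inv_works(1) [OF assms(2)])
    then have "A *v (K *v v) = K *v (z *s v)"
      by (metis v(2) matrix_vector_mul_assoc)
    then have "A *v (K *v v) = z *s (K *v v)"
      by (simp add: vector_scalar_commute)
    moreover have "K *v v \<noteq> 0"
      using v(1) matrix_left_invertible_ker [of K] matrix_inv_works(2) [OF assms(2)] by blast
    ultimately show ?thesis unfolding is_eigenvalue_def by blast
  qed
  then show ?thesis using assms(1) unfolding non_resonant_def by blast
qed

lemma mat_exp_similar:
  fixes A K :: "complex ^ 'k ^ 'k"
  assumes "invertible K"
  shows "mat_exp (mat_scale c A) ** K = K ** mat_exp (mat_scale c (matrix_inv K ** A ** K))"
  by (rule matrix_mult_mat_exp [symmetric])
    (simp add: mat_algebra, simp add: matrix_mul_assoc matrix_inv_works(1) [OF assms])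

lemma germ_eq_mult_const:
  "germ_eq p f U g W \<Longrightarrow> germ_eq p (\<lambda>z. f z ** E) U (\<lambda>z. g z ** E) W"
  unfolding germ_eq_def by (erule ex_forward) auto

lemma sphere_holomorphic_mult_const:
  "sphere_holomorphic_on f U \<Longrightarrow> sphere_holomorphic_on (\<lambda>z. f z ** E) U"
  unfolding sphere_holomorphic_on_def matrix_mult_nth by (auto intro!: holomorphic_intros)

lemma pathin_reverse:
  assumes "pathin X \<alpha>" shows "pathin X (\<lambda>s. \<alpha> (1 - s))"
proof -
  have "continuous_map (top_of_set {0..1}) (top_of_set {0..1}) (\<lambda>s::real. 1 - s)"
    by (auto intro!: continuous_intros)
  from continuous_map_compose [OF this assms [unfolded pathin_def]] show ?thesis
    by (simp add: pathin_def o_def)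
qed

text \<open>The quotient is 1 minus a number of modulus less than 1. It serves to compare the
  arguments seen from \<open>t $ j\<close> and from \<open>t0 $ j\<close>, which differ by less than
  a right angle.\<close>

lemma Re_quotient_pos:
  assumes "cmod (b - a) < cmod (z - a)"
  shows "Re ((z - b) / (z - a)) > 0"
proof -
  have "z - a \<noteq> 0" using assms by auto
  then have "(z - b) / (z - a) = 1 - (b - a) / (z - a)" "cmod ((b - a) / (z - a)) < 1"
    using assms by (auto simp: field_simps norm_divide)
  then show ?thesis
    using abs_Re_le_cmod [of "(b - a) / (z - a)"] by simp
qed

locale pole_setup =
  fixes D :: "(complex ^ 'n::finite) set" and Q :: "'n \<Rightarrow> complex ^ 'n \<Rightarrow> complex ^ 'k::finite ^ 'k"
    and x0 :: "complex option" and t0 :: "complex ^ 'n" and j :: 'n and \<rho> \<delta> :: real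
    and G :: "complex \<times> (complex ^ 'n) \<Rightarrow> complex ^ 'k ^ 'k" and xj :: complex and U :: "complex option set"
    and Y :: "complex option \<times> (complex ^ 'n) \<Rightarrow> complex ^ 'k ^ 'k" and \<alpha> :: "real \<Rightarrow> complex option"
  assumes start: "start_element D Q x0 t0 xj \<delta> U Y \<alpha>"
    and G: "\<And>t x. t \<in> polydisc t0 \<delta> \<Longrightarrow> x \<in> ball (t $ j) \<rho> \<Longrightarrow> invertible (G (x, t)) \<and>
        (x \<noteq> t $ j \<longrightarrow> (\<forall>p. x \<noteq> t $ p) \<and>
           mat_deriv (\<lambda>x. G (x, t)) (fuchsian_coeff Q t x ** G (x, t) - mat_scale (1 / (x - t $ j)) (G (x, t) ** Q j t)) x)"
    and G_hol: "joint_holomorphic_on G {(x, t). t \<in> polydisc t0 \<delta> \<and> x \<in> ball (t $ j) \<rho>}"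
    and r: "\<delta> < cmod (xj - t0 $ j)" "cmod (xj - t0 $ j) < \<rho> - \<delta>"
begin

abbreviation "T \<equiv> polydisc t0 \<delta>"

text \<open>The connection matrix: with the logarithm normalized to 0 at \<open>xj\<close>, the
  continued solution is \<open>G\<close> times the power with exponent \<open>Q j t\<close> times
  \<open>K t\<close>. Moving \<open>K t\<close> to the left of the power turns the exponent into
  \<open>A t\<close>.\<close>

definition K where "K t = matrix_inv (G (xj, t)) ** Y (Some xj, t)"

definition A where "A t = matrix_inv (K t) ** Q j t ** K t"

text \<open>The circle has centre \<open>t0 $ j\<close>, not \<open>t $ j\<close>, because the loop
  must be the same for all \<open>t\<close>. Its radius exceeds \<open>\<delta>\<close>, so every
  admissible \<open>t $ j\<close> lies inside.\<close>

definition circ :: "real \<Rightarrow> complex" where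
  "circ s = t0 $ j + (xj - t0 $ j) * exp (2 * pi * \<i> * of_real s)"

definition loop :: "real \<Rightarrow> complex option" where
  "loop = path_join \<alpha> (path_join (Some \<circ> circ) (\<lambda>s. \<alpha> (1 - s)))"

lemma start_facts:
  "\<delta> > 0" "T \<subseteq> D" "pathin riemann_sphere \<alpha>" "\<alpha> 0 = x0" "\<alpha> 1 = Some xj"
  "s \<in> {0..1} \<Longrightarrow> \<alpha> s \<in> U" "s \<in> {0..1} \<Longrightarrow> \<alpha> s = Some x \<Longrightarrow> \<delta> < cmod (x - t0 $ p)"
  "t \<in> T \<Longrightarrow> solves_fuchsian_on Q t (\<lambda>z. Y (z, t)) U" "t \<in> T \<Longrightarrow> Y (x0, t) = mat 1"
  "t \<in> T \<Longrightarrow> z \<in> U \<Longrightarrow> invertible (Y (z, t))"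
  "joint_holomorphic_on (\<lambda>w. Y (Some xj, snd w)) (UNIV \<times> T)"
  using start unfolding start_element_def by blast+

lemma xj_U: "Some xj \<in> U"
  using start_facts(5) start_facts(6) [of 1] by simp

lemma near_pole:
  assumes t: "t \<in> T" and z: "cmod (z - t0 $ j) = cmod (xj - t0 $ j)"
  shows "z \<in> ball (t $ j) \<rho>" "z \<noteq> t $ j" "Re ((z - t $ j) / (z - t0 $ j)) > 0"
proof -
  have d: "cmod (t $ j - t0 $ j) < \<delta>"
    using t by (auto simp: polydisc_def dist_norm norm_minus_commute)
  have "cmod (z - t $ j) \<le> cmod (z - t0 $ j) + cmod (t $ j - t0 $ j)"
    using norm_triangle_ineq4 [of "z - t0 $ j" "t $ j - t0 $ j"] by simp
  then show "z \<in> ball (t $ j) \<rho>"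
    using d r z by (simp add: dist_norm norm_minus_commute)
  show "z \<noteq> t $ j" using d r z by auto
  show "Re ((z - t $ j) / (z - t0 $ j)) > 0"
    by (rule Re_quotient_pos) (use d r z in simp)
qed

lemma xj_near: "t \<in> T \<Longrightarrow> xj \<in> ball (t $ j) \<rho>" "t \<in> T \<Longrightarrow> xj \<noteq> t $ j"
  using near_pole [of t xj] by auto

lemma invertible_K: "t \<in> T \<Longrightarrow> invertible (K t)"
proof -
  assume t: "t \<in> T"
  have "invertible (G (xj, t))" using G [OF t xj_near(1) [OF t]] by blast
  then have "invertible (matrix_inv (G (xj, t)))"
    using matrix_inv_works unfolding invertible_def by blast
  then show ?thesis
    unfolding K_def using start_facts(10) [OF t xj_U] by (intro invertible_mult)
qed

lemma G_mult_K: "t \<in> T \<Longrightarrow> G (xj, t) ** K t = Y (Some xj, t)"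
  using G [OF _ xj_near(1)] by (simp add: K_def matrix_mul_assoc matrix_inv_works)

lemma log_solution: "t \<in> T \<Longrightarrow> log_solution (\<lambda>x. G (x, t)) (Q j t) (t $ j) \<rho> Q t"
  by unfold_locales (use G in blast)+

abbreviation "pole_elt t l0 \<equiv> log_element (\<lambda>x. G (x, t)) (Q j t) (K t) (t $ j) l0"

text \<open>By the choice of \<open>K t\<close> both solutions take the same value at
  \<open>xj\<close>, whatever the normalization \<open>l0\<close>.\<close>

lemma start_germ:
  assumes t: "t \<in> T"
  shows "germ_eq (Some xj) (\<lambda>z. Y (z, t)) U (pole_elt t l0 l0 xj) (Some ` log_domain (t $ j) \<rho> xj)"
proof (rule solves_fuchsian_germ_unique)
  interpret log_solution "\<lambda>x. G (x, t)" "Q j t" "K t" "t $ j" l0 \<rho> Q t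
    by (rule log_solution [OF t])
  show "solves_fuchsian_on Q t (pole_elt t l0 l0 xj) (Some ` log_domain (t $ j) \<rho> xj)"
    by (rule log_element_solves [OF xj_near(2) [OF t]])
  show "Some xj \<in> Some ` log_domain (t $ j) \<rho> xj"
    using log_domain_centre xj_near [OF t] by blast
  show "Y (Some xj, t) = pole_elt t l0 l0 xj (Some xj)"
    using xj_near(2) [OF t] by (simp add: log_element_def G_mult_K [OF t])
qed (use start_facts t xj_U in auto)

lemma exp_Q_K: "t \<in> T \<Longrightarrow> mat_exp (mat_scale c (Q j t)) ** K t = K t ** mat_exp (mat_scale c (A t))"
  unfolding A_def by (rule mat_exp_similar [OF invertible_K])

text \<open>The increment \<open>l 1 - l 0\<close> occurs because the elements are normalized at
  \<open>xj\<close>; the choice of a branch is postponed to the factor \<open>H\<close> of the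
  theorem. The exponent may still depend on \<open>t\<close>.\<close>

lemma continued_solution_near_pole:
  assumes t: "t \<in> T" and \<mu>: "path \<mu>" "\<mu> 0 = xj" "path_image \<mu> \<subseteq> ball (t $ j) \<rho> - {t $ j}"
    and l: "continuous_on {0..1} l" "\<And>s. s \<in> {0..1} \<Longrightarrow> exp (l s) = \<mu> s - t $ j"
  shows "continued_solution Q x0 t (path_join \<alpha> (Some \<circ> \<mu>)) =
    G (\<mu> 1, t) ** K t ** mat_exp (mat_scale (l 1 - l 0) (A t))"
proof -
  interpret log_solution "\<lambda>x. G (x, t)" "Q j t" "K t" "t $ j" "l 0" \<rho> Q t
    by (rule log_solution [OF t])
  let ?u = "\<lambda>s. if s \<le> 1 / 2 then (\<lambda>z. Y (z, t)) else pole_elt t (l 0) (l (2 * s - 1)) (\<mu> (2 * s - 1))"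
  let ?U = "\<lambda>s. if s \<le> 1 / 2 then U else Some ` log_domain (t $ j) \<rho> (\<mu> (2 * s - 1))"
  have C: "analytic_continuation_along (path_join \<alpha> (Some \<circ> \<mu>)) ?u ?U"
  proof (rule analytic_continuation_path_join [OF pathin_Some [OF \<mu>(1)]])
    show "analytic_continuation_along \<alpha> (\<lambda>_. \<lambda>z. Y (z, t)) (\<lambda>_. U)"
      by (rule analytic_continuation_const) (use start_facts(6,8) t in \<open>auto simp: solves_fuchsian_on_def\<close>)
    show "analytic_continuation_along (Some \<circ> \<mu>) (\<lambda>s. pole_elt t (l 0) (l s) (\<mu> s)) (\<lambda>s. Some ` log_domain (t $ j) \<rho> (\<mu> s))"
      by (rule analytic_continuation_log_element [OF \<mu>(1,3) l])
    show "germ_eq ((Some \<circ> \<mu>) 0) (\<lambda>z. Y (z, t)) U (pole_elt t (l 0) (l 0) (\<mu> 0)) (Some ` log_domain (t $ j) \<rho> (\<mu> 0))"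
      using start_germ [OF t, of "l 0"] \<mu>(2) by simp
  qed (simp add: start_facts(5) \<mu>(2))
  have "continued_solution Q x0 t (path_join \<alpha> (Some \<circ> \<mu>)) = ?u 1 (path_join \<alpha> (Some \<circ> \<mu>) 1)"
  proof (rule continued_solution_eqI [OF _ _ C])
    show "pathin riemann_sphere (path_join \<alpha> (Some \<circ> \<mu>))"
      by (rule pathin_path_join [OF start_facts(3) pathin_Some [OF \<mu>(1)]]) (simp add: start_facts(5) \<mu>(2))
    show "path_join \<alpha> (Some \<circ> \<mu>) 0 = x0" by (simp add: path_join_def start_facts(4))
  qed (use start_facts t in auto)
  also have "\<dots> = G (\<mu> 1, t) ** mat_exp (mat_scale (l 1 - l 0) (Q j t)) ** K t"
  proof -
    have "\<mu> 1 \<in> path_image \<mu>" by (simp add: path_image_def)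
    then have "\<mu> 1 \<noteq> t $ j" using \<mu>(3) by blast
    then show ?thesis by (simp add: path_join_def log_element_def)
  qed
  finally show ?thesis
    by (simp add: matrix_mul_assoc [symmetric] exp_Q_K [OF t])
qed

lemma circ_facts:
  "circ 0 = xj" "circ 1 = xj" "path circ" "cmod (circ s - t0 $ j) = cmod (xj - t0 $ j)"
proof -
  show "circ 0 = xj" "circ 1 = xj" by (simp_all add: circ_def exp_eq_1)
  show "path circ" unfolding path_def circ_def by (intro continuous_intros)
  show "cmod (circ s - t0 $ j) = cmod (xj - t0 $ j)"
    by (simp add: circ_def norm_mult)
qed

lemma pathin_loop: "pathin riemann_sphere loop" "loop 0 = x0" "loop 1 = x0"
proof -
  show "pathin riemann_sphere loop"
    unfolding loop_def
    by (intro pathin_path_join start_facts(3) pathin_Some pathin_reverse circ_facts(3))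
      (simp_all add: start_facts(5) circ_facts path_join_def)
  show "loop 0 = x0" "loop 1 = x0" by (simp_all add: loop_def path_join_def start_facts(4))
qed

lemma loop_avoids:
  assumes "s \<in> {0..1}"
  shows "loop s \<noteq> Some (t0 $ p)"
proof -
  have \<alpha>: "\<alpha> s \<noteq> Some (t0 $ p)" if "s \<in> {0..1}" for s
    using start_facts(7) [OF that, of "t0 $ p" p] start_facts(1) by auto
  have circ: "circ s \<noteq> t0 $ p" for s
    using G [of t0 "circ s"] near_pole [of t0 "circ s"] circ_facts(4) start_facts(1) by auto
  show ?thesis
    using assms \<alpha> circ by (auto simp: loop_def path_join_def)
qed

text \<open>One turn adds \<open>2 * pi * \<i>\<close> to the logarithm, which multiplies the
  element by \<open>E\<close> on the right. Right multiplication by a constant is compatible with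
  continuation, so the way back ends with \<open>Y (x0, t) ** E = E\<close>.\<close>

lemma monodromy_loop:
  assumes t: "t \<in> T"
  shows "continued_solution Q x0 t loop = mat_exp (mat_scale (2 * pi * \<i>) (A t))"
proof -
  \<comment> \<open>A logarithm of \<open>circ s - t $ j\<close>: the last two terms form one of
    \<open>circ s - t0 $ j\<close>, and the first corrects the centre by a quotient with positive
    real part, so that the principal branch is continuous.\<close>
  define l where "l s = Ln ((circ s - t $ j) / (circ s - t0 $ j)) + 2 * pi * \<i> * of_real s + Ln (xj - t0 $ j)" for s
  define E where "E = mat_exp (mat_scale (2 * pi * \<i>) (A t))"
  have xj0: "xj - t0 $ j \<noteq> 0" using r start_facts(1) by auto
  have c0: "circ s - t0 $ j \<noteq> 0" for s using circ_facts(4) [of s] xj0 by (metis norm_eq_zero)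
  have near: "circ s \<in> ball (t $ j) \<rho>" "circ s \<noteq> t $ j" "Re ((circ s - t $ j) / (circ s - t0 $ j)) > 0" for s
    using near_pole [OF t circ_facts(4)] by auto
  have l_cont: "continuous_on {0..1} l"
  proof -
    have "continuous_on {0..1} circ" using circ_facts(3) by (simp add: path_def)
    moreover have "(circ s - t $ j) / (circ s - t0 $ j) \<notin> \<real>\<^sub>\<le>\<^sub>0" for s
      using near(3) [of s] by (auto simp: complex_nonpos_Reals_iff)
    ultimately show ?thesis
      unfolding l_def using c0 by (intro continuous_intros) auto
  qed
  have l_exp: "exp (l s) = circ s - t $ j" for s
  proof -
    have "exp (l s) = (circ s - t $ j) / (circ s - t0 $ j) * (exp (2 * pi * \<i> * of_real s) * (xj - t0 $ j))"
      unfolding l_def exp_add using near(2) [of s] c0 [of s] xj0 by simp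
    also have "exp (2 * pi * \<i> * of_real s) * (xj - t0 $ j) = circ s - t0 $ j" by (simp add: circ_def)
    finally show ?thesis using c0 [of s] by simp
  qed
  have l1: "l 1 = l 0 + 2 * pi * \<i>" by (simp add: l_def circ_facts)
  interpret log_solution "\<lambda>x. G (x, t)" "Q j t" "K t" "t $ j" "l 0" \<rho> Q t
    by (rule log_solution [OF t])
  have EK: "mat_exp (mat_scale (2 * pi * \<i>) (Q j t)) ** K t = K t ** E"
    unfolding E_def by (rule exp_Q_K [OF t])
  have turn: "pole_elt t (l 0) (l 1) xj z = pole_elt t (l 0) (l 0) xj z ** E" for z
  proof (cases z)
    case (Some x)
    have "l 1 + Ln ((x - t $ j) / (xj - t $ j)) - l 0 = (l 0 + Ln ((x - t $ j) / (xj - t $ j)) - l 0) + 2 * pi * \<i>"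
      by (simp add: l1)
    then show ?thesis
      by (simp only: Some log_element_def option.case mat_exp_scale_add matrix_mul_assoc [symmetric] EK)
  qed (simp add: log_element_def)
  have germ1: "germ_eq (Some xj) (pole_elt t (l 0) (l 1) (circ 1)) (Some ` log_domain (t $ j) \<rho> (circ 1)) (\<lambda>z. Y (z, t) ** E) U"
  proof -
    have "pole_elt t (l 0) (l 1) xj = (\<lambda>z. pole_elt t (l 0) (l 0) xj z ** E)"
      by (rule ext) (rule turn)
    then show ?thesis
      unfolding circ_facts(2)
      using germ_eq_mult_const [OF germ_eq_sym [OF start_germ [OF t, of "l 0"]], of E] by simp
  qed
  have solY: "sphere_holomorphic_on (\<lambda>z. Y (z, t)) U"
    using start_facts(8) [OF t] by (simp add: solves_fuchsian_on_def)
  define \<beta> where "\<beta> = path_join (Some \<circ> circ) (\<lambda>s. \<alpha> (1 - s))"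
  define v where "v s = (if s \<le> 1 / 2 then pole_elt t (l 0) (l (2 * s)) (circ (2 * s)) else (\<lambda>z. Y (z, t) ** E))" for s
  define W where "W s = (if s \<le> 1 / 2 then Some ` log_domain (t $ j) \<rho> (circ (2 * s)) else U)" for s
  have p\<beta>: "pathin riemann_sphere \<beta>"
    unfolding \<beta>_def by (intro pathin_path_join pathin_Some pathin_reverse circ_facts start_facts)
      (simp add: circ_facts start_facts)
  have C\<beta>: "analytic_continuation_along \<beta> v W"
    unfolding \<beta>_def v_def W_def
  proof (rule analytic_continuation_path_join [OF pathin_reverse [OF start_facts(3)]])
    show "analytic_continuation_along (Some \<circ> circ) (\<lambda>s. pole_elt t (l 0) (l s) (circ s)) (\<lambda>s. Some ` log_domain (t $ j) \<rho> (circ s))"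
      by (rule analytic_continuation_log_element [OF circ_facts(3) _ l_cont l_exp]) (use near in \<open>auto simp: path_image_def\<close>)
    show "analytic_continuation_along (\<lambda>s. \<alpha> (1 - s)) (\<lambda>_. \<lambda>z. Y (z, t) ** E) (\<lambda>_. U)"
      by (rule analytic_continuation_const [OF sphere_holomorphic_mult_const [OF solY]]) (rule start_facts(6), auto)
    show "germ_eq (\<alpha> (1 - 0)) (pole_elt t (l 0) (l 1) (circ 1)) (Some ` log_domain (t $ j) \<rho> (circ 1)) (\<lambda>z. Y (z, t) ** E) U"
      using germ1 by (simp add: start_facts(5))
  qed (simp add: circ_facts start_facts(5))
  let ?u = "\<lambda>s. if s \<le> 1 / 2 then (\<lambda>z. Y (z, t)) else v (2 * s - 1)"
  let ?U = "\<lambda>s. if s \<le> 1 / 2 then U else W (2 * s - 1)"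
  have C: "analytic_continuation_along loop ?u ?U"
    unfolding loop_def \<beta>_def [symmetric]
  proof (rule analytic_continuation_path_join [OF p\<beta> _ C\<beta>])
    show "analytic_continuation_along \<alpha> (\<lambda>_. \<lambda>z. Y (z, t)) (\<lambda>_. U)"
      by (rule analytic_continuation_const [OF solY start_facts(6)])
    show "\<alpha> 1 = \<beta> 0" by (simp add: \<beta>_def path_join_def circ_facts start_facts(5))
    show "germ_eq (\<beta> 0) (\<lambda>z. Y (z, t)) U (v 0) (W 0)"
      using start_germ [OF t, of "l 0"] by (simp add: \<beta>_def path_join_def v_def W_def circ_facts)
  qed
  have "continued_solution Q x0 t loop = ?u 1 (loop 1)"
    by (rule continued_solution_eqI [OF pathin_loop(1,2) C]) (use start_facts t in auto)
  also have "\<dots> = E"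
    using start_facts(9) [OF t] by (simp add: v_def pathin_loop(3))
  finally show ?thesis by (simp add: E_def)
qed

lemma K_hol: "joint_holomorphic_on (\<lambda>w. K (snd w)) (UNIV \<times> T)"
  unfolding K_def
proof (intro joint_hol_mult joint_hol_matrix_inv)
  show "joint_holomorphic_on (\<lambda>w. G (xj, snd w)) (UNIV \<times> T)"
    by (rule joint_hol_compose_Pair [OF G_hol chol_const]) (use xj_near in auto)
  show "invertible (G (xj, snd w))" if "w \<in> UNIV \<times> T" for w
    using that G [OF _ xj_near(1), of "snd w"] by auto
qed (auto simp: start_facts(11) open_polydisc open_Times)

lemma A_hol:
  assumes "vec_holomorphic_on (Q j) D"
  shows "joint_holomorphic_on (\<lambda>w. A (snd w)) (UNIV \<times> T)"
  unfolding A_def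
proof (intro joint_hol_mult joint_hol_matrix_inv K_hol)
  show "joint_holomorphic_on (\<lambda>w. Q j (snd w)) (UNIV \<times> T)"
    by (rule joint_hol_subset [OF joint_hol_vec [OF assms]]) (use start_facts(2) in auto)
qed (auto simp: invertible_K open_polydisc open_Times)

end

section \<open>Choice of the radii and the isoprincipal factorization\<close>

lemma start_element_mono:
  assumes "start_element D Q x0 t0 xj \<delta> U Y \<alpha>" "0 < \<delta>'" "\<delta>' \<le> \<delta>"
  shows "start_element D Q x0 t0 xj \<delta>' U Y \<alpha>"
proof -
  have "polydisc t0 \<delta>' \<subseteq> polydisc t0 \<delta>" by (rule polydisc_mono [OF assms(3)])
  then show ?thesis
    using assms unfolding start_element_def
    by (auto intro: joint_hol_subset less_le_trans le_less_trans)
qed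

theorem lemma7p7:
  fixes D :: "(complex ^ 'n::finite) set"
    and Q :: "'n \<Rightarrow> complex ^ 'n \<Rightarrow> complex ^ 'k::finite ^ 'k"
    and x0 :: "complex option"
    and t0 :: "complex ^ 'n"
  assumes "open D" and "connected D" and "D \<subseteq> distinct_coords"
    and "\<And>p. vec_holomorphic_on (Q p) D"
    and "\<And>t. t \<in> D \<Longrightarrow> (\<Sum>p\<in>UNIV. Q p t) = 0"
    and "t0 \<in> D"
    and "\<And>j. Some (t0 $ j) \<noteq> x0"
    and "\<And>j. non_resonant (Q j t0)"
    and "isomonodromic_at D Q x0 t0"
  shows "isoprincipal_narrow_at D Q x0 t0"
  unfolding isoprincipal_narrow_at_def
proof (intro allI)
  fix j
  note Q = assms(4)
  obtain \<rho> \<delta>1 G where \<rho>: "\<rho> > 0" "ereal \<rho> \<le> half_gap t0 j" and \<delta>1: "\<delta>1 > 0" "polydisc t0 \<delta>1 \<subseteq> D"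
    and G_hol: "joint_holomorphic_on G {(x, t). t \<in> polydisc t0 \<delta>1 \<and> x \<in> ball (t $ j) \<rho>}"
    and G: "\<forall>t\<in>polydisc t0 \<delta>1. \<forall>x\<in>ball (t $ j) \<rho>. invertible (G (x, t)) \<and>
        (x \<noteq> t $ j \<longrightarrow> (\<forall>p. x \<noteq> t $ p) \<and>
           mat_deriv (\<lambda>x. G (x, t)) (fuchsian_coeff Q t x ** G (x, t) - mat_scale (1 / (x - t $ j)) (G (x, t) ** Q j t)) x)"
    using singular_local_solution [where Q = Q and j = j, OF assms(1,3,6) Q assms(8)] by blast
  \<comment> \<open>Distances between \<open>\<rho> / 4\<close> and \<open>\<rho> / 2\<close>,
    together with \<open>\<delta>' \<le> \<rho> / 8\<close>, leave room for all inequalities on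
    \<open>xj\<close> in the definition.\<close>
  define S where "S = ball (t0 $ j) (\<rho> / 2) - cball (t0 $ j) (\<rho> / 4)"
  have S: "open S" by (simp add: S_def open_Diff)
  have "t0 $ j + of_real (3 * \<rho> / 8) \<in> S" using \<rho> by (simp add: S_def dist_norm norm_mult norm_divide)
  then have Sne: "S \<noteq> {}" by blast
  have "\<exists>xj\<in>S. \<exists>\<delta> U Y \<alpha>. start_element D Q x0 t0 xj \<delta> U Y \<alpha>"
  proof (cases x0)
    case None
    then show ?thesis
      using start_element_infinite [where Q = Q, OF assms(1,6,3) Q assms(5) S Sne] by simp
  next
    case (Some a)
    then have "a \<noteq> t0 $ p" for p using assms(7) [of p] by auto
    then show ?thesis
      unfolding Some using start_element_finite [where Q = Q and a = a, OF assms(1,6) Q _ S Sne] by blast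
  qed
  then obtain xj \<delta>2 U Y \<alpha> where xj: "xj \<in> S" and start2: "start_element D Q x0 t0 xj \<delta>2 U Y \<alpha>"
    by blast
  have \<delta>2: "\<delta>2 > 0" using start2 by (simp add: start_element_def)
  define \<delta>' where "\<delta>' = min \<delta>1 (min \<delta>2 (\<rho> / 8))"
  have \<delta>': "\<delta>' > 0" "\<delta>' \<le> \<delta>1" "\<delta>' \<le> \<delta>2" "\<delta>' \<le> \<rho> / 8"
    using \<rho> \<delta>1 \<delta>2 by (auto simp: \<delta>'_def)
  have r: "\<rho> / 4 < cmod (xj - t0 $ j)" "cmod (xj - t0 $ j) < \<rho> / 2"
    using xj by (auto simp: S_def dist_norm norm_minus_commute)
  have sub1: "polydisc t0 \<delta>' \<subseteq> polydisc t0 \<delta>1" by (rule polydisc_mono [OF \<delta>'(2)])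
  interpret pole_setup D Q x0 t0 j \<rho> \<delta>' G xj U Y \<alpha>
  proof
    show "start_element D Q x0 t0 xj \<delta>' U Y \<alpha>"
      by (rule start_element_mono [OF start2 \<delta>'(1,3)])
    show "joint_holomorphic_on G {(x, t). t \<in> polydisc t0 \<delta>' \<and> x \<in> ball (t $ j) \<rho>}"
      by (rule joint_hol_subset [OF G_hol]) (use sub1 in auto)
    show "invertible (G (x, t)) \<and>
        (x \<noteq> t $ j \<longrightarrow> (\<forall>p. x \<noteq> t $ p) \<and>
           mat_deriv (\<lambda>x. G (x, t)) (fuchsian_coeff Q t x ** G (x, t) - mat_scale (1 / (x - t $ j)) (G (x, t) ** Q j t)) x)"
      if "t \<in> polydisc t0 \<delta>'" "x \<in> ball (t $ j) \<rho>" for t x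
      using G sub1 that by blast
  qed (use r \<delta>' in auto)
  \<comment> \<open>The hypothesis of isomonodromy enters here, through the loop around
    \<open>t0 $ j\<close>; its radius may be smaller than that of the local solutions.\<close>
  obtain \<delta>3 where \<delta>3: "\<delta>3 > 0"
    "\<And>t. t \<in> polydisc t0 \<delta>3 \<Longrightarrow> continued_solution Q x0 t loop = continued_solution Q x0 t0 loop"
  proof -
    have "pathin riemann_sphere loop \<and> loop 0 = x0 \<and> loop 1 = x0 \<and> (\<forall>s\<in>{0..1}. \<forall>p. loop s \<noteq> Some (t0 $ p))"
      by (intro conjI ballI allI pathin_loop loop_avoids)
    with assms(9) [unfolded isomonodromic_at_def, THEN spec, of loop]
    have "\<exists>\<delta>>0. polydisc t0 \<delta> \<subseteq> D \<and> (\<forall>t\<in>polydisc t0 \<delta>. \<forall>s\<in>{0..1}. \<forall>p. loop s \<noteq> Some (t $ p)) \<and>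
        (\<forall>t\<in>polydisc t0 \<delta>. continued_solution Q x0 t loop = continued_solution Q x0 t0 loop)"
      by (rule mp)
    then obtain \<delta> where "\<delta> > 0"
      and \<delta>: "\<forall>t\<in>polydisc t0 \<delta>. continued_solution Q x0 t loop = continued_solution Q x0 t0 loop"
      by (elim exE conjE)
    show ?thesis by (rule that [OF \<open>\<delta> > 0\<close>]) (rule bspec [OF \<delta>])
  qed
  \<comment> \<open>\<open>A\<close> is continuous at \<open>t0\<close>, which gives the closeness
    that \<open>mat_exp_eq_near\<close> asks for.\<close>
  obtain \<delta>4 where \<delta>4: "\<delta>4 > 0" "\<And>t. t \<in> polydisc t0 \<delta>4 \<Longrightarrow> norm (A t0 - A t) < 1 / 32"
    using eventually_polydisc [OF eventually_near [OF joint_hol_continuous_on [OF A_hol [OF Q]] open_polydisc, of t0 "1 / 32"]] \<delta>'(1) by auto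
  define \<delta> where "\<delta> = min \<delta>' (min \<delta>3 \<delta>4)"
  have \<delta>: "\<delta> > 0" "\<delta> \<le> \<delta>'" "\<delta> \<le> \<delta>3" "\<delta> \<le> \<delta>4"
    using \<delta>' \<delta>3 \<delta>4 by (auto simp: \<delta>_def)
  have sub: "t \<in> polydisc t0 \<delta> \<Longrightarrow> t \<in> T" for t
    using polydisc_mono [OF \<delta>(2), of t0] by blast
  have t0T: "t0 \<in> T" using \<delta>'(1) by simp
  have A_const: "A t = A t0" if t: "t \<in> polydisc t0 \<delta>" for t
  proof (rule mat_exp_eq_near [symmetric])
    show "non_resonant (A t0)"
      unfolding A_def by (rule non_resonant_similar [OF assms(8) invertible_K [OF t0T]])
    show "norm (A t0 - A t) < 1 / 32"
      using \<delta>4(2) polydisc_mono [OF \<delta>(4), of t0] t by blast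
    show "mat_exp (mat_scale (2 * pi * \<i>) (A t0)) = mat_exp (mat_scale (2 * pi * \<i>) (A t))"
      using \<delta>3(2) [of t] polydisc_mono [OF \<delta>(3), of t0] t
      by (auto simp: monodromy_loop [OF sub [OF t]] monodromy_loop [OF t0T])
  qed
  have fact: "\<exists>H A. joint_holomorphic_on H {(x, t). t \<in> polydisc t0 \<delta> \<and> x \<in> ball (t $ j) \<rho>} \<and>
             (\<forall>t\<in>polydisc t0 \<delta>. \<forall>x\<in>ball (t $ j) \<rho>. invertible (H (x, t))) \<and>
             (\<forall>t\<in>polydisc t0 \<delta>. \<forall>\<mu> l.
                path \<mu> \<and> \<mu> 0 = xj \<and> path_image \<mu> \<subseteq> ball (t $ j) \<rho> - {t $ j} \<and>
                log_along (t $ j) \<theta> \<mu> l \<longrightarrow>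
                continued_solution Q x0 t (path_join \<alpha> (Some \<circ> \<mu>)) =
                  H (\<mu> 1, t) ** mat_exp (mat_scale (l 1) A))"
    if \<theta>: "is_Arg (xj - t0 $ j) \<theta>" for \<theta>
  proof -
    define r0 where "r0 = cmod (xj - t0 $ j)"
    have r0: "r0 > 0" using r(1) start_facts(1) unfolding r0_def by linarith
    \<comment> \<open>The logarithm of \<open>xj - t $ j\<close> with argument near
      \<open>\<theta>\<close>: at \<open>t0\<close> it is fixed through \<open>\<theta>\<close>, and
      the quotient, of positive real part, has a principal logarithm that is holomorphic in
      \<open>t\<close>.\<close>
    define lt where "lt t = Ln ((xj - t $ j) / (xj - t0 $ j)) + (of_real (ln r0) + \<i> * of_real \<theta>)" for t :: "complex ^ 'n"
    have Re_pos: "Re ((xj - t $ j) / (xj - t0 $ j)) > 0" if "t \<in> polydisc t0 \<delta>" for t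
      using near_pole(3) [OF sub [OF that]] by simp
    \<comment> \<open>\<open>H\<close> absorbs the inverse of the power at \<open>xj\<close>: with
      the constant exponent \<open>A t0\<close>, the power for the increment
      \<open>l 1 - l 0\<close> splits into the factors for \<open>- lt t\<close> and for
      \<open>l 1\<close>.\<close>
    define H where "H w = G w ** K (snd w) ** mat_exp (mat_scale (- lt (snd w)) (A t0))" for w
    let ?S = "{(x, t). t \<in> polydisc t0 \<delta> \<and> x \<in> ball (t $ j) \<rho>}"
    have "joint_holomorphic_on H ?S"
      unfolding H_def
    proof (intro joint_hol_mult)
      show "joint_holomorphic_on G ?S"
        by (rule joint_hol_subset [OF local.G_hol]) (use sub in auto)
      show "joint_holomorphic_on (\<lambda>w. K (snd w)) ?S"
        by (rule joint_hol_subset [OF K_hol]) (use sub in auto)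
      have "chol (\<lambda>w. (xj - snd w $ j) / (xj - t0 $ j)) ?S"
        using r0 by (intro chol_divide chol_diff chol_const chol_coord) (auto simp: r0_def)
      then have "chol (\<lambda>w. Ln ((xj - snd w $ j) / (xj - t0 $ j))) ?S"
      proof (rule chol_compose_field [where g = Ln])
        fix z assume "z \<in> ?S"
        then have "Re ((xj - snd z $ j) / (xj - t0 $ j)) > 0" using Re_pos by auto
        then show "Ln field_differentiable at ((xj - snd z $ j) / (xj - t0 $ j))"
          by (intro field_differentiable_at_Ln) (auto simp: complex_nonpos_Reals_iff)
      qed
      then have lt: "chol (\<lambda>w. - lt (snd w)) ?S"
        unfolding lt_def by (intro chol_minus chol_add chol_const)
      show "joint_holomorphic_on (\<lambda>w. mat_exp (mat_scale (- lt (snd w)) (A t0))) ?S"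
        unfolding joint_holomorphic_on_chol
      proof (intro allI)
        fix i i'
        show "chol (\<lambda>w. mat_exp (mat_scale (- lt (snd w)) (A t0)) $ i $ i') ?S"
          by (rule chol_compose_field [OF lt, where g = "\<lambda>c. mat_exp (mat_scale c (A t0)) $ i $ i'"])
            (use mat_deriv_exp [of "A t0"] in \<open>unfold mat_deriv_def field_differentiable_def, blast\<close>)
      qed
    qed
    moreover have "invertible (H (x, t))" if "t \<in> polydisc t0 \<delta>" "x \<in> ball (t $ j) \<rho>" for t x
      unfolding H_def using local.G [OF sub [OF that(1)] that(2)] invertible_K [OF sub [OF that(1)]]
      by (auto intro!: invertible_mult invertible_mat_exp)
    moreover have "continued_solution Q x0 t (path_join \<alpha> (Some \<circ> \<mu>)) = H (\<mu> 1, t) ** mat_exp (mat_scale (l 1) (A t0))"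
      if t: "t \<in> polydisc t0 \<delta>" and \<mu>: "path \<mu>" "\<mu> 0 = xj" "path_image \<mu> \<subseteq> ball (t $ j) \<rho> - {t $ j}"
        and log: "log_along (t $ j) \<theta> \<mu> l" for t \<mu> l
    proof -
      have l: "continuous_on {0..1} l" "\<And>s. s \<in> {0..1} \<Longrightarrow> exp (l s) = \<mu> s - t $ j"
        and "\<theta> - pi / 2 < Im (l 0)" "Im (l 0) < \<theta> + pi / 2"
        using log by (auto simp: log_along_def)
      then have Im_l: "\<bar>Im (l 0) - \<theta>\<bar> < pi / 2" by linarith
      have "xj - t0 $ j = of_real r0 * exp (\<i> * of_real \<theta>)"
        using \<theta> by (simp add: is_Arg_def r0_def)
      then have "exp (lt t) = (xj - t $ j) / (xj - t0 $ j) * (xj - t0 $ j)"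
        unfolding lt_def exp_add using xj_near(2) [OF sub [OF t]] r0 by (simp add: exp_of_real)
      then have "exp (lt t) = exp (l 0)"
        using r0 l(2) [of 0] \<mu>(2) by (auto simp: r0_def)
      then have "exp (l 0 - lt t) = 1" by (simp add: exp_diff)
      then obtain n :: int where n: "Re (l 0 - lt t) = 0" "Im (l 0 - lt t) = of_int (2 * n) * pi"
        unfolding exp_eq_1 by blast
      have "\<bar>Im (Ln ((xj - t $ j) / (xj - t0 $ j)))\<bar> < pi / 2"
        by (rule Re_Ln_pos_lt_imp [OF Re_pos [OF t]])
      then have "\<bar>Im (lt t) - \<theta>\<bar> < pi / 2" by (simp add: lt_def)
      \<comment> \<open>Both arguments are within a right angle of \<open>\<theta>\<close>, so they
        differ by less than \<open>pi\<close>, and a difference that is a multiple of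
        \<open>2 * pi\<close> must be 0.\<close>
      then have "\<bar>Im (l 0 - lt t)\<bar> < pi" using Im_l unfolding minus_complex.sel by linarith
      then have "pi * \<bar>2 * real_of_int n\<bar> < pi * 1"
        unfolding n(2) by (simp add: abs_mult mult_ac)
      then have "\<bar>2 * real_of_int n\<bar> < 1"
        by (rule mult_left_less_imp_less) simp
      then have "n = 0" by linarith
      then have l0: "l 0 = lt t" using n by (simp add: complex_eq_iff)
      have "mat_exp (mat_scale (l 1 - l 0) (A t)) = mat_exp (mat_scale (- lt t) (A t0)) ** mat_exp (mat_scale (l 1) (A t0))"
        unfolding A_const [OF t] mat_exp_scale_add [symmetric] l0 by simp
      then show ?thesis
        using continued_solution_near_pole [OF sub [OF t] \<mu> l] by (simp add: H_def matrix_mul_assoc)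
    qed
    ultimately show ?thesis by blast
  qed
  show "\<exists>\<rho> \<delta> xj \<alpha>.
        0 < \<rho> \<and> ereal \<rho> \<le> half_gap t0 j \<and> 0 < 2 * \<delta> \<and> 2 * \<delta> < \<rho> \<and> polydisc t0 \<delta> \<subseteq> D \<and>
        \<delta> < cmod (xj - t0 $ j) \<and> cmod (xj - t0 $ j) < \<rho> - \<delta> \<and>
        pathin riemann_sphere \<alpha> \<and> \<alpha> 0 = x0 \<and> \<alpha> 1 = Some xj \<and>
        (\<forall>s\<in>{0..1}. \<forall>z p. \<alpha> s = Some z \<longrightarrow> cmod (z - t0 $ p) > \<delta>) \<and>
        (\<forall>\<theta>. is_Arg (xj - t0 $ j) \<theta> \<longrightarrow>
          (\<exists>H A.
             joint_holomorphic_on H {(x, t). t \<in> polydisc t0 \<delta> \<and> x \<in> ball (t $ j) \<rho>} \<and>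
             (\<forall>t\<in>polydisc t0 \<delta>. \<forall>x\<in>ball (t $ j) \<rho>. invertible (H (x, t))) \<and>
             (\<forall>t\<in>polydisc t0 \<delta>. \<forall>\<mu> l.
                path \<mu> \<and> \<mu> 0 = xj \<and> path_image \<mu> \<subseteq> ball (t $ j) \<rho> - {t $ j} \<and>
                log_along (t $ j) \<theta> \<mu> l \<longrightarrow>
                continued_solution Q x0 t (path_join \<alpha> (Some \<circ> \<mu>)) =
                  H (\<mu> 1, t) ** mat_exp (mat_scale (l 1) A))))"
  proof (intro exI conjI)
    show "2 * \<delta> < \<rho>" "\<delta> < cmod (xj - t0 $ j)" "cmod (xj - t0 $ j) < \<rho> - \<delta>" "0 < 2 * \<delta>"
      using \<delta> \<delta>' r \<rho> by auto
    show "polydisc t0 \<delta> \<subseteq> D" using sub start_facts(2) by blast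
    show "\<forall>s\<in>{0..1}. \<forall>z p. \<alpha> s = Some z \<longrightarrow> cmod (z - t0 $ p) > \<delta>"
      using start_facts(7) \<delta>(2) by (meson le_less_trans)
  qed (use \<rho> start_facts fact in blast)+
qed

end
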